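(* Let $\mathrm T_d$ be the $d$-dimensional algebraic torus over $\overline{\mathbb Q}$ with coordinates $x_1,\dots,x_d$. There exists a unique $\mathbb Q$-linear map $$\mathrm K\colon\mathrm{St}_d(\mathbb Q)\longrightarrow\overline K_d(\mathrm T_d)$$ such that for every integral apartment $[v_1,\dots,v_d]\in\mathrm{St}_d(\mathbb Q)$ we have $$\mathrm K([v_1,\dots,v_d])=\{1-x^{v_1},\dots,1-x^{v_d}\}\in\overline K_d(\mathrm T_d).$$
   Context: **Steinberg module.** $\mathrm{St}_d(\mathbb Q)=\widetilde H_{d-2}(\mathcal T_V,\mathbb Q)$ is the top reduced homology of the Tits building of $V=\mathbb Q^d$ ($=\mathbb Q$ for $d\le1$). Equivalently, it is the $\mathbb Q$-vector space generated by apartments $[v_1,\dots,v_d]$, $v_i\in\mathbb Q^d\setminus\{0\}$, which vanish for linearly dependent $v_i$, are skew-symmetric, are unchanged when a $v_i$ is multiplied by an element of $\mathbb Q^\times$, and satisfy $\sum_{i=0}^d(-1)^i[v_0,\dots,\widehat{v_i},\dots,v_d]=0$ for nonzero $v_0,\dots,v_d$. An apartment $[v_1,\dots,v_d]$ is integral if $v_i\in\mathbb Z^d$ and $\det(v_1,\dots,v_d)=\pm1$. For $v=(a_1,\dots,a_d)\in\mathbb Z^d$, $x^v=x_1^{a_1}\cdots x_d^{a_d}$. **Milnor $K$-theory.** $K^M_*(F)$ is the quotient of the tensor algebra (over $\mathbb Z$) of $F^\times$ by the ideal generated by $a\otimes(1-a)$, $a,1-a\in F^\times$; $\{a_1,\dots,a_n\}$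 is the class of $a_1\otimes\dots\otimes a_n$. For a torus $\mathrm T$ over $\overline{\mathbb Q}$ with character lattice $\mathrm X(\mathrm T)\subset\overline{\mathbb Q}(\mathrm T)^\times$, $$\overline K_n(\mathrm T)=\mathrm{Coker}\Bigl(K^M_{n-1}(\overline{\mathbb Q}(\mathrm T))\otimes\mathrm X(\mathrm T)\to K^M_n(\overline{\mathbb Q}(\mathrm T))\Bigr)\otimes_{\mathbb Z}\mathbb Q,$$ the map being induced by $\mathrm X(\mathrm T)\hookrightarrow K^M_1(\overline{\mathbb Q}(\mathrm T))$ and multiplication in the Milnor ring. *)

theory Defs
  imports
    "Jordan_Normal_Form.VS_Connect"
    "HOL-Algebra.Algebraic_Closure_Type"
    "HOL-Computational_Algebra.Fraction_Field"
    "HOL-Library.Poly_Mapping"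
    "HOL-Combinatorics.Permutations"
begin

section \<open>Vector spaces over the rationals by generators and relations\<close>

definition free_vs :: "'g set \<Rightarrow> (rat, 'g \<Rightarrow>\<^sub>0 rat) module" where
  "free_vs G =
    \<lparr>carrier = {f. Poly_Mapping.keys f \<subseteq> G}, monoid.mult = undefined, one = undefined,
     zero = 0, add = (+), module.smult = (\<lambda>c. Poly_Mapping.map ((*) c))\<rparr>"

abbreviation basis_elt :: "'g \<Rightarrow> ('g \<Rightarrow>\<^sub>0 rat)" where
  "basis_elt g \<equiv> Poly_Mapping.single g 1"

definition quotient_vs :: "(rat, 'v) module \<Rightarrow> 'v set \<Rightarrow> (rat, 'v set) module" where
  "quotient_vs V N =
    \<lparr>carrier = a_rcosets\<^bsub>V\<^esub> N, monoid.mult = undefined, one = undefined,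
     zero = N, add = set_add V, module.smult = (\<lambda>c A. \<Union>x\<in>A. N +>\<^bsub>V\<^esub> (c \<odot>\<^bsub>V\<^esub> x))\<rparr>"

definition presented_vs :: "'g set \<Rightarrow> ('g \<Rightarrow>\<^sub>0 rat) set \<Rightarrow> (rat, ('g \<Rightarrow>\<^sub>0 rat) set) module" where
  "presented_vs G R = quotient_vs (free_vs G) (LinearCombinations.module.span class_ring (free_vs G) R)"

definition presented_gen :: "'g set \<Rightarrow> ('g \<Rightarrow>\<^sub>0 rat) set \<Rightarrow> 'g \<Rightarrow> ('g \<Rightarrow>\<^sub>0 rat) set" where
  "presented_gen G R g = LinearCombinations.module.span class_ring (free_vs G) R +>\<^bsub>free_vs G\<^esub> basis_elt g"


section \<open>The Steinberg module\<close>

definition frames :: "nat \<Rightarrow> rat vec list set" where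
  "frames d = {vs. length vs = d \<and> set vs \<subseteq> carrier_vec d - {0\<^sub>v d}}"

text \<open>Linear dependence of a family, so repeated entries count as a dependence.\<close>

definition dependent_list :: "nat \<Rightarrow> rat vec list \<Rightarrow> bool" where
  "dependent_list d vs \<longleftrightarrow>
    \<not> distinct vs \<or> LinearCombinations.module.lin_dep class_ring (module_vec TYPE(rat) d) (set vs)"

definition steinberg_rels :: "nat \<Rightarrow> (rat vec list \<Rightarrow>\<^sub>0 rat) set" where
  "steinberg_rels d =
     {basis_elt vs | vs. vs \<in> frames d \<and> dependent_list d vs}
   \<union> {basis_elt (permute_list p vs) - Poly_Mapping.single vs (of_int (sign p)) | p vs.
        vs \<in> frames d \<and> p permutes {..<d}}
   \<union> {basis_elt (vs[i := c \<cdot>\<^sub>v (vs ! i)]) - basis_elt vs | vs i c.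
        vs \<in> frames d \<and> i < d \<and> c \<noteq> 0}
   \<union> {\<Sum>i\<le>d. Poly_Mapping.single (take i ws @ drop (Suc i) ws) ((-1) ^ i) | ws.
        length ws = Suc d \<and> set ws \<subseteq> carrier_vec d - {0\<^sub>v d}}"

definition steinberg :: "nat \<Rightarrow> (rat, (rat vec list \<Rightarrow>\<^sub>0 rat) set) module" where
  "steinberg d = presented_vs (frames d) (steinberg_rels d)"

definition apartment :: "nat \<Rightarrow> rat vec list \<Rightarrow> (rat vec list \<Rightarrow>\<^sub>0 rat) set" where
  "apartment d vs = presented_gen (frames d) (steinberg_rels d) vs"

definition integral_frame :: "nat \<Rightarrow> int vec list \<Rightarrow> bool" where
  "integral_frame d vs \<longleftrightarrow>
     length vs = d \<and> set vs \<subseteq> carrier_vec d \<and> det (mat_of_cols d vs) \<in> {1, -1}"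


section \<open>The tensor algebra of an abelian group\<close>

text \<open>Words under concatenation, written additively so that \<open>'a free_monoid \<Rightarrow>\<^sub>0 int\<close>
  with its library multiplication is the free associative ring on \<open>'a\<close>.\<close>

datatype 'a free_monoid = Word (letters: "'a list")

instantiation free_monoid :: (type) monoid_add
begin

definition zero_free_monoid :: "'a free_monoid" where
  "0 = Word []"

definition plus_free_monoid :: "'a free_monoid \<Rightarrow> 'a free_monoid \<Rightarrow> 'a free_monoid" where
  "u + v = Word (letters u @ letters v)"

instance
  by standard (simp_all add: zero_free_monoid_def plus_free_monoid_def)

end

definition free_ring :: "'a set \<Rightarrow> ('a free_monoid \<Rightarrow>\<^sub>0 int) ring" where
  "free_ring S =
    \<lparr>carrier = {f. \<forall>w\<in>Poly_Mapping.keys f. set (letters w) \<subseteq> S},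
     monoid.mult = (*), one = 1, zero = 0, add = (+)\<rparr>"

abbreviation word :: "'a list \<Rightarrow> ('a free_monoid \<Rightarrow>\<^sub>0 int)" where
  "word as \<equiv> Poly_Mapping.single (Word as) 1"

text \<open>The tensor algebra over the integers of an abelian group \<open>M\<close> (written multiplicatively):
  the free associative ring on the elements of \<open>M\<close>, with the group law of \<open>M\<close> made additive.\<close>

definition tensor_ideal :: "('a, 'm) monoid_scheme \<Rightarrow> ('a free_monoid \<Rightarrow>\<^sub>0 int) set" where
  "tensor_ideal M = Idl\<^bsub>free_ring (carrier M)\<^esub>
     {word [a \<otimes>\<^bsub>M\<^esub> b] - word [a] - word [b] | a b. a \<in> carrier M \<and> b \<in> carrier M}"

definition tensor_algebra :: "('a, 'm) monoid_scheme \<Rightarrow> ('a free_monoid \<Rightarrow>\<^sub>0 int) set ring" where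
  "tensor_algebra M = free_ring (carrier M) Quot tensor_ideal M"

definition tensor :: "('a, 'm) monoid_scheme \<Rightarrow> 'a list \<Rightarrow> ('a free_monoid \<Rightarrow>\<^sub>0 int) set" where
  "tensor M as = tensor_ideal M +>\<^bsub>free_ring (carrier M)\<^esub> word as"


section \<open>Milnor K-theory\<close>

definition steinberg_ideal :: "('a, 'm) ring_scheme \<Rightarrow> ('a free_monoid \<Rightarrow>\<^sub>0 int) set set" where
  "steinberg_ideal F = Idl\<^bsub>tensor_algebra (units_of F)\<^esub>
     {tensor (units_of F) [a, \<one>\<^bsub>F\<^esub> \<ominus>\<^bsub>F\<^esub> a] | a. a \<in> Units F \<and> \<one>\<^bsub>F\<^esub> \<ominus>\<^bsub>F\<^esub> a \<in> Units F}"

definition milnor_ring :: "('a, 'm) ring_scheme \<Rightarrow> ('a free_monoid \<Rightarrow>\<^sub>0 int) set set ring" where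
  "milnor_ring F = tensor_algebra (units_of F) Quot steinberg_ideal F"

definition milnor_symbol ::
    "('a, 'm) ring_scheme \<Rightarrow> 'a list \<Rightarrow> ('a free_monoid \<Rightarrow>\<^sub>0 int) set set" where
  "milnor_symbol F as =
     steinberg_ideal F +>\<^bsub>tensor_algebra (units_of F)\<^esub> tensor (units_of F) as"

text \<open>The degree \<open>n\<close> part, i.e. the image of the \<open>n\<close>-th tensor power.  For abelian groups
  constructed from it the group law is addition, although it occupies the \<open>mult\<close> field.\<close>

definition milnor_K ::
    "('a, 'm) ring_scheme \<Rightarrow> nat \<Rightarrow> ('a free_monoid \<Rightarrow>\<^sub>0 int) set set monoid" where
  "milnor_K F n = (add_monoid (milnor_ring F))
     \<lparr>carrier := generate (add_monoid (milnor_ring F))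
        {milnor_symbol F as | as. length as = n \<and> set as \<subseteq> Units F}\<rparr>"

text \<open>For \<open>S\<close> a subgroup of the units of \<open>F\<close>: the image of the homomorphism from
  \<open>K\<^sub>n\<^sub>-\<^sub>1(F) \<otimes> S\<close> to \<open>K\<^sub>n(F)\<close>
  sending \<open>y \<otimes> \<chi>\<close> to \<open>y \<cdot> {\<chi>}\<close>.  It is trivial for \<open>n = 0\<close>,
  as Milnor K-theory vanishes in degree \<open>-1\<close>.\<close>

definition milnor_product_image ::
    "('a, 'm) ring_scheme \<Rightarrow> 'a set \<Rightarrow> nat \<Rightarrow> ('a free_monoid \<Rightarrow>\<^sub>0 int) set set set" where
  "milnor_product_image F S n = generate (milnor_K F n)
     {y \<otimes>\<^bsub>milnor_ring F\<^esub> milnor_symbol F [\<chi>] | y \<chi> m.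
        n = Suc m \<and> y \<in> carrier (milnor_K F m) \<and> \<chi> \<in> S}"

definition milnor_coker ::
    "('a, 'm) ring_scheme \<Rightarrow> 'a set \<Rightarrow> nat \<Rightarrow> ('a free_monoid \<Rightarrow>\<^sub>0 int) set set set monoid" where
  "milnor_coker F S n = milnor_K F n Mod milnor_product_image F S n"

text \<open>Extension of scalars of an abelian group from the integers to the rationals:
  \<open>q\<close> times the generator \<open>a\<close> is the tensor \<open>a \<otimes> q\<close>.\<close>

definition tensor_rat_rels :: "('a, 'm) monoid_scheme \<Rightarrow> ('a \<Rightarrow>\<^sub>0 rat) set" where
  "tensor_rat_rels A =
     {basis_elt (a \<otimes>\<^bsub>A\<^esub> b) - basis_elt a - basis_elt b | a b. a \<in> carrier A \<and> b \<in> carrier A}"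

definition tensor_rat :: "('a, 'm) monoid_scheme \<Rightarrow> (rat, ('a \<Rightarrow>\<^sub>0 rat) set) module" where
  "tensor_rat A = presented_vs (carrier A) (tensor_rat_rels A)"

definition tensor_rat_one :: "('a, 'm) monoid_scheme \<Rightarrow> 'a \<Rightarrow> ('a \<Rightarrow>\<^sub>0 rat) set" where
  "tensor_rat_one A a = presented_gen (carrier A) (tensor_rat_rels A) a"


section \<open>The function field of a split torus\<close>

type_synonym Qbar = "rat alg_closure"

text \<open>Laurent polynomials in countably many variables; the coordinate ring of the
  \<open>d\<close>-dimensional torus consists of those involving only the first \<open>d\<close> variables.\<close>

type_synonym laurent = "(nat \<Rightarrow>\<^sub>0 int) \<Rightarrow>\<^sub>0 Qbar"

definition torus_coordinate_ring :: "nat \<Rightarrow> laurent set" where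
  "torus_coordinate_ring d = {p. \<forall>m\<in>Poly_Mapping.keys p. Poly_Mapping.keys m \<subseteq> {..<d}}"

definition torus_field :: "nat \<Rightarrow> laurent fract ring" where
  "torus_field d =
    \<lparr>carrier = {Fract p q | p q.
        p \<in> torus_coordinate_ring d \<and> q \<in> torus_coordinate_ring d \<and> q \<noteq> 0},
     monoid.mult = (*), one = 1, zero = 0, add = (+)\<rparr>"

definition torus_coord :: "nat \<Rightarrow> laurent fract" where
  "torus_coord i = Fract (Poly_Mapping.single (Poly_Mapping.single i 1) 1) 1"

definition torus_char :: "int vec \<Rightarrow> laurent fract" where
  "torus_char v = (\<Prod>i<dim_vec v. torus_coord i powi (v $ i))"

text \<open>The character lattice of the \<open>d\<close>-dimensional torus is the image of \<open>torus_char\<close> on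
  integer vectors of length \<open>d\<close>.\<close>

definition torus_K_coker ::
    "nat \<Rightarrow> nat \<Rightarrow> (laurent fract free_monoid \<Rightarrow>\<^sub>0 int) set set set monoid" where
  "torus_K_coker d n = milnor_coker (torus_field d) (torus_char ` carrier_vec d) n"

definition torus_K ::
    "nat \<Rightarrow> nat \<Rightarrow> (rat, ((laurent fract free_monoid \<Rightarrow>\<^sub>0 int) set set set \<Rightarrow>\<^sub>0 rat) set) module" where
  "torus_K d n = tensor_rat (torus_K_coker d n)"

definition torus_symbol ::
    "nat \<Rightarrow> laurent fract list \<Rightarrow> ((laurent fract free_monoid \<Rightarrow>\<^sub>0 int) set set set \<Rightarrow>\<^sub>0 rat) set" where
  "torus_symbol d as = tensor_rat_one (torus_K_coker d (length as))
     (milnor_product_image (torus_field d) (torus_char ` carrier_vec d) (length as)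
        #>\<^bsub>milnor_K (torus_field d) (length as)\<^esub> milnor_symbol (torus_field d) as)"


section \<open>Well-definedness\<close>

text \<open>The generated ideals above are intersections of ideals, and in particular only behave as
  expected because the ambient structures are rings; likewise the quotients are vector spaces.\<close>

lemma ring_free_ring: "ring (free_ring S)"
proof (rule ringI)
  show "abelian_group (free_ring S)"
  proof (rule abelian_groupI)
    fix x assume x: "x \<in> carrier (free_ring S)"
    then show "\<exists>y\<in>carrier (free_ring S). y \<oplus>\<^bsub>free_ring S\<^esub> x = \<zero>\<^bsub>free_ring S\<^esub>"
      by (intro bexI[of _ "- x"]) (auto simp: free_ring_def)
  next
    fix x y assume "x \<in> carrier (free_ring S)" "y \<in> carrier (free_ring S)"
    then show "x \<oplus>\<^bsub>free_ring S\<^esub> y \<in> carrier (free_ring S)"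
      using Poly_Mapping.keys_add[of x y] by (auto simp: free_ring_def)
  qed (auto simp: free_ring_def ac_simps)
  show "Group.monoid (free_ring S)"
  proof (rule monoidI)
    fix x y assume "x \<in> carrier (free_ring S)" "y \<in> carrier (free_ring S)"
    then show "x \<otimes>\<^bsub>free_ring S\<^esub> y \<in> carrier (free_ring S)"
      using keys_mult[of x y] by (fastforce simp: free_ring_def plus_free_monoid_def)
  qed (auto simp: free_ring_def mult.assoc zero_free_monoid_def keys_one)
qed (auto simp: free_ring_def algebra_simps)

lemma ideal_tensor_ideal:
  assumes "Group.monoid M"
  shows "ideal (tensor_ideal M) (free_ring (carrier M))"
  unfolding tensor_ideal_def
proof (rule ring.genideal_ideal[OF ring_free_ring], safe)
  fix a b assume "a \<in> carrier M" "b \<in> carrier M"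
  then show "word [a \<otimes>\<^bsub>M\<^esub> b] - word [a] - word [b] \<in> carrier (free_ring (carrier M))"
    using Group.monoid.m_closed[OF assms]
      keys_diff[of "word [a \<otimes>\<^bsub>M\<^esub> b] - word [a]" "word [b]"] keys_diff[of "word [a \<otimes>\<^bsub>M\<^esub> b]" "word [a]"]
    by (auto simp: free_ring_def split: if_splits dest!: subsetD)
qed

lemma ring_tensor_algebra: "Group.monoid M \<Longrightarrow> ring (tensor_algebra M)"
  unfolding tensor_algebra_def by (intro ideal.quotient_is_ring ideal_tensor_ideal)

lemma tensor_closed:
  assumes "set as \<subseteq> carrier M"
  shows "tensor M as \<in> carrier (tensor_algebra M)"
proof -
  have "word as \<in> carrier (free_ring (carrier M))"
    using assms by (auto simp: free_ring_def)
  then show ?thesis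
    by (auto simp: tensor_algebra_def tensor_def FactRing_def A_RCOSETS_def')
qed

lemma ideal_steinberg_ideal:
  assumes "ring F"
  shows "ideal (steinberg_ideal F) (tensor_algebra (units_of F))"
proof -
  have "Group.monoid (units_of F)"
    using assms by (simp add: Group.monoid.units_group group.is_monoid ring_def)
  then show ?thesis
    unfolding steinberg_ideal_def
    by (intro ring.genideal_ideal ring_tensor_algebra subsetI)
       (auto intro!: tensor_closed simp: units_of_carrier)
qed

lemma ring_milnor_ring: "ring F \<Longrightarrow> ring (milnor_ring F)"
  unfolding milnor_ring_def by (intro ideal.quotient_is_ring ideal_steinberg_ideal)

lemma torus_coordinate_ring_closed:
  shows "0 \<in> torus_coordinate_ring d" "1 \<in> torus_coordinate_ring d"
  and "p \<in> torus_coordinate_ring d \<Longrightarrow> - p \<in> torus_coordinate_ring d"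
  and "p \<in> torus_coordinate_ring d \<Longrightarrow> q \<in> torus_coordinate_ring d \<Longrightarrow> p + q \<in> torus_coordinate_ring d"
  and "p \<in> torus_coordinate_ring d \<Longrightarrow> q \<in> torus_coordinate_ring d \<Longrightarrow> p * q \<in> torus_coordinate_ring d"
proof -
  show "p \<in> torus_coordinate_ring d \<Longrightarrow> q \<in> torus_coordinate_ring d \<Longrightarrow> p + q \<in> torus_coordinate_ring d"
    using Poly_Mapping.keys_add[of p q] by (auto simp: torus_coordinate_ring_def)
  show "p * q \<in> torus_coordinate_ring d" if p: "p \<in> torus_coordinate_ring d" and q: "q \<in> torus_coordinate_ring d"
    unfolding torus_coordinate_ring_def
  proof (intro CollectI ballI)
    fix m assume "m \<in> Poly_Mapping.keys (p * q)"
    then obtain a b where "m = a + b" "a \<in> Poly_Mapping.keys p" "b \<in> Poly_Mapping.keys q"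
      using keys_mult[of p q] by auto
    then show "Poly_Mapping.keys m \<subseteq> {..<d}"
      using p q Poly_Mapping.keys_add[of a b] unfolding torus_coordinate_ring_def by blast
  qed
qed (auto simp: torus_coordinate_ring_def keys_one)

lemma field_torus_field: "field (torus_field d)"
proof -
  have I: "Fract p q \<in> carrier (torus_field d)"
    if "p \<in> torus_coordinate_ring d" "q \<in> torus_coordinate_ring d" "q \<noteq> 0" for p q
    using that by (auto simp: torus_field_def)
  have E: thesis if "x \<in> carrier (torus_field d)"
    "\<And>p q. x = Fract p q \<Longrightarrow> p \<in> torus_coordinate_ring d \<Longrightarrow> q \<in> torus_coordinate_ring d \<Longrightarrow> q \<noteq> 0 \<Longrightarrow> thesis"
    for x thesis using that by (auto simp: torus_field_def)
  note cl = torus_coordinate_ring_closed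
  have one: "1 \<in> carrier (torus_field d)" and zero: "0 \<in> carrier (torus_field d)"
    using I[of 1 1 ] I[of 0 1] cl by (auto simp: One_fract_def Zero_fract_def)
  have add: "x + y \<in> carrier (torus_field d)"
    and mul: "x * y \<in> carrier (torus_field d)"
    if "x \<in> carrier (torus_field d)" "y \<in> carrier (torus_field d)" for x y
    using that cl by (auto elim!: E intro!: I)
  have neg: "- x \<in> carrier (torus_field d)" if "x \<in> carrier (torus_field d)" for x
    using that cl by (auto elim!: E intro!: I)
  have inv: "inverse x \<in> carrier (torus_field d)" if "x \<in> carrier (torus_field d)" for x
  proof (cases "x = 0")
    case False
    then show ?thesis using that cl
      by (auto elim!: E intro!: I simp: eq_fract Zero_fract_def)
  qed (use zero in simp)
  have ops: "x \<oplus>\<^bsub>torus_field d\<^esub> y = x + y" "x \<otimes>\<^bsub>torus_field d\<^esub> y = x * y"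
    "\<one>\<^bsub>torus_field d\<^esub> = 1" "\<zero>\<^bsub>torus_field d\<^esub> = 0" for x y
    by (auto simp: torus_field_def)
  have "cring (torus_field d)"
  proof (rule cringI)
    show "abelian_group (torus_field d)"
    proof (rule abelian_groupI)
      fix x assume "x \<in> carrier (torus_field d)"
      then show "\<exists>y\<in>carrier (torus_field d). y \<oplus>\<^bsub>torus_field d\<^esub> x = \<zero>\<^bsub>torus_field d\<^esub>"
        by (intro bexI[of _ "- x"]) (auto simp: ops neg)
    qed (auto simp: ops add zero)
    show "comm_monoid (torus_field d)"
      by (rule comm_monoidI) (auto simp: ops mul one)
  qed (auto simp: ops algebra_simps)
  then show ?thesis
  proof (rule cring.cring_fieldI2)
    fix a assume "a \<in> carrier (torus_field d)" "a \<noteq> \<zero>\<^bsub>torus_field d\<^esub>"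
    then show "\<exists>b\<in>carrier (torus_field d). a \<otimes>\<^bsub>torus_field d\<^esub> b = \<one>\<^bsub>torus_field d\<^esub>"
      by (intro bexI[of _ "inverse a"]) (auto simp: ops inv)
  qed (auto simp: ops)
qed

lemma vectorspace_free_vs: "vectorspace class_ring (free_vs G)"
proof -
  have class_cring: "cring (class_ring :: rat ring)"
    using class_field.field_axioms field_def domain_def by blast
  have lk: "Poly_Mapping.lookup (Poly_Mapping.map ((*) c) x) g = c * Poly_Mapping.lookup x g" 
    for c::rat and x::"'a \<Rightarrow>\<^sub>0 rat" and g
    by (simp add: map.rep_eq when_def)
  have k: "Poly_Mapping.keys (Poly_Mapping.map ((*) c) x) \<subseteq> Poly_Mapping.keys x" for c::rat and x::"'a \<Rightarrow>\<^sub>0 rat"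
    by (auto simp: in_keys_iff lk)
  have "Module.module class_ring (free_vs G)"
  proof (rule moduleI)
    show "abelian_group (free_vs G)"
    proof (rule abelian_groupI)
      fix x assume x: "x \<in> carrier (free_vs G)"
      then show "\<exists>y\<in>carrier (free_vs G). y \<oplus>\<^bsub>free_vs G\<^esub> x = \<zero>\<^bsub>free_vs G\<^esub>"
        by (intro bexI[of _ "- x"]) (auto simp: free_vs_def)
    next
      fix x y assume "x \<in> carrier (free_vs G)" "y \<in> carrier (free_vs G)"
      then show "x \<oplus>\<^bsub>free_vs G\<^esub> y \<in> carrier (free_vs G)"
        using Poly_Mapping.keys_add[of x y] by (auto simp: free_vs_def)
    qed (auto simp: free_vs_def ac_simps)
  qed (use k in \<open>auto simp: free_vs_def poly_mapping_eq_iff fun_eq_iff lk lookup_add algebra_simps class_cring\<close>)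
  then show ?thesis by (simp add: vectorspace_def class_field.field_axioms)
qed

lemma vectorspace_quotient_vs:
  assumes V: "Module.module class_ring V" and N: "submodule class_ring N V"
  shows "vectorspace class_ring (quotient_vs V N)"
    and "x \<in> carrier V \<Longrightarrow> c \<odot>\<^bsub>quotient_vs V N\<^esub> (N +>\<^bsub>V\<^esub> x) = N +>\<^bsub>V\<^esub> (c \<odot>\<^bsub>V\<^esub> x)"
proof -
  have class_cring: "cring (class_ring :: rat ring)"
    using class_field.field_axioms field_def domain_def by blast
  interpret V: Module.module class_ring V by fact
  have cl [simp]: "c \<odot>\<^bsub>V\<^esub> x \<in> carrier V" if "x \<in> carrier V" for c x
    using V.smult_closed[of c x] that by simp
  interpret N: submodule class_ring N V by fact
  have "subgroup N (add_monoid V)"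
  proof (unfold_locales)
    show "inv\<^bsub>add_monoid V\<^esub> x \<in> N" if "x \<in> N" for x
    proof -
      have "x \<in> carrier V" using that N.subset by auto
      then have "inv\<^bsub>add_monoid V\<^esub> x = (-1) \<odot>\<^bsub>V\<^esub> x"
        using V.smult_l_minus[of 1 x] V.smult_one[of x]
        by (simp add: a_inv_def[of V, symmetric] class_ring_simps)
      then show ?thesis using N.smult_closed[of "-1" x] that by simp
    qed
  qed (use N.subset N.m_closed N.zero_closed in auto)
  then interpret A: abelian_subgroup N V
    by (intro abelian_subgroupI3 V.abelian_group_axioms additive_subgroup.intro)
  show sm: "c \<odot>\<^bsub>quotient_vs V N\<^esub> (N +>\<^bsub>V\<^esub> x) = N +>\<^bsub>V\<^esub> (c \<odot>\<^bsub>V\<^esub> x)" 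
    if x: "x \<in> carrier V" for x c
  proof -
    have "N +>\<^bsub>V\<^esub> (c \<odot>\<^bsub>V\<^esub> y) = N +>\<^bsub>V\<^esub> (c \<odot>\<^bsub>V\<^esub> x)" if y: "y \<in> N +>\<^bsub>V\<^esub> x" for y
    proof -
      obtain n where n: "n \<in> N" "y = n \<oplus>\<^bsub>V\<^esub> x" using y by (auto simp: a_r_coset_def r_coset_def)
      then have nV: "n \<in> carrier V" using N.subset by auto
      have "c \<odot>\<^bsub>V\<^esub> y = c \<odot>\<^bsub>V\<^esub> n \<oplus>\<^bsub>V\<^esub> c \<odot>\<^bsub>V\<^esub> x"
        using n nV x V.smult_r_distr[of c n x] by simp
      moreover have "c \<odot>\<^bsub>V\<^esub> n \<in> N" using N.smult_closed[of c n] n by simp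
      ultimately have "c \<odot>\<^bsub>V\<^esub> y \<in> N +>\<^bsub>V\<^esub> (c \<odot>\<^bsub>V\<^esub> x)" by (auto simp: a_r_coset_def r_coset_def)
      then show ?thesis using x A.a_repr_independence' cl by metis
    qed
    then have "(\<Union>y\<in>N +>\<^bsub>V\<^esub> x. N +>\<^bsub>V\<^esub> (c \<odot>\<^bsub>V\<^esub> y))
        = (\<Union>y\<in>N +>\<^bsub>V\<^esub> x. N +>\<^bsub>V\<^esub> (c \<odot>\<^bsub>V\<^esub> x))" by (rule SUP_cong[OF refl])
    moreover have "N +>\<^bsub>V\<^esub> x \<noteq> {}" using x A.a_rcos_self by blast
    ultimately show ?thesis by (simp add: quotient_vs_def)
  qed
  have rc: "\<exists>x\<in>carrier V. C = N +>\<^bsub>V\<^esub> x" if "C \<in> carrier (quotient_vs V N)" for C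
    using that by (auto simp: quotient_vs_def A_RCOSETS_def')
  have rI: "N +>\<^bsub>V\<^esub> x \<in> carrier (quotient_vs V N)" if "x \<in> carrier V" for x
    using that by (auto simp: quotient_vs_def A_RCOSETS_def')
  have ad: "(N +>\<^bsub>V\<^esub> x) \<oplus>\<^bsub>quotient_vs V N\<^esub> (N +>\<^bsub>V\<^esub> y) = N +>\<^bsub>V\<^esub> (x \<oplus>\<^bsub>V\<^esub> y)"
    if "x \<in> carrier V" "y \<in> carrier V" for x y
    using A.a_rcos_sum that by (simp add: quotient_vs_def)
  have ze: "\<zero>\<^bsub>quotient_vs V N\<^esub> = N +>\<^bsub>V\<^esub> \<zero>\<^bsub>V\<^esub>"
    using V.a_coset_add_zero[OF N.subset] by (simp add: quotient_vs_def)
  have eqs: "(a + b) \<odot>\<^bsub>V\<^esub> x = a \<odot>\<^bsub>V\<^esub> x \<oplus>\<^bsub>V\<^esub> b \<odot>\<^bsub>V\<^esub> x"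
    "a \<odot>\<^bsub>V\<^esub> (x \<oplus>\<^bsub>V\<^esub> y) = a \<odot>\<^bsub>V\<^esub> x \<oplus>\<^bsub>V\<^esub> a \<odot>\<^bsub>V\<^esub> y"
    "(a * b) \<odot>\<^bsub>V\<^esub> x = a \<odot>\<^bsub>V\<^esub> (b \<odot>\<^bsub>V\<^esub> x)" "1 \<odot>\<^bsub>V\<^esub> x = x"
    if "x \<in> carrier V" "y \<in> carrier V" for a b x y
    using V.smult_l_distr[of a b x] V.smult_r_distr[of a x y] V.smult_assoc1[of a b x]
      V.smult_one[of x] that by simp_all
  have "Module.module class_ring (quotient_vs V N)"
  proof (rule moduleI)
    show "abelian_group (quotient_vs V N)"
    proof (rule abelian_groupI)
      fix C assume "C \<in> carrier (quotient_vs V N)"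
      then obtain x where x: "x \<in> carrier V" "C = N +>\<^bsub>V\<^esub> x" using rc by blast
      then show "\<exists>y\<in>carrier (quotient_vs V N). y \<oplus>\<^bsub>quotient_vs V N\<^esub> C = \<zero>\<^bsub>quotient_vs V N\<^esub>"
        by (intro bexI[of _ "N +>\<^bsub>V\<^esub> (\<ominus>\<^bsub>V\<^esub> x)"]) (auto simp: ad ze rI V.l_neg)
    qed (auto dest!: rc simp: ad ze rI V.a_ac)
  qed (auto dest!: rc simp: sm ad rI eqs class_cring)
  then show "vectorspace class_ring (quotient_vs V N)"
    by (simp add: vectorspace_def class_field.field_axioms)
qed

lemma vectorspace_presented_vs:
  assumes "R \<subseteq> carrier (free_vs G)"
  shows "vectorspace class_ring (presented_vs G R)"
proof -
  interpret vectorspace class_ring "free_vs G" by (rule vectorspace_free_vs)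
  show ?thesis unfolding presented_vs_def
    by (intro vectorspace_quotient_vs span_is_submodule module_axioms assms)
qed

lemma steinberg_rels_subset: "steinberg_rels d \<subseteq> carrier (free_vs (frames d))"
proof -
  have "permute_list p vs \<in> frames d" if "vs \<in> frames d" "p permutes {..<d}" for p vs
    using that by (auto simp: frames_def)
  moreover have "vs[i := c \<cdot>\<^sub>v (vs ! i)] \<in> frames d" if "vs \<in> frames d" "i < d" "c \<noteq> 0" for i c vs
  proof -
    have "vs ! i \<in> set vs" using that by (auto simp: frames_def)
    then have vi: "vs ! i \<in> carrier_vec d" "vs ! i \<noteq> 0\<^sub>v d" using that unfolding frames_def by blast+
    moreover have "c \<cdot>\<^sub>v (vs ! i) \<noteq> 0\<^sub>v d"
    proof
      assume "c \<cdot>\<^sub>v (vs ! i) = 0\<^sub>v d"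
      then have "inverse c \<cdot>\<^sub>v (c \<cdot>\<^sub>v (vs ! i)) = 0\<^sub>v d" by (auto intro!: eq_vecI)
      then show False using calculation that by (simp add: smult_smult_assoc)
    qed
    ultimately show ?thesis using that set_update_subset_insert[of vs i]
      by (fastforce simp: frames_def)
  qed
  moreover have "take i ws @ drop (Suc i) ws \<in> frames d"
    if "length ws = Suc d" "set ws \<subseteq> carrier_vec d - {0\<^sub>v d}" "i \<le> d" for i ws
    using that set_take_subset[of i ws] set_drop_subset[of "Suc i" ws]
    by (auto simp: frames_def)
  ultimately show ?thesis
    unfolding steinberg_rels_def free_vs_def
    apply (simp only: Un_subset_iff)
    apply (intro conjI)
    subgoal by auto
    subgoal by (clarsimp, drule subsetD[OF keys_diff], auto split: if_splits)
    subgoal by (clarsimp, drule subsetD[OF keys_diff], auto split: if_splits)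
    subgoal by (clarsimp, drule subsetD[OF keys_sum], auto split: if_splits)
    done
qed

lemma vectorspace_steinberg: "vectorspace class_ring (steinberg d)"
  unfolding steinberg_def by (intro vectorspace_presented_vs steinberg_rels_subset)

lemma vectorspace_tensor_rat:
  assumes "Group.monoid A"
  shows "vectorspace class_ring (tensor_rat A)"
proof -
  have "tensor_rat_rels A \<subseteq> carrier (free_vs (carrier A))"
    unfolding tensor_rat_rels_def free_vs_def
    using Group.monoid.m_closed[OF assms]
    by (clarsimp, drule_tac subsetD[OF keys_diff], auto dest!: subsetD[OF keys_diff] split: if_splits)
  then show ?thesis unfolding tensor_rat_def by (rule vectorspace_presented_vs)
qed

lemma torus_char_unit: "v \<in> carrier_vec d \<Longrightarrow> torus_char v \<in> Units (torus_field d)"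
proof -
  interpret field "torus_field d" by (rule field_torus_field)
  have ops: "x \<otimes>\<^bsub>torus_field d\<^esub> y = x * y" "\<one>\<^bsub>torus_field d\<^esub> = 1" "\<zero>\<^bsub>torus_field d\<^esub> = 0" for x y
    by (simp_all add: torus_field_def)
  have mult: "x * y \<in> carrier (torus_field d)" 
    if "x \<in> carrier (torus_field d)" "y \<in> carrier (torus_field d)" for x y
    using m_closed[OF that] by (simp add: ops)
  have one: "1 \<in> carrier (torus_field d)" using one_closed by (simp add: ops)
  have nz: "torus_coord i \<noteq> 0" for i
    by (simp add: torus_coord_def Zero_fract_def eq_fract)
      (metis lookup_single_eq lookup_zero one_neq_zero)
  have c: "torus_coord i \<in> carrier (torus_field d)" if "i < d" for i
  proof -
    have "Poly_Mapping.single (Poly_Mapping.single i (1::int)) (1::Qbar) \<in> torus_coordinate_ring d"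
      using that by (auto simp: torus_coordinate_ring_def)
    moreover have "(1 :: laurent) \<in> torus_coordinate_ring d" by (rule torus_coordinate_ring_closed)
    ultimately show ?thesis
      unfolding torus_field_def torus_coord_def partial_object.select_convs
      by (intro CollectI exI[of _ "Poly_Mapping.single (Poly_Mapping.single i (1::int)) (1::Qbar)"]
            exI[of _ "1 :: laurent"] conjI refl) simp_all
  qed
  have inv: "inverse x \<in> carrier (torus_field d)" if x: "x \<in> carrier (torus_field d)" "x \<noteq> 0" for x
  proof -
    have "x \<in> Units (torus_field d)" unfolding field_Units using x by (simp add: ops)
    then obtain y where "y \<in> carrier (torus_field d)" "x * y = 1"
      unfolding Units_def by (auto simp: ops)
    then show ?thesis by (simp add: inverse_unique[of x y])
  qed
  have pow: "x ^ k \<in> carrier (torus_field d)" if "x \<in> carrier (torus_field d)" for x k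
    using that by (induction k) (auto intro: mult one)
  have powi: "x powi k \<in> carrier (torus_field d)" if "x \<in> carrier (torus_field d)" "x \<noteq> 0" for x k
    using pow[OF that(1)] pow[OF inv[OF that]] by (simp add: power_int_def)
  assume v: "v \<in> carrier_vec d"
  have "torus_char v \<in> carrier (torus_field d)"
  proof -
    have "(\<Prod>i\<in>J. torus_coord i powi (v $ i)) \<in> carrier (torus_field d)"
      if "finite J" "J \<subseteq> {..<d}" for J
      using that by (induction J rule: finite_induct) (auto intro!: mult one powi c nz)
    then show ?thesis using v by (auto simp: torus_char_def)
  qed
  moreover have "torus_char v \<noteq> 0" using nz by (simp add: torus_char_def)
  ultimately show ?thesis unfolding field_Units by (simp add: ops)
qed

lemma comm_group_milnor_coker:
  assumes F: "ring F" and S: "S \<subseteq> Units F"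
  shows "comm_group (milnor_coker F S n)"
proof -
  interpret K: ring "milnor_ring F" by (rule ring_milnor_ring[OF F])
  let ?A = "add_monoid (milnor_ring F)"
  have A: "comm_group ?A" by (rule K.a_comm_group)
  then have grA: "group ?A" by (rule comm_group.axioms)
  have mon: "Group.monoid (units_of F)"
    using F by (simp add: Group.monoid.units_group group.is_monoid ring_def)
  have sym: "milnor_symbol F as \<in> carrier (milnor_ring F)" if "set as \<subseteq> Units F" for as
  proof -
    have "tensor (units_of F) as \<in> carrier (tensor_algebra (units_of F))"
      using that by (intro tensor_closed) (simp add: units_of_carrier)
    then show ?thesis
      by (auto simp: milnor_symbol_def milnor_ring_def FactRing_def A_RCOSETS_def')
  qed
  define G where "G m = {milnor_symbol F as | as. length as = m \<and> set as \<subseteq> Units F}" for m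
  have G: "G m \<subseteq> carrier ?A" for m using sym by (auto simp: G_def)
  have Kn: "milnor_K F m = ?A \<lparr>carrier := generate ?A (G m)\<rparr>" for m
    by (simp add: milnor_K_def G_def)
  have sg: "subgroup (generate ?A (G m)) ?A" for m by (rule group.generate_is_subgroup[OF grA G])
  have cg: "comm_group (milnor_K F m)" for m
    proof (rule group.group_comm_groupI)
    show "group (milnor_K F m)"
      unfolding Kn by (rule subgroup.subgroup_is_group[OF sg grA])
    show "x \<otimes>\<^bsub>milnor_K F m\<^esub> y = y \<otimes>\<^bsub>milnor_K F m\<^esub> x"
      if "x \<in> carrier (milnor_K F m)" "y \<in> carrier (milnor_K F m)" for x y
      using that group.generate_in_carrier[OF grA G] K.a_comm unfolding Kn by simp
  qed
  interpret Kn: comm_group "milnor_K F n" by (rule cg)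
  have tmul: "tensor (units_of F) as \<otimes>\<^bsub>tensor_algebra (units_of F)\<^esub> tensor (units_of F) bs
      = tensor (units_of F) (as @ bs)" if "set as \<subseteq> Units F" "set bs \<subseteq> Units F" for as bs
  proof -
    have "word as \<in> carrier (free_ring (carrier (units_of F)))"
      "word bs \<in> carrier (free_ring (carrier (units_of F)))"
      using that by (auto simp: free_ring_def units_of_carrier)
    from ideal.rcoset_mult_add[OF ideal_tensor_ideal[OF mon] this]
    have "tensor (units_of F) as \<otimes>\<^bsub>tensor_algebra (units_of F)\<^esub> tensor (units_of F) bs
      = tensor_ideal (units_of F) +>\<^bsub>free_ring (carrier (units_of F))\<^esub>
          (word as \<otimes>\<^bsub>free_ring (carrier (units_of F))\<^esub> word bs)"
      by (simp add: tensor_algebra_def FactRing_def tensor_def)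
    also have "word as \<otimes>\<^bsub>free_ring (carrier (units_of F))\<^esub> word bs = word (as @ bs)"
      by (simp add: free_ring_def mult_single plus_free_monoid_def)
    finally show ?thesis by (simp add: tensor_def)
  qed
  have smul: "milnor_symbol F as \<otimes>\<^bsub>milnor_ring F\<^esub> milnor_symbol F bs = milnor_symbol F (as @ bs)"
    if "set as \<subseteq> Units F" "set bs \<subseteq> Units F" for as bs
  proof -
    have "tensor (units_of F) as \<in> carrier (tensor_algebra (units_of F))"
      "tensor (units_of F) bs \<in> carrier (tensor_algebra (units_of F))"
      using that by (auto intro!: tensor_closed simp: units_of_carrier)
    from ideal.rcoset_mult_add[OF ideal_steinberg_ideal[OF F] this] show ?thesis
      using tmul[OF that] by (simp add: milnor_ring_def FactRing_def milnor_symbol_def)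
  qed
  have prod: "y \<otimes>\<^bsub>milnor_ring F\<^esub> milnor_symbol F [x] \<in> generate ?A (G (Suc m))"
    if "y \<in> generate ?A (G m)" and x: "x \<in> Units F" for y x m
    using that(1)
  proof induction
    case one
    have "milnor_symbol F [x] \<in> carrier (milnor_ring F)" using x sym by simp
    then show ?case using generate.one[of ?A "G (Suc m)"] by simp
  next
    case (incl h)
    then obtain as where "h = milnor_symbol F as" "length as = m" "set as \<subseteq> Units F"
      by (auto simp: G_def)
    then show ?case using smul[of as "[x]"] x
      by (intro generate.incl) (auto simp: G_def intro!: exI[of _ "as @ [x]"])
  next
    case (inv h)
    then obtain as where as: "h = milnor_symbol F as" "length as = m" "set as \<subseteq> Units F"
      by (auto simp: G_def)
    then have "inv\<^bsub>?A\<^esub> (milnor_symbol F (as @ [x])) \<in> generate ?A (G (Suc m))"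
      using x by (intro generate.inv) (force simp: G_def)
    then show ?case using as x smul[of as "[x]"] K.l_minus[of h "milnor_symbol F [x]"] sym
      by (simp add: a_inv_def)
  next
    case (eng h1 h2)
    have "h1 \<in> carrier (milnor_ring F)" "h2 \<in> carrier (milnor_ring F)"
      using eng.hyps group.generate_in_carrier[OF grA G] by auto
    then show ?case using generate.eng[OF eng.IH] x sym K.l_distr by simp
  qed
  have "subgroup (milnor_product_image F S n) (milnor_K F n)"
    unfolding milnor_product_image_def
    by (rule Kn.generate_is_subgroup) (use prod S in \<open>auto simp: Kn\<close>)
  then show ?thesis unfolding milnor_coker_def by (rule Kn.abelian_FactGroup)
qed

lemma vectorspace_torus_K: "vectorspace class_ring (torus_K d n)"
proof -
  have "comm_group (torus_K_coker d n)"
    unfolding torus_K_coker_def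
    by (rule comm_group_milnor_coker)
       (use field_torus_field torus_char_unit in \<open>auto simp: field_def domain_def cring_def\<close>)
  then show ?thesis
    unfolding torus_K_def
    by (intro vectorspace_tensor_rat) (simp add: comm_group_def comm_monoid_def)
qed

end

theory Submission
  imports Defs "Jordan_Normal_Form.DL_Rank"
begin

text \<open>Uniqueness is the Ash-Rudolph argument: if \<open>v\<close> is a frame of integral vectors with
  determinant \<open>D\<close>, \<open>|D| > 1\<close>, then the half-open parallelepiped spanned by \<open>v\<close> contains a
  lattice vector \<open>w \<noteq> 0\<close>, and the relation for \<open>(w, v\<^sub>1, \<dots>, v\<^sub>d)\<close> writes \<open>[v]\<close>
  as a sum of apartments of smaller determinant.

  For existence, the same formula is taken as a recursive definition of a function \<open>F\<close> on integral
  frames that extends the symbols \<open>f(v) = {1 - x\<^sup>v\<^sup>1, \<dots>, 1 - x\<^sup>v\<^sup>d}\<close> of unimodular frames and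
  vanishes on dependent ones.  Bykovskii's theorem says that \<open>F\<close> satisfies all the relations of the
  Steinberg module as soon as \<open>f\<close> is skew-symmetric, invariant under \<open>v\<^sub>i \<mapsto> -v\<^sub>i\<close>, and
  \<open>f(v\<^sub>1, v\<^sub>2, \<dots>) = f(v\<^sub>1 + v\<^sub>2, v\<^sub>2, \<dots>) + f(v\<^sub>1, v\<^sub>1 + v\<^sub>2, \<dots>)\<close>.  It is proved by
  induction on the largest minor occurring in a relation: coning off with a suitable lattice vector,
  \<open>\<partial>\<partial> = 0\<close> reduces a relation to ones with smaller minors.  The three properties of \<open>f\<close>
  follow from the Steinberg relation modulo torsion and characters.\<close>

section \<open>Determinants of lists of column vectors\<close>

text \<open>The target is a quotient of a free vector space and not a type, so every identity is
  stated as membership in a subgroup \<open>N\<close> of relations; \<open>F\<close> itself takes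
  values before the quotient is formed. The obstacle is that \<open>F\<close> depends on the
  arbitrary choice of \<open>cut v\<close>, and that neither of its two properties can be proved
  alone: skew-symmetry at determinant n needs the cocycle relation for an apex other than the chosen
  cut, while comparing two apexes needs skew-symmetry of the frames that contain both. One induction
  carries the two together. Comparing apexes works as long as the 2 x 2 minors of their coordinates
  stay below 1 in absolute value, and this bound dictates the auxiliary lattice vectors, which are
  translates by vectors of the lattice spanned by v. Rational frames enter by clearing denominators.
  That the multiple chosen is irrelevant is no extra axiom on f: it is the cocycle relation with
  apex a v_i.\<close>

abbreviation cdet :: "nat \<Rightarrow> 'a :: comm_ring_1 vec list \<Rightarrow> 'a" where
  "cdet d vs \<equiv> det (mat_of_cols d vs)"

text \<open>The cofactors along column \<open>j\<close> do not see column \<open>j\<close>, so the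
  expansion makes linearity in that entry visible.\<close>

lemma cdet_update_expand:
  fixes vs :: "'a :: comm_ring_1 vec list"
  assumes "length vs = d" "j < d"
  shows "cdet d (vs[j := w]) = (\<Sum>i<d. w $ i * cofactor (mat_of_cols d vs) i j)"
proof -
  have "mat_delete (mat_of_cols d (vs[j := w])) i j = mat_delete (mat_of_cols d vs) i j" for i
    using assms by (intro eq_matI) (auto simp: mat_delete_def mat_of_cols_def)
  moreover have "mat_of_cols d (vs[j := w]) \<in> carrier_mat d d" using assms by (metis length_list_update mat_of_cols_carrier(1))
  ultimately show ?thesis
    using assms by (subst laplace_expansion_column[of _ d j]) (auto simp: cofactor_def mat_of_cols_index)
qed

lemma cdet_update_add:
  assumes "length vs = d" "j < d" "u \<in> carrier_vec d" "w \<in> carrier_vec d"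
  shows "cdet d (vs[j := u + w]) = cdet d (vs[j := u]) + cdet d (vs[j := w])"
  using assms by (simp add: cdet_update_expand distrib_right sum.distrib)

lemma cdet_update_smult:
  assumes "length vs = d" "j < d" "u \<in> carrier_vec d"
  shows "cdet d (vs[j := c \<cdot>\<^sub>v u]) = c * cdet d (vs[j := u])"
  using assms by (simp add: cdet_update_expand sum_distrib_left mult.assoc)

lemma cdet_repeated:
  assumes "length vs = d" "i < d" "j < d" "i \<noteq> j" "vs ! i = vs ! j"
  shows "cdet d vs = 0"
proof (rule det_identical_columns[of _ d i j])
  show "mat_of_cols d vs \<in> carrier_mat d d" using assms(1) by auto
qed (use assms in \<open>auto simp: col_def mat_of_cols_def\<close>)

lemma cdet_swap:
  assumes "length vs = d" "i < d" "j < d" "i \<noteq> j"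
  shows "cdet d (vs[i := vs ! j, j := vs ! i]) = - cdet d vs"
proof -
  have "mat_of_cols d (vs[i := vs ! j, j := vs ! i]) = swapcols i j (mat_of_cols d vs)"
    using assms by (intro eq_matI) (auto simp: mat_of_cols_def mat_swapcols_def nth_list_update)
  then show ?thesis using assms by (simp add: det_swapcols[of i d j] mat_of_cols_carrier(1)[of d vs, unfolded assms(1)])
qed

lemma cdet_update_mult_mat_vec:
  assumes "length vs = d" "j < d" "x \<in> carrier_vec d"
  shows "cdet d (vs[j := mat_of_cols d vs *\<^sub>v x]) = x $ j * cdet d vs"
proof -
  have "mat_of_cols d (vs[j := mat_of_cols d vs *\<^sub>v x])
    = replace_col (mat_of_cols d vs) (mat_of_cols d vs *\<^sub>v x) j"
    using assms by (intro eq_matI) (auto simp: mat_of_cols_def replace_col_def)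
  then show ?thesis using assms mat_of_cols_carrier(1)[of d vs] by (simp add: cramer_lemma_mat)
qed

text \<open>Apply A adj(A) = det(A) to \<open>w\<close>: the entries of adj(A) w are the
  determinants with one column replaced. Nothing is divided, so this holds over any commutative
  ring.\<close>

lemma cramer_expansion:
  assumes "length vs = d" "k < d" "w \<in> carrier_vec d"
  shows "cdet d vs * w $ k = (\<Sum>j<d. cdet d (vs[j := w]) * (vs ! j) $ k)"
proof -
  let ?A = "mat_of_cols d vs"
  have A: "?A \<in> carrier_mat d d" using assms mat_of_cols_carrier(1)[of d vs] by simp
  have adj: "(adj_mat ?A *\<^sub>v w) $ j = cdet d (vs[j := w])" if "j < d" for j
    using that assms A by (simp add: cdet_update_expand adj_mat_def scalar_prod_def Matrix.row_def
        lessThan_atLeast0 mult.commute)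
  have "cdet d vs * w $ k = (cdet d vs \<cdot>\<^sub>v w) $ k" using assms by simp
  also have "cdet d vs \<cdot>\<^sub>v w = (?A * adj_mat ?A) *\<^sub>v w"
    using assms by (intro eq_vecI) (auto simp: adj_mat(2)[OF A] scalar_prod_def mult.assoc
        if_distrib[of "\<lambda>x. x * _"] if_distrib[of "\<lambda>x. _ * x"] sum.If_cases)
  also have "\<dots> = ?A *\<^sub>v (adj_mat ?A *\<^sub>v w)"
    using adj_mat[OF A] A assms by (metis assoc_mult_mat_vec)
  also have "\<dots> $ k = (\<Sum>j<d. (vs ! j) $ k * (adj_mat ?A *\<^sub>v w) $ j)"
    using assms A adj_mat(1)[OF A] by (simp add: scalar_prod_def lessThan_atLeast0 mat_of_cols_index)
  finally show ?thesis using adj by (simp add: mult.commute)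
qed

text \<open>Expand \<open>cdet d vs\<close> times \<open>w'\<close> in the columns of
  \<open>vs\<close> by Cramer and insert it into slot \<open>j\<close> of \<open>vs[i := w]\<close>:
  all terms but those of \<open>vs ! i\<close> and \<open>vs ! j\<close> have a repeated column.
  Frames with two new entries are thus controlled by frames with one.\<close>

lemma cdet_pluecker:
  assumes l: "length vs = d" and ij: "i < d" "j < d" "i \<noteq> j"
    and w: "w \<in> carrier_vec d" "w' \<in> carrier_vec d"
  shows "cdet d vs * cdet d (vs[i := w, j := w'])
    = cdet d (vs[i := w]) * cdet d (vs[j := w']) - cdet d (vs[j := w]) * cdet d (vs[i := w'])"
proof -
  let ?u = "vs[i := w]"
  define c where "c = cofactor (mat_of_cols d ?u)"
  have ex: "cdet d (?u[j := x]) = (\<Sum>k<d. x $ k * c k j)" for x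
    using l ij unfolding c_def by (simp add: cdet_update_expand)
  have "cdet d vs * cdet d (?u[j := w']) = (\<Sum>k<d. (cdet d vs * w' $ k) * c k j)"
    by (simp add: ex sum_distrib_left mult.assoc)
  also have "\<dots> = (\<Sum>k<d. (\<Sum>m<d. cdet d (vs[m := w']) * (vs ! m) $ k) * c k j)"
    using cramer_expansion[OF l _ w(2)] by simp
  also have "\<dots> = (\<Sum>k<d. \<Sum>m<d. cdet d (vs[m := w']) * ((vs ! m) $ k * c k j))"
    by (simp add: sum_distrib_right mult.assoc)
  also have "\<dots> = (\<Sum>m<d. cdet d (vs[m := w']) * cdet d (?u[j := vs ! m]))"
    by (subst sum.swap) (simp add: ex sum_distrib_left)
  also have "\<dots> = (\<Sum>m\<in>{i, j}. cdet d (vs[m := w']) * cdet d (?u[j := vs ! m]))"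
  proof (rule sum.mono_neutral_right)
    have "cdet d (?u[j := vs ! m]) = 0" if "m < d" "m \<noteq> i" "m \<noteq> j" for m
      using that l ij by (intro cdet_repeated[of _ d m j]) auto
    then show "\<forall>m\<in>{..<d} - {i, j}. cdet d (vs[m := w']) * cdet d (?u[j := vs ! m]) = 0"
      by simp
  qed (use ij in auto)
  also have "\<dots> = cdet d (vs[i := w']) * cdet d (?u[j := vs ! i])
      + cdet d (vs[j := w']) * cdet d (?u[j := vs ! j])" using ij by simp
  also have "cdet d (?u[j := vs ! i]) = - cdet d (vs[j := w])"
  proof -
    have "?u[j := vs ! i] = (let u = vs[j := w] in u[i := u ! j, j := u ! i])"
      using l ij by (simp add: Let_def nth_list_update list_update_swap)
    then show ?thesis using cdet_swap[of "vs[j := w]" d i j] l ij by (simp add: Let_def)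
  qed
  also have "?u[j := vs ! j] = ?u" using ij by (metis list_update_id nth_list_update_neq)
  finally show ?thesis by (simp add: mult.commute)
qed

section \<open>Bykovskii's presentation\<close>

locale additive_subgroup_set =
  fixes N :: "'m :: ab_group_add set"
  assumes zero_mem: "0 \<in> N"
    and diff_mem: "x \<in> N \<Longrightarrow> y \<in> N \<Longrightarrow> x - y \<in> N"
begin

lemma minus_mem: "x \<in> N \<Longrightarrow> - x \<in> N"
  using diff_mem[OF zero_mem, of x] by simp

lemma add_mem: "x \<in> N \<Longrightarrow> y \<in> N \<Longrightarrow> x + y \<in> N"
  using diff_mem[of x "- y"] minus_mem[of y] by simp

lemma sum_mem: "(\<And>i. i \<in> I \<Longrightarrow> g i \<in> N) \<Longrightarrow> sum g I \<in> N"
  by (induction I rule: infinite_finite_induct) (auto intro: zero_mem add_mem)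

lemma diff_sum_mem: "(\<And>i. i \<in> I \<Longrightarrow> g i - h i \<in> N) \<Longrightarrow> sum g I - sum h I \<in> N"
  by (simp add: sum_mem flip: sum_subtractf)

end

abbreviation swap_entries :: "nat \<Rightarrow> nat \<Rightarrow> 'a list \<Rightarrow> 'a list" where
  "swap_entries i j v \<equiv> v[i := v ! j, j := v ! i]"

lemma swap_entries_update:
  assumes "i < length v" "j < length v" "k < length v"
  shows "(swap_entries i j v)[k := w] = swap_entries i j (v[Transposition.transpose i j k := w])"
  by (rule nth_equalityI) (use assms in \<open>auto simp: nth_list_update Transposition.transpose_def\<close>)

lemma swap_entries_update2:
  assumes "i < length v" "j < length v" "i \<noteq> j"
  shows "swap_entries i j (v[i := w, j := w']) = v[j := w, i := w']"
    and "swap_entries i j (v[j := w]) = v[i := w, j := v ! i]"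
  by (rule nth_equalityI; use assms in \<open>auto simp: nth_list_update\<close>)+

lemma sum_off_diagonal:
  fixes g :: "nat \<Rightarrow> nat \<Rightarrow> 'm :: ab_group_add"
  shows "(\<Sum>i<d. \<Sum>j\<in>{..<d} - {i}. g i j) = (\<Sum>i<d. \<Sum>j<i. g i j + g j i)"
proof (induction d)
  case (Suc d)
  have "{..<Suc d} - {i} = insert d ({..<d} - {i})" if "i < d" for i using that by auto
  moreover have "{..<Suc d} - {d} = {..<d}" by auto
  ultimately show ?case by (simp add: Suc sum.distrib add_ac)
qed simp

text \<open>For skew-symmetric \<open>F\<close> this is the alternating sum of \<open>F\<close> over the faces of
  \<open>(w, v\<^sub>1, \<dots>, v\<^sub>d)\<close>, in a form that does not depend on the position of \<open>w\<close>.\<close>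

definition defect :: "nat \<Rightarrow> ('a list \<Rightarrow> 'm :: ab_group_add) \<Rightarrow> 'a list \<Rightarrow> 'a \<Rightarrow> 'm" where
  "defect d F v w = F v - (\<Sum>i<d. F (v[i := w]))"

context additive_subgroup_set
begin

text \<open>The identity \<open>\<partial>\<partial>(w, w', v) = 0\<close>.\<close>

lemma defect_exchange:
  assumes l: "length v = d"
    and skew: "\<And>i j. i < d \<Longrightarrow> j < d \<Longrightarrow> i \<noteq> j \<Longrightarrow>
      F (swap_entries i j (v[i := w, j := w'])) + F (v[i := w, j := w']) \<in> N"
  shows "defect d F v w' - defect d F v w - (\<Sum>i<d. defect d F (v[i := w]) w') \<in> N"
proof -
  let ?g = "\<lambda>i j. F (v[i := w, j := w'])"
  \<comment> \<open>The term j = i overwrites \<open>w\<close> and gives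
    \<open>F (v[i := w'])\<close>, which cancels against the sum in \<open>defect d F v w'\<close>;
    the off-diagonal double sum remains.\<close>
  have "(\<Sum>j<d. F (v[i := w, j := w'])) = F (v[i := w']) + (\<Sum>j\<in>{..<d} - {i}. ?g i j)" if "i < d" for i
    using that by (subst sum.remove[of _ i]) auto
  then have "defect d F v w' - defect d F v w - (\<Sum>i<d. defect d F (v[i := w]) w')
     = (\<Sum>i<d. \<Sum>j\<in>{..<d} - {i}. ?g i j)"
    by (simp add: defect_def sum_subtractf sum.distrib)
  also have "\<dots> = (\<Sum>i<d. \<Sum>j<i. ?g i j + ?g j i)" by (rule sum_off_diagonal)
  also have "\<dots> \<in> N"
  proof (intro sum_mem)
    fix i j assume "i \<in> {..<d}" "j \<in> {..<i}"
    then show "?g i j + ?g j i \<in> N"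
      using skew[of i j] swap_entries_update2(1)[of i v j w w'] l by (simp add: add.commute)
  qed
  finally show ?thesis .
qed

text \<open>The faces \<open>v\<close> and \<open>v[i := w]\<close> trade places; every other face
  contains both \<open>w\<close> and \<open>v ! i\<close>, in swapped slots, so skew-symmetry gives
  the sign. It lets any prescribed face serve as base frame.\<close>

lemma defect_flip:
  assumes l: "length v = d" and i: "i < d"
    and skew: "\<And>j. j < d \<Longrightarrow> j \<noteq> i \<Longrightarrow> F (swap_entries i j (v[j := w])) + F (v[j := w]) \<in> N"
  shows "defect d F (v[i := w]) (v ! i) + defect d F v w \<in> N"
proof -
  have "(\<Sum>j<d. F (v[i := w, j := v ! i])) = F v + (\<Sum>j\<in>{..<d} - {i}. F (v[i := w, j := v ! i]))"
    using l i by (subst sum.remove[of _ i]) (auto simp: list_update_overwrite list_update_id)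
  moreover have "(\<Sum>j<d. F (v[j := w])) = F (v[i := w]) + (\<Sum>j\<in>{..<d} - {i}. F (v[j := w]))"
    using i by (subst sum.remove[of _ i]) auto
  ultimately have "defect d F (v[i := w]) (v ! i) + defect d F v w
     = - (\<Sum>j\<in>{..<d} - {i}. F (v[i := w, j := v ! i]) + F (v[j := w]))"
    by (simp add: defect_def sum.distrib)
  also have "\<dots> \<in> N"
    using skew swap_entries_update2(2)[of i v _ w] l i by (intro minus_mem sum_mem) force
  finally show ?thesis .
qed

end

definition nonzero_frame :: "nat \<Rightarrow> 'a :: zero vec list \<Rightarrow> bool" where
  "nonzero_frame d v \<longleftrightarrow> length v = d \<and> set v \<subseteq> carrier_vec d - {0\<^sub>v d}"

lemma nonzero_frame_update:
  "nonzero_frame d v \<Longrightarrow> w \<in> carrier_vec d - {0\<^sub>v d} \<Longrightarrow> nonzero_frame d (v[i := w])"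
  using set_update_subset_insert[of v i w] unfolding nonzero_frame_def by auto

lemma nonzero_frame_nth: "nonzero_frame d v \<Longrightarrow> i < d \<Longrightarrow> v ! i \<in> carrier_vec d - {0\<^sub>v d}"
  unfolding nonzero_frame_def using nth_mem by blast

lemma nonzero_frame_length: "nonzero_frame d v \<Longrightarrow> length v = d"
  by (simp add: nonzero_frame_def)

lemma nonzero_frame_swap:
  "nonzero_frame d v \<Longrightarrow> i < d \<Longrightarrow> j < d \<Longrightarrow> nonzero_frame d (swap_entries i j v)"
  by (intro nonzero_frame_update nonzero_frame_nth)

section \<open>Coordinates with respect to a frame and lattice points\<close>

text \<open>The coordinates of \<open>w\<close> with respect to the family \<open>v\<close>, by Cramer's rule.\<close>

definition coord :: "nat \<Rightarrow> int vec list \<Rightarrow> int vec \<Rightarrow> nat \<Rightarrow> rat" where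
  "coord d v w i = of_int (cdet d (v[i := w])) / of_int (cdet d v)"

lemma abs_cdet_update_less:
  assumes "cdet d v \<noteq> 0"
  shows "\<bar>cdet d (v[i := w])\<bar> < \<bar>cdet d v\<bar> \<longleftrightarrow> \<bar>coord d v w i\<bar> < 1"
proof -
  have "\<bar>coord d v w i\<bar> < 1 \<longleftrightarrow> \<bar>rat_of_int (cdet d (v[i := w]))\<bar> < \<bar>rat_of_int (cdet d v)\<bar>"
    using assms by (simp add: coord_def abs_divide divide_less_eq)
  then show ?thesis by (simp flip: of_int_abs)
qed

lemma abs_cdet_update_le:
  assumes "cdet d v \<noteq> 0"
  shows "\<bar>cdet d (v[i := w])\<bar> \<le> \<bar>cdet d v\<bar> \<longleftrightarrow> \<bar>coord d v w i\<bar> \<le> 1"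
proof -
  have "\<bar>coord d v w i\<bar> \<le> 1 \<longleftrightarrow> \<bar>rat_of_int (cdet d (v[i := w]))\<bar> \<le> \<bar>rat_of_int (cdet d v)\<bar>"
    using assms by (simp add: coord_def abs_divide divide_le_eq)
  then show ?thesis by (simp flip: of_int_abs)
qed

text \<open>\<open>cdet_pluecker\<close> divided by the square of \<open>cdet d v\<close>: relative
  to the old determinant, the new one is a 2 x 2 minor of the two coordinate vectors.\<close>

lemma cdet_update2_coord:
  assumes "length v = d" "i < d" "j < d" "i \<noteq> j" "w \<in> carrier_vec d" "w' \<in> carrier_vec d"
    "cdet d v \<noteq> 0"
  shows "rat_of_int (cdet d (v[i := w, j := w']))
    = (coord d v w i * coord d v w' j - coord d v w j * coord d v w' i) * of_int (cdet d v)"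
proof -
  have "rat_of_int (cdet d v * cdet d (v[i := w, j := w']))
    = of_int (cdet d (v[i := w]) * cdet d (v[j := w']) - cdet d (v[j := w]) * cdet d (v[i := w']))"
    using cdet_pluecker[OF assms(1-6)] by presburger
  then have "rat_of_int (cdet d (v[i := w, j := w']))
    = of_int (cdet d (v[i := w]) * cdet d (v[j := w']) - cdet d (v[j := w]) * cdet d (v[i := w']))
      / of_int (cdet d v)"
    using assms(7) by (simp add: eq_divide_eq mult.commute)
  then show ?thesis using assms(7) by (simp add: coord_def diff_divide_distrib left_diff_distrib)
qed

lemma abs_cdet_update2_less:
  assumes "length v = d" "i < d" "j < d" "i \<noteq> j" "w \<in> carrier_vec d" "w' \<in> carrier_vec d"
    "cdet d v \<noteq> 0"
    "\<bar>coord d v w i * coord d v w' j - coord d v w j * coord d v w' i\<bar> < 1"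
  shows "\<bar>cdet d (v[i := w, j := w'])\<bar> < \<bar>cdet d v\<bar>"
proof -
  have "\<bar>rat_of_int (cdet d (v[i := w, j := w']))\<bar> < 1 * \<bar>rat_of_int (cdet d v)\<bar>"
    unfolding cdet_update2_coord[OF assms(1-7)] abs_mult using assms(7,8) by (intro mult_strict_right_mono) auto
  then show ?thesis by (simp flip: of_int_abs)
qed

lemma coord_determines:
  fixes v :: "int vec list"
  assumes "length v = d" "w \<in> carrier_vec d" "w' \<in> carrier_vec d" "cdet d v \<noteq> 0"
    "\<And>i. i < d \<Longrightarrow> cdet d (v[i := w]) = cdet d (v[i := w'])"
  shows "w = w'"
proof (rule eq_vecI)
  fix k assume "k < dim_vec w'"
  then have "cdet d v * w $ k = cdet d v * w' $ k"
    using assms cramer_expansion[of v d k w] cramer_expansion[of v d k w'] by simp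
  then show "w $ k = w' $ k" using assms(4) by simp
qed (use assms in simp)

lemma cdet_update_zero: "length v = d \<Longrightarrow> i < d \<Longrightarrow> cdet d (v[i := 0\<^sub>v d]) = 0"
  by (simp add: cdet_update_expand)

lemma cdet_nth: "length v = d \<Longrightarrow> i < d \<Longrightarrow> j < d \<Longrightarrow>
    cdet d (v[i := v ! j]) = (if i = j then cdet d v else 0)"
  using cdet_repeated[of "v[i := v ! j]" d i j] by (simp add: list_update_id)

lemma nonzero_coord:
  assumes "length v = d" "w \<in> carrier_vec d - {0\<^sub>v d}" "cdet d v \<noteq> 0"
  obtains i where "i < d" "coord d v w i \<noteq> 0"
  using coord_determines[of v d w "0\<^sub>v d"] assms that cdet_update_zero[of v d]
  by (auto simp: coord_def)

lemma coord_nonzero: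
  assumes "length v = d" "i < d" "coord d v w i \<noteq> 0"
  shows "w \<noteq> 0\<^sub>v d"
  using assms cdet_update_zero[of v d i] by (auto simp: coord_def)

text \<open>The translation is by the combination of the entries of \<open>v\<close> with
  coefficients \<open>c\<close>. It serves to correct signs and integer parts of
  coordinates.\<close>

lemma lattice_translate:
  fixes c :: "nat \<Rightarrow> int"
  assumes "length v = d" "w \<in> carrier_vec d" "cdet d v \<noteq> 0"
  obtains w' where "w' \<in> carrier_vec d" "\<And>i. i < d \<Longrightarrow> coord d v w' i = coord d v w i + of_int (c i)"
proof
  let ?t = "mat_of_cols d v *\<^sub>v Matrix.vec d c"
  have t: "?t \<in> carrier_vec d" using assms(1) by (auto simp: mult_mat_vec_def)
  then show "w + ?t \<in> carrier_vec d" using assms by simp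
  show "coord d v (w + ?t) i = coord d v w i + of_int (c i)" if "i < d" for i
    using that assms cdet_update_add[OF assms(1) that assms(2) t]
      cdet_update_mult_mat_vec[OF assms(1) that, of "Matrix.vec d c"]
    by (simp add: coord_def add_divide_distrib)
qed

text \<open>The entries of \<open>v\<close> span a proper sublattice, so some unit vector lies
  outside it; reducing its coordinates to their fractional parts gives the point.\<close>

lemma lattice_point_in_parallelepiped:
  assumes l: "length v = d" and D: "\<bar>cdet d v\<bar> > 1"
  obtains w where "w \<in> carrier_vec d - {0\<^sub>v d}" "\<And>i. i < d \<Longrightarrow> 0 \<le> coord d v w i \<and> coord d v w i < 1"
proof -
  let ?A = "mat_of_cols d v" and ?D = "cdet d v"
  have A: "?A \<in> carrier_mat d d" using l mat_of_cols_carrier(1)[of d v] by simp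
  have D0: "?D \<noteq> 0" using D by auto
  \<comment> \<open>The coordinates of the \<open>k\<close>-th unit vector are the cofactors in row
    \<open>k\<close> divided by \<open>?D\<close>. Were they integral for all \<open>k\<close>, the
    adjugate divided by \<open>?D\<close> would be an integral inverse, and \<open>?D\<close> a
    unit.\<close>
  have "\<exists>k<d. \<exists>j<d. \<not> ?D dvd cofactor ?A k j"
  proof (rule ccontr)
    assume "\<not> ?thesis"
    then have dv: "cofactor ?A k j = ?D * (cofactor ?A k j div ?D)" if "k < d" "j < d" for k j
      using that by auto
    define B where "B = mat d d (\<lambda>(j, k). cofactor ?A k j div ?D)"
    have B: "B \<in> carrier_mat d d" by (simp add: B_def)
    have "adj_mat ?A = ?D \<cdot>\<^sub>m B"
      using dv l by (intro eq_matI) (auto simp: adj_mat_def B_def)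
    then have "?D \<cdot>\<^sub>m (?A * B) = ?D \<cdot>\<^sub>m 1\<^sub>m d"
      using adj_mat(2)[OF A] mult_smult_distrib[OF A B, of ?D] by simp
    moreover have "det (?D \<cdot>\<^sub>m (?A * B)) = ?D ^ d * (?D * det B)"
      using A B det_mult[OF A B] by simp
    moreover have "det (?D \<cdot>\<^sub>m 1\<^sub>m d) = ?D ^ d" by simp
    ultimately have "?D * det B = 1" using D0 by simp
    then show False using D using abs_zmult_eq_1[of ?D "det B"] by simp
  qed
  then obtain k j where kj: "k < d" "j < d" "\<not> ?D dvd cofactor ?A k j" by blast
  have cf: "cdet d (v[i := unit_vec d k]) = cofactor ?A k i" if "i < d" for i
    using that l kj(1) by (simp add: cdet_update_expand unit_vec_def if_distrib[of "\<lambda>x. x * _"] cong: if_cong)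
  obtain w where w: "w \<in> carrier_vec d"
    "\<And>i. i < d \<Longrightarrow> coord d v w i
      = coord d v (unit_vec d k) i + of_int (- (cofactor ?A k i div ?D))"
    using lattice_translate[OF l _ D0, of "unit_vec d k" "\<lambda>i. - (cofactor ?A k i div ?D)"] by auto
  have co: "coord d v w i = of_int (cofactor ?A k i mod ?D) / of_int ?D" if "i < d" for i
  proof -
    let ?c = "cofactor ?A k i"
    have "coord d v w i = of_int ?c / of_int ?D - of_int (?c div ?D)"
      using w(2)[OF that] by (simp add: coord_def[of d v "unit_vec d k"] cf[OF that])
    also have "rat_of_int ?c = of_int (?D * (?c div ?D) + ?c mod ?D)" by (simp only: mult_div_mod_eq)
    also have "\<dots> = of_int ?D * of_int (?c div ?D) + of_int (?c mod ?D)"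
      by (simp only: of_int_add of_int_mult)
    finally show ?thesis using D0 by (simp add: add_divide_distrib)
  qed
  show thesis
  proof
    have "cofactor ?A k j mod ?D \<noteq> 0" using kj(3) by (simp add: dvd_eq_mod_eq_0)
    then have "coord d v w j \<noteq> 0" using co[OF kj(2)] D0 by simp
    then show "w \<in> carrier_vec d - {0\<^sub>v d}" using w(1) coord_nonzero[OF l kj(2)] by auto
  next
    fix i assume i: "i < d"
    consider "?D > 0" | "?D < 0" using D0 by linarith
    then show "0 \<le> coord d v w i \<and> coord d v w i < 1"
    proof cases
      case 1
      then show ?thesis using pos_mod_bound[of ?D] pos_mod_sign[of ?D] by (simp add: co[OF i])
    next
      case 2
      then show ?thesis using neg_mod_bound[of ?D] neg_mod_sign[of ?D "cofactor ?A k i"]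
        by (simp add: co[OF i] divide_less_eq zero_le_divide_iff)
    qed
  qed
qed

section \<open>The extended symbol \<open>F\<close> and the induction on the largest minor\<close>

locale unimodular_symbol = additive_subgroup_set N
  for N :: "'m :: ab_group_add set" +
  fixes d :: nat and f :: "int vec list \<Rightarrow> 'm"
  assumes f_swap: "integral_frame d v \<Longrightarrow> i < d \<Longrightarrow> j < d \<Longrightarrow> i \<noteq> j \<Longrightarrow> f (swap_entries i j v) + f v \<in> N"
    and f_minus: "integral_frame d v \<Longrightarrow> i < d \<Longrightarrow> f (v[i := - (v ! i)]) - f v \<in> N"
    and f_add: "integral_frame d v \<Longrightarrow> i < d \<Longrightarrow> j < d \<Longrightarrow> i \<noteq> j \<Longrightarrow>
      f v - f (v[i := v ! i + v ! j]) - f (v[j := v ! i + v ! j]) \<in> N"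
begin

text \<open>An arbitrary choice. \<open>defect_strict\<close> shows that, modulo \<open>N\<close>,
  every nonzero lattice vector with coordinates of absolute value below 1 would do as well.\<close>

definition cut :: "int vec list \<Rightarrow> int vec" where
  "cut v = (SOME w. w \<in> carrier_vec d - {0\<^sub>v d} \<and> (\<forall>i<d. 0 \<le> coord d v w i \<and> coord d v w i < 1))"

lemma cut:
  assumes "length v = d" "\<bar>cdet d v\<bar> > 1"
  shows "cut v \<in> carrier_vec d - {0\<^sub>v d}" "i < d \<Longrightarrow> 0 \<le> coord d v (cut v) i"
    "i < d \<Longrightarrow> coord d v (cut v) i < 1"
proof -
  have "\<exists>w. w \<in> carrier_vec d - {0\<^sub>v d} \<and> (\<forall>i<d. 0 \<le> coord d v w i \<and> coord d v w i < 1)"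
    using lattice_point_in_parallelepiped[OF assms] by metis
  from someI_ex[OF this] show "cut v \<in> carrier_vec d - {0\<^sub>v d}" "i < d \<Longrightarrow> 0 \<le> coord d v (cut v) i"
    "i < d \<Longrightarrow> coord d v (cut v) i < 1"
    unfolding cut_def by blast+
qed

lemma cut_decreases:
  assumes "length v = d" "\<bar>cdet d v\<bar> > 1" "i < d"
  shows "\<bar>cdet d (v[i := cut v])\<bar> < \<bar>cdet d v\<bar>"
  using cut(2,3)[OF assms] assms by (subst abs_cdet_update_less) auto

text \<open>Barvinok's signed decomposition into unimodular cones.\<close>

function F :: "int vec list \<Rightarrow> 'm" where
  "F v = (if length v = d \<and> \<bar>cdet d v\<bar> > 1 then \<Sum>i<d. F (v[i := cut v])
     else if cdet d v = 0 then 0 else f v)"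
  by auto
termination
proof (relation "measure (\<lambda>v. nat \<bar>cdet d v\<bar>)")
  fix v :: "int vec list" and i assume "length v = d \<and> \<bar>cdet d v\<bar> > 1" "i \<in> {..<d}"
  then show "(v[i := cut v], v) \<in> measure (\<lambda>v. nat \<bar>cdet d v\<bar>)"
    using cut_decreases[of v i] by auto
qed simp

declare F.simps [simp del]

lemma F_dependent: "cdet d v = 0 \<Longrightarrow> F v = 0"
  by (simp add: F.simps)

lemma F_unimodular: "\<bar>cdet d v\<bar> = 1 \<Longrightarrow> F v = f v"
  using F.simps[of v] by auto

lemma defect_cut: "length v = d \<Longrightarrow> \<bar>cdet d v\<bar> > 1 \<Longrightarrow> defect d F v (cut v) = 0"
  by (simp add: defect_def F.simps[of v])

definition skew_below :: "int \<Rightarrow> bool" where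
  "skew_below n \<longleftrightarrow> (\<forall>v i j. nonzero_frame d v \<longrightarrow> i < d \<longrightarrow> j < d \<longrightarrow> i \<noteq> j \<longrightarrow> \<bar>cdet d v\<bar> < n
     \<longrightarrow> F (swap_entries i j v) + F v \<in> N)"

text \<open>The bound is put on all d + 1 faces of (w, v), so that it does not matter which of them
  plays the role of base frame.\<close>

definition cocycle_below :: "int \<Rightarrow> bool" where
  "cocycle_below n \<longleftrightarrow> (\<forall>v w. nonzero_frame d v \<longrightarrow> w \<in> carrier_vec d - {0\<^sub>v d} \<longrightarrow> \<bar>cdet d v\<bar> < n
     \<longrightarrow> (\<forall>i<d. \<bar>cdet d (v[i := w])\<bar> < n) \<longrightarrow> defect d F v w \<in> N)"

lemma skew_belowD:
  "skew_below n \<Longrightarrow> nonzero_frame d v \<Longrightarrow> i < d \<Longrightarrow> j < d \<Longrightarrow> i \<noteq> j \<Longrightarrow> \<bar>cdet d v\<bar> < n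
    \<Longrightarrow> F (swap_entries i j v) + F v \<in> N"
  by (simp add: skew_below_def)

text \<open>Skew-symmetry enters only for frames that contain both \<open>w\<close> and
  \<open>w'\<close>, so only their determinants must be below \<open>n\<close>; that of
  \<open>v\<close> is not restricted.\<close>

lemma exchange:
  assumes "skew_below n" and v: "nonzero_frame d v"
    and w: "w \<in> carrier_vec d - {0\<^sub>v d}" "w' \<in> carrier_vec d - {0\<^sub>v d}"
    and "\<And>i j. i < d \<Longrightarrow> j < d \<Longrightarrow> i \<noteq> j \<Longrightarrow> \<bar>cdet d (v[i := w, j := w'])\<bar> < n"
  shows "defect d F v w' - defect d F v w - (\<Sum>i<d. defect d F (v[i := w]) w') \<in> N"
  using assms by (intro defect_exchange[OF nonzero_frame_length[OF v]] skew_belowD[OF assms(1)]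
      nonzero_frame_update) auto

lemma flip:
  assumes "skew_below n" and v: "nonzero_frame d v" and w: "w \<in> carrier_vec d - {0\<^sub>v d}"
    and "i < d" and "\<And>j. j < d \<Longrightarrow> j \<noteq> i \<Longrightarrow> \<bar>cdet d (v[j := w])\<bar> < n"
  shows "defect d F (v[i := w]) (v ! i) + defect d F v w \<in> N"
  using assms by (intro defect_flip[OF nonzero_frame_length[OF v]] skew_belowD[OF assms(1)]
      nonzero_frame_update) auto

text \<open>For every \<open>i\<close>, all faces of (w', v[i := w]) have determinant below
  \<open>n\<close>, so the sum in \<open>exchange\<close> lies in \<open>N\<close> by
  \<open>cocycle_below n\<close>. Two apexes over \<open>v\<close> are thereby compared although
  \<open>v\<close> itself may have determinant \<open>n\<close>.\<close>

lemma exchange_small: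
  assumes sk: "skew_below n" and co: "cocycle_below n" and v: "nonzero_frame d v"
    and D: "cdet d v \<noteq> 0" "\<bar>cdet d v\<bar> \<le> n"
    and w: "w \<in> carrier_vec d - {0\<^sub>v d}" "w' \<in> carrier_vec d - {0\<^sub>v d}"
    and a: "\<And>i. i < d \<Longrightarrow> \<bar>coord d v w i\<bar> < 1" "\<And>i. i < d \<Longrightarrow> \<bar>coord d v w' i\<bar> < 1"
    and m: "\<And>i j. i < d \<Longrightarrow> j < d \<Longrightarrow> i \<noteq> j \<Longrightarrow>
      \<bar>coord d v w i * coord d v w' j - coord d v w j * coord d v w' i\<bar> < 1"
  shows "defect d F v w' - defect d F v w \<in> N"
proof -
  note l = nonzero_frame_length[OF v]
  have 2: "\<bar>cdet d (v[i := w, j := w'])\<bar> < n" if "i < d" "j < d" "i \<noteq> j" for i j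
    using abs_cdet_update2_less[OF l that _ _ D(1) m[OF that]] w D(2) by auto
  have 1: "\<bar>cdet d (v[i := w])\<bar> < n" "\<bar>cdet d (v[i := w'])\<bar> < n" if "i < d" for i
    using abs_cdet_update_less[OF D(1)] a[OF that] D(2) by (meson less_le_trans)+
  have "defect d F (v[i := w]) w' \<in> N" if i: "i < d" for i
  proof -
    have "\<bar>cdet d (v[i := w, j := w'])\<bar> < n" if "j < d" for j
      using 1(2)[OF i] 2[of i j] i that by (cases "i = j") auto
    then show ?thesis
      using co nonzero_frame_update[OF v w(1), of i] w(2) 1(1)[OF i] by (simp add: cocycle_below_def)
  qed
  then have "(\<Sum>i<d. defect d F (v[i := w]) w') \<in> N" by (intro sum_mem) simp
  from add_mem[OF exchange[OF sk v w 2] this] show ?thesis by simp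
qed

text \<open>The sign conditions force the two products to have weakly the same sign, and two such
  numbers in (-1, 1) differ by less than 1. With opposite signs the difference could approach
  2.\<close>

lemma abs_diff_less_one:
  fixes a b a' b' :: rat
  assumes "\<bar>a\<bar> < 1" "\<bar>a'\<bar> < 1" "\<bar>b\<bar> \<le> 1" "\<bar>b'\<bar> \<le> 1" "a * b \<ge> 0" "a' * b' \<ge> 0"
  shows "\<bar>a * b' - a' * b\<bar> < 1"
proof -
  have "\<bar>x * y\<bar> < 1" if "\<bar>x\<bar> < 1" "\<bar>y\<bar> \<le> 1" for x y :: rat
    using mult_left_le[of "\<bar>y\<bar>" "\<bar>x\<bar>"] that by (simp add: abs_mult)
  then have "\<bar>a * b'\<bar> < 1" "\<bar>a' * b\<bar> < 1" using assms by blast+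
  moreover have "(a * b') * (a' * b) \<ge> 0"
    using mult_nonneg_nonneg[OF assms(5,6)] by (simp add: ac_simps)
  moreover have "\<bar>x - y\<bar> < 1" if "\<bar>x\<bar> < 1" "\<bar>y\<bar> < 1" "x * y \<ge> 0" for x y :: rat
    using that unfolding zero_le_mult_iff by linarith
  ultimately show ?thesis by blast
qed

text \<open>The defect at \<open>cut v\<close> is 0 by definition of \<open>F\<close>, so it
  suffices to compare apexes. Comparing \<open>w\<close> with \<open>cut v\<close> directly can
  fail, since coordinates of mixed sign allow 2 x 2 minors beyond 1; the comparison passes through a
  third point \<open>w'\<close>.\<close>

lemma defect_strict:
  assumes n: "n \<ge> 2" and sk: "skew_below n" and co: "cocycle_below n" and v: "nonzero_frame d v"
    and D: "\<bar>cdet d v\<bar> = n" and w: "w \<in> carrier_vec d - {0\<^sub>v d}"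
    and small: "\<And>i. i < d \<Longrightarrow> \<bar>cdet d (v[i := w])\<bar> < n"
  shows "defect d F v w \<in> N"
proof -
  note l = nonzero_frame_length[OF v]
  have D0: "cdet d v \<noteq> 0" "\<bar>cdet d v\<bar> \<le> n" and D1: "\<bar>cdet d v\<bar> > 1" using D n by auto
  let ?a = "coord d v w"
  have a: "\<bar>?a i\<bar> < 1" if "i < d" for i using small[OF that] D abs_cdet_update_less[OF D0(1)] by auto
  \<comment> \<open>Add \<open>v ! i\<close> to \<open>w\<close> for each negative coordinate. Up to
    sign, the minors of (w, w') are then 0, one coordinate of \<open>w\<close>, or a difference of
    two negative ones, all below 1; and \<open>w'\<close>, like \<open>cut v\<close>, has
    coordinates in [0, 1), where \<open>abs_diff_less_one\<close> applies.\<close>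
  obtain w' where w'c: "w' \<in> carrier_vec d"
    and w': "\<And>i. i < d \<Longrightarrow> coord d v w' i = ?a i + of_int (if ?a i < 0 then 1 else 0)"
    using lattice_translate[OF l _ D0(1), of w "\<lambda>i. if ?a i < 0 then 1 else 0"] w by auto
  have b: "0 \<le> coord d v w' i" "coord d v w' i < 1" if "i < d" for i
    using w'[OF that] a[OF that] by (auto split: if_splits)
  obtain j where j: "j < d" "?a j \<noteq> 0" using nonzero_coord[OF l w D0(1)] by blast
  then have "coord d v w' j \<noteq> 0" using w'[OF j(1)] a[OF j(1)] by (auto split: if_splits)
  then have w'n: "w' \<in> carrier_vec d - {0\<^sub>v d}" using coord_nonzero[OF l j(1)] w'c by blast
  note c = cut[OF l D1]
  have "\<bar>?a i * coord d v w' j - ?a j * coord d v w' i\<bar> < 1" if "i < d" "j < d" for i j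
    using w'[OF that(1)] w'[OF that(2)] a[OF that(1)] a[OF that(2)] by (auto simp: algebra_simps split: if_splits)
  then have "defect d F v w' - defect d F v w \<in> N"
    using a b by (intro exchange_small[OF sk co v D0 w w'n]) auto
  moreover have "defect d F v w' - defect d F v (cut v) \<in> N"
  proof (rule exchange_small[OF sk co v D0 c(1) w'n])
    fix i j assume ij: "i < d" "j < d"
    then show "\<bar>coord d v (cut v) i * coord d v w' j - coord d v (cut v) j * coord d v w' i\<bar> < 1"
      using b[of i] b[of j] c(2,3)[of i] c(2,3)[of j] by (intro abs_diff_less_one) auto
  qed (use b c in auto)
  ultimately show ?thesis using diff_mem[of "defect d F v w'" "defect d F v w' - defect d F v w"]
    by (simp add: defect_cut[OF l D1])
qed

lemma cdet_swap_entries_update: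
  fixes v :: "int vec list"
  assumes "length v = d" "i < d" "j < d" "i \<noteq> j" "k < d"
  shows "\<bar>cdet d ((swap_entries i j v)[k := w])\<bar> = \<bar>cdet d (v[Transposition.transpose i j k := w])\<bar>"
  using assms cdet_swap[of "v[Transposition.transpose i j k := w]" d i j]
  by (simp add: swap_entries_update)

text \<open>Use \<open>cut v\<close> as apex over the swapped frame too. It need not be the cut
  chosen there, but \<open>defect_strict\<close> permits it. Both frames then expand into the same
  smaller faces up to the swap.\<close>

lemma skew_below_step:
  assumes n: "n \<ge> 2" and sk: "skew_below n" and co: "cocycle_below n"
  shows "skew_below (n + 1)"
  unfolding skew_below_def
proof (intro allI impI)
  fix v i j assume v: "nonzero_frame d v" and ij: "i < d" "j < d" "i \<noteq> j" and D: "\<bar>cdet d v\<bar> < n + 1"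
  note l = nonzero_frame_length[OF v]
  let ?t = "Transposition.transpose i j"
  have t: "?t k < d" if "k < d" for k using that ij by (simp add: Transposition.transpose_def)
  show "F (swap_entries i j v) + F v \<in> N"
  proof (cases "\<bar>cdet d v\<bar> = n")
    case True
    then have D1: "\<bar>cdet d v\<bar> > 1" using n by auto
    let ?v = "swap_entries i j v" and ?w = "cut v"
    note c = cut[OF l D1]
    have less: "\<bar>cdet d (v[k := ?w])\<bar> < n" if "k < d" for k
      using cut_decreases[OF l D1 that] True by simp
    have "defect d F ?v ?w \<in> N"
      using c(1) n v ij True l cdet_swap[of v d i j] less t
      by (intro defect_strict[OF n sk co] nonzero_frame_swap)
        (auto simp: cdet_swap_entries_update[OF l ij])
    moreover have "(\<Sum>k<d. F (swap_entries i j (v[?t k := ?w])) + F (v[?t k := ?w])) \<in> N"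
      using sk less t ij nonzero_frame_update[OF v c(1)] by (intro sum_mem) (auto simp: skew_below_def)
    moreover have "F v = (\<Sum>k<d. F (v[?t k := ?w]))"
    proof -
      have "F v = (\<Sum>k<d. F (v[k := ?w]))" using l D1 by (simp add: F.simps[of v])
      also have "\<dots> = (\<Sum>k<d. F (v[?t k := ?w]))"
        using ij by (intro sum.reindex_bij_witness[of _ ?t ?t]) (auto simp: t)
      finally show ?thesis .
    qed
    ultimately show ?thesis
      using add_mem[of "defect d F ?v ?w" "\<Sum>k<d. F (swap_entries i j (v[?t k := ?w])) + F (v[?t k := ?w])"]
        l ij by (simp add: defect_def swap_entries_update sum.distrib)
  qed (use sk v ij D in \<open>auto simp: skew_below_def\<close>)
qed

text \<open>Coordinates of \<open>w\<close> may now be 1 or -1, so \<open>defect_strict\<close> does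
  not apply. Exchange \<open>w\<close> with a translate \<open>u\<close> of \<open>cut v\<close>
  whose signs fit those of \<open>w\<close>: every frame containing both is then small, and the
  remaining defects become strict after a flip.\<close>

lemma defect_maximal:
  assumes n: "n \<ge> 2" and sk: "skew_below n" and co: "cocycle_below n" and v: "nonzero_frame d v"
    and D: "\<bar>cdet d v\<bar> = n" and w: "w \<in> carrier_vec d - {0\<^sub>v d}"
    and le: "\<And>i. i < d \<Longrightarrow> \<bar>cdet d (v[i := w])\<bar> \<le> n"
  shows "defect d F v w \<in> N"
proof -
  note l = nonzero_frame_length[OF v]
  have D0: "cdet d v \<noteq> 0" "\<bar>cdet d v\<bar> \<le> n" and D1: "\<bar>cdet d v\<bar> > 1" using D n by auto
  let ?b = "coord d v w" and ?c = "coord d v (cut v)"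
  have b: "\<bar>?b i\<bar> \<le> 1" if "i < d" for i using le[OF that] D abs_cdet_update_le[OF D0(1)] by auto
  note c = cut[OF l D1]
  \<comment> \<open>\<open>cut v\<close> has coordinates in [0, 1). Subtracting 1 where
    \<open>w\<close> is negative moves a positive coordinate into (-1, 0); a zero coordinate needs
    no correction.\<close>
  define s :: "nat \<Rightarrow> int" where "s i = (if ?b i < 0 \<and> ?c i > 0 then - 1 else 0)" for i
  obtain u where uc: "u \<in> carrier_vec d"
    and u: "\<And>i. i < d \<Longrightarrow> coord d v u i = ?c i + of_int (s i)"
    using lattice_translate[OF l _ D0(1), of "cut v" s] c(1) by auto
  have a: "\<bar>coord d v u i\<bar> < 1" "coord d v u i * ?b i \<ge> 0" if "i < d" for i
    using u[OF that] c(2,3)[OF that] by (auto simp: s_def zero_le_mult_iff not_less split: if_splits)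
  obtain j where j: "j < d" "?c j \<noteq> 0" using nonzero_coord[OF l c(1) D0(1)] by blast
  then have "coord d v u j \<noteq> 0" using u[OF j(1)] c(3)[OF j(1)] by (auto simp: s_def split: if_splits)
  then have un: "u \<in> carrier_vec d - {0\<^sub>v d}" using coord_nonzero[OF l j(1)] uc by blast
  have m: "\<bar>cdet d (v[i := u, j := w])\<bar> < n" "\<bar>cdet d (v[i := w, j := u])\<bar> < n"
    if ij: "i < d" "j < d" "i \<noteq> j" for i j
    using abs_diff_less_one[OF a(1)[OF ij(1)] a(1)[OF ij(2)] b[OF ij(1)] b[OF ij(2)] a(2)[OF ij(1)] a(2)[OF ij(2)]]
      abs_diff_less_one[OF a(1)[OF ij(2)] a(1)[OF ij(1)] b[OF ij(2)] b[OF ij(1)] a(2)[OF ij(2)] a(2)[OF ij(1)]]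
      abs_cdet_update2_less[OF l ij uc _ D0(1), of w] abs_cdet_update2_less[OF l ij _ uc D0(1), of w] w D
    by (auto simp: mult.commute)
  have u1: "\<bar>cdet d (v[i := u])\<bar> < n" if "i < d" for i
    using a(1)[OF that] abs_cdet_update_less[OF D0(1)] D by auto
  have "defect d F (v[i := u]) w \<in> N" if i: "i < d" for i
  proof -
    have vi: "nonzero_frame d (v[i := w])" by (rule nonzero_frame_update[OF v w])
    have less: "\<bar>cdet d (v[i := w, j := u])\<bar> < n" if "j < d" for j
      using m(2)[of i j] u1 i that by (cases "i = j") auto
    \<comment> \<open>Interchanging \<open>u\<close> and \<open>w\<close> makes
      \<open>v[i := w]\<close> the base. It may have determinant \<open>n\<close>, but its faces
      with \<open>u\<close> are smaller, so \<open>defect_strict\<close> or \<open>co\<close>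
      applies.\<close>
    have "defect d F (v[i := w, i := u]) (v[i := w] ! i) + defect d F (v[i := w]) u \<in> N"
      using less i by (intro flip[OF sk vi un]) auto
    moreover have "defect d F (v[i := w]) u \<in> N"
      using le[OF i] less un vi co defect_strict[OF n sk co vi _ un]
      by (cases "\<bar>cdet d (v[i := w])\<bar> = n") (auto simp: cocycle_below_def)
    ultimately show ?thesis using diff_mem i l by fastforce
  qed
  then have "(\<Sum>i<d. defect d F (v[i := u]) w) \<in> N" by (intro sum_mem) simp
  moreover have "defect d F v u \<in> N" by (rule defect_strict[OF n sk co v D un u1])
  moreover have "defect d F v w - defect d F v u - (\<Sum>i<d. defect d F (v[i := u]) w) \<in> N"
    by (rule exchange[OF sk v un w m(1)])
  ultimately have "(defect d F v w - defect d F v u - (\<Sum>i<d. defect d F (v[i := u]) w))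
     + (\<Sum>i<d. defect d F (v[i := u]) w) + defect d F v u \<in> N" by (intro add_mem)
  then show ?thesis by simp
qed

lemma cocycle_below_step:
  assumes n: "n \<ge> 2" and sk: "skew_below n" and co: "cocycle_below n"
  shows "cocycle_below (n + 1)"
  unfolding cocycle_below_def
proof (intro allI impI)
  fix v w assume v: "nonzero_frame d v" and w: "w \<in> carrier_vec d - {0\<^sub>v d}" and D: "\<bar>cdet d v\<bar> < n + 1"
    and Di: "\<forall>i<d. \<bar>cdet d (v[i := w])\<bar> < n + 1"
  note l = nonzero_frame_length[OF v]
  consider "\<bar>cdet d v\<bar> = n" | i where "i < d" "\<bar>cdet d (v[i := w])\<bar> = n"
    | "\<bar>cdet d v\<bar> < n" "\<forall>i<d. \<bar>cdet d (v[i := w])\<bar> < n"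
    using D Di by force
  then show "defect d F v w \<in> N"
  proof cases
    case 1
    then show ?thesis using Di by (intro defect_maximal[OF n sk co v _ w]) auto
  next
    case (2 i)
    \<comment> \<open>Make the face of determinant \<open>n\<close> the base frame. Other faces may
      have determinant \<open>n\<close> as well, so skew-symmetry is needed one level higher, where
      \<open>skew_below_step\<close> supplies it.\<close>
    have "defect d F (v[i := w]) (v ! i) + defect d F v w \<in> N"
      using Di by (intro flip[OF skew_below_step[OF n sk co] v w 2(1)]) auto
    moreover have "\<bar>cdet d (v[i := w, j := v ! i])\<bar> \<le> n" if "j < d" for j
    proof (cases "j = i")
      case False
      then have "\<bar>cdet d (v[i := w, j := v ! i])\<bar> = \<bar>cdet d (v[j := w])\<bar>"
        using swap_entries_update2(2)[of i v j w] cdet_swap[of "v[j := w]" d i j] that 2(1) l by simp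
      then show ?thesis using Di that by force
    qed (use D l 2 in \<open>auto simp: list_update_overwrite list_update_id\<close>)
    then have "defect d F (v[i := w]) (v ! i) \<in> N"
      by (intro defect_maximal[OF n sk co nonzero_frame_update[OF v w] 2(2) nonzero_frame_nth[OF v 2(1)]])
    ultimately show ?thesis using diff_mem by fastforce
  qed (use co v w in \<open>auto simp: cocycle_below_def\<close>)
qed

end

lemma nonzero_frame_of_cdet:
  assumes "length v = d" "set v \<subseteq> carrier_vec d" "cdet d v \<noteq> 0"
  shows "nonzero_frame d v"
proof -
  have "0\<^sub>v d \<notin> set v"
  proof
    assume "0\<^sub>v d \<in> set v"
    then obtain i where "i < d" "v ! i = 0\<^sub>v d" using assms(1) by (auto simp: in_set_conv_nth)
    then show False using cdet_update_zero[of v d i] assms by (metis list_update_id)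
  qed
  then show ?thesis using assms by (auto simp: nonzero_frame_def)
qed

lemma integral_frame_iff: "integral_frame d v \<longleftrightarrow> nonzero_frame d v \<and> \<bar>cdet d v\<bar> = 1"
  using nonzero_frame_of_cdet[of v d] by (auto simp: integral_frame_def nonzero_frame_def)

lemma smult_vec_nonzero:
  fixes c :: "'a :: idom"
  assumes "u \<in> carrier_vec d - {0\<^sub>v d}" "c \<noteq> 0"
  shows "c \<cdot>\<^sub>v u \<in> carrier_vec d - {0\<^sub>v d}"
proof -
  obtain k where "k < d" "u $ k \<noteq> 0" using assms(1) by (auto simp: vec_eq_iff)
  then have "(c \<cdot>\<^sub>v u) $ k \<noteq> 0\<^sub>v d $ k" using assms by (auto simp: carrier_vecD)
  then show ?thesis using assms(1) by auto
qed

lemma scale_entry: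
  fixes v :: "'a :: idom vec list"
  assumes "nonzero_frame d v" "i < d" "c \<noteq> 0"
  shows "nonzero_frame d (v[i := c \<cdot>\<^sub>v v ! i])" "cdet d (v[i := c \<cdot>\<^sub>v v ! i]) = c * cdet d v"
  using nonzero_frame_update[OF assms(1) smult_vec_nonzero[OF nonzero_frame_nth[OF assms(1,2)] assms(3)]]
    cdet_update_smult[OF nonzero_frame_length[OF assms(1)] assms(2), of "v ! i" c]
    nonzero_frame_nth[OF assms(1,2)] by (simp_all add: list_update_id)

lemma cdet_combination:
  fixes v :: "int vec list"
  assumes "nonzero_frame d v" "i < d" "j < d" "i \<noteq> j" "k < d"
  shows "cdet d (v[k := a \<cdot>\<^sub>v v ! i + b \<cdot>\<^sub>v v ! j])
    = (if k = i then a else if k = j then b else 0) * cdet d v"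
  using assms nonzero_frame_nth[OF assms(1,2)] nonzero_frame_nth[OF assms(1,3)]
  by (auto simp: cdet_update_add cdet_update_smult cdet_nth nonzero_frame_length)

section \<open>Base of the induction: determinants 0, 1 and -1\<close>

context unimodular_symbol
begin

lemma skew_below_two: "skew_below 2"
  unfolding skew_below_def
proof (intro allI impI)
  fix v :: "int vec list" and i j
  assume v: "nonzero_frame d v" and ij: "i < d" "j < d" "i \<noteq> j" and D: "\<bar>cdet d v\<bar> < 2"
  note sw = cdet_swap[OF nonzero_frame_length[OF v] ij]
  show "F (swap_entries i j v) + F v \<in> N"
  proof (cases "cdet d v = 0")
    case False
    then have "\<bar>cdet d v\<bar> = 1" using D by linarith
    then show ?thesis using f_swap[of v i j] v ij sw by (simp add: F_unimodular integral_frame_iff)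
  qed (use sw in \<open>simp add: F_dependent zero_mem\<close>)
qed

lemma F_sign:
  assumes v: "nonzero_frame d v" "\<bar>cdet d v\<bar> = 1" and i: "i < d" and e: "\<bar>e\<bar> = 1"
  shows "F (v[i := e \<cdot>\<^sub>v v ! i]) - F v \<in> N"
proof -
  note l = nonzero_frame_length[OF v(1)]
  have vi: "v ! i \<in> carrier_vec d" using nonzero_frame_nth[OF v(1) i] by simp
  have D: "cdet d (v[i := e \<cdot>\<^sub>v v ! i]) = e * cdet d v"
    using scale_entry(2)[OF v(1) i, of e] e by auto
  consider "e = 1" | "e = - 1" using e by linarith
  then show ?thesis
  proof cases
    case 1
    then show ?thesis using vi by (simp add: list_update_id zero_mem one_smult_vec)
  next
    case 2
    have "e \<cdot>\<^sub>v v ! i = - (v ! i)" unfolding 2 by (intro eq_vecI) auto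
    then show ?thesis using f_minus[of v i] v i D 2 by (simp add: F_unimodular integral_frame_iff)
  qed
qed

text \<open>All faces except \<open>v\<close> and those at \<open>i\<close> and \<open>j\<close> are
  degenerate, because the other coordinates of \<open>w\<close> vanish; what is left is
  \<open>f_add\<close> for the frame with \<open>a\<close> and \<open>b\<close> absorbed into its
  entries.\<close>

lemma defect_two:
  assumes v: "nonzero_frame d v" "\<bar>cdet d v\<bar> = 1" and ij: "i < d" "j < d" "i \<noteq> j"
    and e: "\<bar>a\<bar> = 1" "\<bar>b\<bar> = 1"
  defines "w \<equiv> a \<cdot>\<^sub>v v ! i + b \<cdot>\<^sub>v v ! j"
  shows "w \<in> carrier_vec d - {0\<^sub>v d}" "defect d F v w \<in> N"
proof -
  note l = nonzero_frame_length[OF v(1)]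
  have vi: "v ! i \<in> carrier_vec d" "v ! j \<in> carrier_vec d"
    using nonzero_frame_nth[OF v(1)] ij by auto
  have D: "cdet d (v[k := w]) = (if k = i then a else if k = j then b else 0) * cdet d v" if "k < d" for k
    unfolding w_def by (rule cdet_combination[OF v(1) ij that])
  have wc: "w \<in> carrier_vec d" using vi by (simp add: w_def)
  moreover have "w \<noteq> 0\<^sub>v d" using D[OF ij(1)] cdet_update_zero[OF l ij(1)] v(2) e by auto
  ultimately show w: "w \<in> carrier_vec d - {0\<^sub>v d}" by simp
  have "(\<Sum>k<d. F (v[k := w])) = (\<Sum>k\<in>{i, j}. F (v[k := w]))"
    using ij by (intro sum.mono_neutral_right) (auto simp: D F_dependent)
  then have df: "defect d F v w = F v - F (v[i := w]) - F (v[j := w])"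
    using ij by (simp add: defect_def)
  let ?vi = "v[i := a \<cdot>\<^sub>v v ! i]"
  let ?v = "?vi[j := b \<cdot>\<^sub>v v ! j]"
  have e0: "a \<noteq> 0" "b \<noteq> 0" using e by auto
  have ai: "nonzero_frame d ?vi" "\<bar>cdet d ?vi\<bar> = 1"
    using scale_entry[OF v(1) ij(1) e0(1)] v(2) e by (simp_all add: abs_mult)
  have "?vi ! j = v ! j" using ij by simp
  then have aj: "nonzero_frame d ?v" "\<bar>cdet d ?v\<bar> = 1"
    using scale_entry[OF ai(1) ij(2) e0(2)] ai(2) e by (simp_all add: abs_mult)
  have wi: "nonzero_frame d (v[i := w])" "\<bar>cdet d (v[i := w])\<bar> = 1"
    and wj: "nonzero_frame d (v[j := w])" "\<bar>cdet d (v[j := w])\<bar> = 1"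
    using D ij nonzero_frame_update[OF v(1) w] v(2) e by (simp_all add: abs_mult)
  have vi: "?v[i := w] = v[i := w, j := b \<cdot>\<^sub>v (v[i := w] ! j)]"
    and vj: "?v[j := w] = v[j := w, i := a \<cdot>\<^sub>v (v[j := w] ! i)]"
    using ij l by (auto intro!: nth_equalityI simp: nth_list_update)
  have "F ?v - F ?vi \<in> N" using F_sign[OF ai ij(2) e(2)] ij by simp
  moreover have "F ?vi - F v \<in> N" using F_sign[OF v ij(1) e(1)] .
  moreover have "F ?v - F (?v[i := w]) - F (?v[j := w]) \<in> N"
  proof -
    have "\<bar>cdet d (?v[i := w])\<bar> = 1" "\<bar>cdet d (?v[j := w])\<bar> = 1"
      using scale_entry(2)[OF wi(1) ij(2) e0(2)] scale_entry(2)[OF wj(1) ij(1) e0(1)] wi(2) wj(2) e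
      unfolding vi vj by (simp_all add: abs_mult)
    moreover have "w = ?v ! i + ?v ! j" using ij l by (simp add: w_def)
    ultimately show ?thesis
      using f_add[of ?v i j] aj ij by (simp add: F_unimodular integral_frame_iff)
  qed
  moreover have "F (?v[i := w]) - F (v[i := w]) \<in> N"
    unfolding vi by (rule F_sign[OF wi ij(2) e(2)])
  moreover have "F (?v[j := w]) - F (v[j := w]) \<in> N"
    unfolding vj by (rule F_sign[OF wj ij(1) e(1)])
  \<comment> \<open>The relation \<open>f_add\<close> for \<open>?v\<close>, corrected by sign
    changes in each of its three terms.\<close>
  moreover have "defect d F v w = (F ?v - F (?v[i := w]) - F (?v[j := w]))
      + (F (?v[i := w]) - F (v[i := w])) + (F (?v[j := w]) - F (v[j := w]))
      - ((F ?v - F ?vi) + (F ?vi - F v))"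
    by (simp add: df)
  ultimately show "defect d F v w \<in> N" by (simp only: add_mem diff_mem)
qed

lemma defect_zero:
  "cdet d v = 0 \<Longrightarrow> (\<And>i. i < d \<Longrightarrow> cdet d (v[i := w]) = 0) \<Longrightarrow> defect d F v w = 0"
  by (simp add: defect_def F_dependent)

text \<open>Induction on the number of nonzero coordinates of \<open>w\<close>: split off two of them.\<close>

lemma defect_unimodular:
  assumes "nonzero_frame d v" "\<bar>cdet d v\<bar> = 1" "w \<in> carrier_vec d - {0\<^sub>v d}"
    "\<And>i. i < d \<Longrightarrow> \<bar>cdet d (v[i := w])\<bar> \<le> 1"
  shows "defect d F v w \<in> N"
  using assms
proof (induction "card {i. i < d \<and> cdet d (v[i := w]) \<noteq> 0}" arbitrary: v rule: less_induct)
  case (less v)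
  note v = less.prems(1,2) and w = less.prems(3) and le = less.prems(4)
  note l = nonzero_frame_length[OF v(1)]
  let ?S = "\<lambda>v. {i. i < d \<and> cdet d (v[i := w]) \<noteq> 0}"
  have D0: "cdet d v \<noteq> 0" using v(2) by auto
  \<comment> \<open>As the determinant is 1 or -1, multiplying by it is dividing by it:
    \<open>c i\<close> is the \<open>i\<close>-th coordinate of \<open>w\<close>, and for
    \<open>i < d\<close> it is 0, 1 or -1.\<close>
  define c where "c i = cdet d (v[i := w]) * cdet d v" for i
  have DD: "cdet d v * cdet d v = 1" using v(2) by (simp add: abs_if split: if_splits)
  have c: "cdet d (v[i := w]) = c i * cdet d v" for i
    using DD by (simp add: c_def mult.assoc)
  have cle: "\<bar>c i\<bar> \<le> 1" if "i < d" for i using le[OF that] v(2) by (simp add: c_def abs_mult)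
  have c0: "c i \<noteq> 0 \<longleftrightarrow> cdet d (v[i := w]) \<noteq> 0" for i using D0 by (simp add: c_def)
  have "\<exists>i<d. c i \<noteq> 0"
    using coord_determines[OF l _ _ D0, of w "0\<^sub>v d"] w cdet_update_zero[OF l] c0 by auto
  then obtain i where i: "i < d" "c i \<noteq> 0" by blast
  have ci: "\<bar>c i\<bar> = 1" using cle[OF i(1)] i(2) by linarith
  show ?case
  proof (cases "\<exists>j<d. j \<noteq> i \<and> c j \<noteq> 0")
    case False
    have vi: "v ! i \<in> carrier_vec d" using nonzero_frame_nth[OF v(1) i(1)] by simp
    have "w = c i \<cdot>\<^sub>v v ! i"
      using False i vi w l D0
      by (intro coord_determines[OF l]) (auto simp: cdet_update_smult cdet_nth c)
    moreover have "(\<Sum>k<d. F (v[k := w])) = (\<Sum>k\<in>{i}. F (v[k := w]))"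
      using i False by (intro sum.mono_neutral_right) (auto simp: c F_dependent)
    ultimately show ?thesis
      using F_sign[OF v i(1) ci] minus_mem by (fastforce simp: defect_def)
  next
    case True
    then obtain j where j: "j < d" "j \<noteq> i" "c j \<noteq> 0" by blast
    have cj: "\<bar>c j\<bar> = 1" using cle[OF j(1)] j(3) by linarith
    \<comment> \<open>\<open>u\<close> keeps the two terms of \<open>w\<close> at \<open>i\<close>
      and \<open>j\<close>. Exchanging \<open>w\<close> for \<open>u\<close> is possible because all
      2 x 2 minors of their coordinates are at most 1 in absolute value.\<close>
    define u where "u = c i \<cdot>\<^sub>v v ! i + c j \<cdot>\<^sub>v v ! j"
    note two = defect_two[OF v i(1) j(1) j(2)[symmetric] ci cj, folded u_def]
    define b where "b k = (if k = i then c i else if k = j then c j else 0)" for k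
    have b: "cdet d (v[k := u]) = b k * cdet d v" if "k < d" for k
      unfolding u_def b_def by (rule cdet_combination[OF v(1) i(1) j(1) j(2)[symmetric] that])
    have uw: "cdet d (v[k := u, m := w]) = (b k * c m - b m * c k) * cdet d v"
      "cdet d (v[k := w, m := u]) = (c k * b m - c m * b k) * cdet d v"
      if km: "k < d" "m < d" "k \<noteq> m" for k m
    proof -
      have "cdet d v * cdet d (v[k := u, m := w]) = cdet d v * ((b k * c m - b m * c k) * cdet d v)"
        using cdet_pluecker[OF l km, of u w] two(1) w b km c by (simp add: algebra_simps)
      then show "cdet d (v[k := u, m := w]) = (b k * c m - b m * c k) * cdet d v" using D0 by simp
      have "cdet d v * cdet d (v[k := w, m := u]) = cdet d v * ((c k * b m - c m * b k) * cdet d v)"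
        using cdet_pluecker[OF l km, of w u] two(1) w b km c by (simp add: algebra_simps)
      then show "cdet d (v[k := w, m := u]) = (c k * b m - c m * b k) * cdet d v" using D0 by simp
    qed
    have c1: "\<bar>c i * c m\<bar> \<le> 1" "\<bar>c j * c m\<bar> \<le> 1" if "m < d" for m
      using cle[OF that] ci cj by (simp_all add: abs_mult)
    have bc: "\<bar>b k * c m - b m * c k\<bar> \<le> 1" if "k < d" "m < d" for k m
      using c1[OF that(1)] c1[OF that(2)] unfolding b_def by (auto simp: mult.commute)
    have less2: "\<bar>cdet d (v[k := u, m := w])\<bar> < 2" "\<bar>cdet d (v[k := w, m := u])\<bar> < 2"
      if "k < d" "m < d" "k \<noteq> m" for k m
      using bc[OF that(1,2)] bc[OF that(2,1)] v(2) unfolding uw[OF that] abs_mult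
      by (auto simp: mult.commute)
    have "defect d F (v[k := u]) w \<in> N" if k: "k < d" for k
    proof -
      \<comment> \<open>For \<open>k\<close> in {i, j}, replacing \<open>v ! k\<close> by
        \<open>u\<close> makes the other of these two coordinates of \<open>w\<close> vanish, and
        the induction applies. For other \<open>k\<close> the frame \<open>v[k := u]\<close> is
        degenerate: either so are all faces, or a flip makes the unimodular frame
        \<open>v[k := w]\<close> the base, over which \<open>u\<close> is again a signed sum of two
        entries.\<close>
      consider "k = i \<or> k = j" | "k \<noteq> i" "k \<noteq> j" "c k = 0" | "k \<noteq> i" "k \<noteq> j" "c k \<noteq> 0" by blast
      then show ?thesis
      proof cases
        case 1
        have vk: "nonzero_frame d (v[k := u])" by (rule nonzero_frame_update[OF v(1) two(1)])
        have Dk: "\<bar>cdet d (v[k := u])\<bar> = 1" using 1 k b v(2) ci cj by (auto simp: b_def abs_mult)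
        have dk: "cdet d (v[k := u, m := w]) = (if m = k then c k else b k * c m - b m * c k) * cdet d v"
          if "m < d" for m using uw(1)[OF k that] c by auto
        have "?S (v[k := u]) \<subseteq> ?S v - {if k = i then j else i}"
        proof
          fix m assume m: "m \<in> ?S (v[k := u])"
          then have "(if m = k then c k else b k * c m - b m * c k) \<noteq> 0" using dk[of m] by auto
          then show "m \<in> ?S v - {if k = i then j else i}"
            using 1 i j m by (auto simp: c0[symmetric] b_def split: if_splits)
        qed
        moreover have "(if k = i then j else i) \<in> ?S v" using i j c0 by auto
        ultimately have "card (?S (v[k := u])) < card (?S v)"
          by (intro psubset_card_mono) auto
        moreover have "\<bar>cdet d (v[k := u, m := w])\<bar> \<le> 1" if "m < d" for m
          using less2(1)[OF k that] le[OF k] that by (cases "m = k") auto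
        ultimately show ?thesis by (intro less.hyps vk Dk w)
      next
        case 2
        have "cdet d (v[k := u, m := w]) = 0" if "m < d" for m
          using 2 uw(1)[OF k that] c by (cases "m = k") (auto simp: b_def)
        then show ?thesis using b[OF k] 2 by (subst defect_zero) (auto simp: b_def zero_mem)
      next
        case 3
        let ?v = "v[k := w]"
        have vk: "nonzero_frame d ?v" by (rule nonzero_frame_update[OF v(1) w])
        have Dk: "\<bar>cdet d ?v\<bar> = 1" using 3 le[OF k] c0 by force
        have "u = c i \<cdot>\<^sub>v ?v ! i + c j \<cdot>\<^sub>v ?v ! j" using 3 by (simp add: u_def)
        then have "defect d F ?v u \<in> N"
          using defect_two(2)[OF vk Dk i(1) j(1) j(2)[symmetric] ci cj] by simp
        moreover have "defect d F (?v[k := u]) (?v ! k) + defect d F ?v u \<in> N"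
          using less2(2) k by (intro flip[OF skew_below_two vk two(1)]) auto
        ultimately show ?thesis using diff_mem k l by fastforce
      qed
    qed
    then have "(\<Sum>k<d. defect d F (v[k := u]) w) \<in> N" by (intro sum_mem) simp
    moreover have "defect d F v w - defect d F v u - (\<Sum>k<d. defect d F (v[k := u]) w) \<in> N"
      by (rule exchange[OF skew_below_two v(1) two(1) w less2(1)])
    ultimately have "(defect d F v w - defect d F v u - (\<Sum>k<d. defect d F (v[k := u]) w))
       + (\<Sum>k<d. defect d F (v[k := u]) w) + defect d F v u \<in> N" using two(2) by (intro add_mem)
    then show ?thesis by simp
  qed
qed

lemma cocycle_below_two: "cocycle_below 2"
  unfolding cocycle_below_def
proof (intro allI impI)
  fix v :: "int vec list" and w
  assume v: "nonzero_frame d v" and w: "w \<in> carrier_vec d - {0\<^sub>v d}" and D: "\<bar>cdet d v\<bar> < 2"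
    and Di: "\<forall>i<d. \<bar>cdet d (v[i := w])\<bar> < 2"
  note l = nonzero_frame_length[OF v]
  consider "\<bar>cdet d v\<bar> = 1" | i where "i < d" "\<bar>cdet d (v[i := w])\<bar> = 1"
    | "cdet d v = 0" "\<And>i. i < d \<Longrightarrow> cdet d (v[i := w]) = 0"
    using D Di by force
  then show "defect d F v w \<in> N"
  proof cases
    case 1
    then show ?thesis using Di by (intro defect_unimodular[OF v _ w]) auto
  next
    case (2 i)
    have "defect d F (v[i := w]) (v ! i) + defect d F v w \<in> N"
      using Di by (intro flip[OF skew_below_two v w 2(1)]) auto
    moreover have "\<bar>cdet d (v[i := w, j := v ! i])\<bar> \<le> 1" if "j < d" for j
    proof (cases "j = i")
      case False
      then have "\<bar>cdet d (v[i := w, j := v ! i])\<bar> = \<bar>cdet d (v[j := w])\<bar>"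
        using swap_entries_update2(2)[of i v j w] cdet_swap[of "v[j := w]" d i j] that 2(1) l by simp
      then show ?thesis using Di that by force
    qed (use D l 2 in \<open>auto simp: list_update_overwrite list_update_id\<close>)
    then have "defect d F (v[i := w]) (v ! i) \<in> N"
      by (intro defect_unimodular[OF nonzero_frame_update[OF v w] 2(2) nonzero_frame_nth[OF v 2(1)]])
    ultimately show ?thesis using diff_mem by fastforce
  next
    case 3
    then show ?thesis by (simp add: defect_zero zero_mem)
  qed
qed

text \<open>The start is 2 because below it only the determinants 0, 1 and -1 occur, where
  \<open>F\<close> is 0 or \<open>f\<close>. Each of the two steps uses both hypotheses.\<close>

lemma skew_cocycle_below: "skew_below (int n + 2) \<and> cocycle_below (int n + 2)"
proof (induction n)
  case (Suc n)
  then show ?case using skew_below_step[of "int n + 2"] cocycle_below_step[of "int n + 2"]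
    by (simp add: add_ac)
qed (simp add: skew_below_two cocycle_below_two)

theorem F_swap:
  assumes "nonzero_frame d v" "i < d" "j < d" "i \<noteq> j"
  shows "F (swap_entries i j v) + F v \<in> N"
  using skew_belowD[OF conjunct1[OF skew_cocycle_below[of "nat \<bar>cdet d v\<bar>"]] assms] by simp

theorem F_cocycle:
  assumes "nonzero_frame d v" "w \<in> carrier_vec d - {0\<^sub>v d}"
  shows "defect d F v w \<in> N"
proof -
  define n where "n = nat (\<bar>cdet d v\<bar> + (\<Sum>i<d. \<bar>cdet d (v[i := w])\<bar>))"
  have "\<bar>cdet d (v[i := w])\<bar> \<le> (\<Sum>i<d. \<bar>cdet d (v[i := w])\<bar>)" if "i < d" for i
    using that by (intro member_le_sum) auto
  moreover have "0 \<le> (\<Sum>i<d. \<bar>cdet d (v[i := w])\<bar>)" by (intro sum_nonneg) auto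
  ultimately have "\<bar>cdet d v\<bar> < int n + 2" "\<forall>i<d. \<bar>cdet d (v[i := w])\<bar> < int n + 2"
    unfolding n_def by (auto simp: add.commute add_pos_nonneg) (smt (verit))+
  then show ?thesis using skew_cocycle_below[of n] assms by (simp add: cocycle_below_def)
qed

end

section \<open>Skew-symmetric functions of lists\<close>

text \<open>Stands for (-1)^n x in a group without scalars.\<close>

definition signed :: "nat \<Rightarrow> 'm :: ab_group_add \<Rightarrow> 'm" where
  "signed n x = (if even n then x else - x)"

lemma signed_simps [simp]: "signed 0 x = x" "signed (Suc n) x = - signed n x" "signed n (- x) = - signed n x"
  by (auto simp: signed_def)

lemma signed_add: "signed n (x + y) = signed n x + signed n y"
  and signed_diff: "signed n (x - y) = signed n x - signed n y"
  by (auto simp: signed_def)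

lemma (in additive_subgroup_set) signed_mem_iff [simp]: "signed n x \<in> N \<longleftrightarrow> x \<in> N"
  using minus_mem[of x] minus_mem[of "- x"] by (auto simp: signed_def)

text \<open>Skew-symmetry for neighbours only, the form in which it is proved for symbols. The entry
  set \<open>T\<close> is abstract because the locale serves symbols of field elements and functions
  of vectors alike.\<close>

locale skew_list_function = additive_subgroup_set N for N :: "'m :: ab_group_add set" +
  fixes n :: nat and T :: "'a set" and G :: "'a list \<Rightarrow> 'm"
  assumes adjacent: "length as + length bs + 2 = n \<Longrightarrow> set as \<subseteq> T \<Longrightarrow> set bs \<subseteq> T \<Longrightarrow> a \<in> T \<Longrightarrow> b \<in> T \<Longrightarrow>
    G (as @ a # b # bs) + G (as @ b # a # bs) \<in> N"
begin

lemma move: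
  assumes "length as + length xs + length bs + 1 = n" "set as \<subseteq> T" "set xs \<subseteq> T" "set bs \<subseteq> T" "a \<in> T"
  shows "G (as @ a # xs @ bs) - signed (length xs) (G (as @ xs @ a # bs)) \<in> N"
  using assms
proof (induction xs arbitrary: as)
  case (Cons x xs)
  have "G (as @ a # x # xs @ bs) + G ((as @ [x]) @ a # xs @ bs) \<in> N"
    using adjacent[of as "xs @ bs" a x] Cons.prems by simp
  moreover have "G ((as @ [x]) @ a # xs @ bs) - signed (length xs) (G ((as @ [x]) @ xs @ a # bs)) \<in> N"
    using Cons.prems by (intro Cons.IH) auto
  ultimately show ?case using diff_mem by fastforce
qed (simp add: zero_mem)

text \<open>Move both lists to a form where \<open>a\<close> and \<open>b\<close> are neighbours.
  The signs from passing \<open>xs\<close> are equal, so one adjacent swap decides.\<close>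

lemma swap_lists:
  assumes "length as + length xs + length bs + 2 = n" "set as \<subseteq> T" "set xs \<subseteq> T" "set bs \<subseteq> T" "a \<in> T" "b \<in> T"
  shows "G (as @ b # xs @ a # bs) + G (as @ a # xs @ b # bs) \<in> N"
proof -
  let ?s = "signed (length xs)"
  have "G (as @ b # xs @ a # bs) - ?s (G (as @ xs @ b # a # bs)) \<in> N"
    "G (as @ a # xs @ b # bs) - ?s (G (as @ xs @ a # b # bs)) \<in> N"
    using move[of as xs "a # bs" b] move[of as xs "b # bs" a] assms by auto
  moreover have "?s (G (as @ xs @ b # a # bs) + G (as @ xs @ a # b # bs)) \<in> N"
    using adjacent[of "as @ xs" bs b a] assms by simp
  ultimately have "(G (as @ b # xs @ a # bs) - ?s (G (as @ xs @ b # a # bs)))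
     + (G (as @ a # xs @ b # bs) - ?s (G (as @ xs @ a # b # bs)))
     + ?s (G (as @ xs @ b # a # bs) + G (as @ xs @ a # b # bs)) \<in> N" by (intro add_mem)
  then show ?thesis by (simp add: signed_add)
qed

end

lemma split_two_entries:
  assumes "i < j" "j < length v"
  obtains as xs bs where "v = as @ v ! i # xs @ v ! j # bs" "length as = i" "j = Suc (i + length xs)"
    "\<And>a. v[i := a] = as @ a # xs @ v ! j # bs" "\<And>b. v[j := b] = as @ v ! i # xs @ b # bs"
    "\<And>a b. v[i := a, j := b] = as @ a # xs @ b # bs"
proof -
  define as xs bs where "as = take i v" "xs = take (j - Suc i) (drop (Suc i) v)" "bs = drop (Suc j) v"
  have l: "length as = i" "j = Suc (i + length xs)" using assms by (auto simp: as_xs_bs_def)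
  have "drop (Suc i) v = xs @ drop j v"
    using assms append_take_drop_id[of "j - Suc i" "drop (Suc i) v"] by (simp add: as_xs_bs_def)
  then have v: "v = as @ v ! i # xs @ v ! j # bs"
    using assms id_take_nth_drop[of i v] Cons_nth_drop_Suc[of j v] by (simp add: as_xs_bs_def)
  have u: "(as @ x # xs @ y # bs)[i := a] = as @ a # xs @ y # bs"
    "(as @ x # xs @ y # bs)[j := b] = as @ x # xs @ b # bs" for x y a b
    using l by (simp_all add: list_update_append)
  show thesis
    by (rule that[OF v l]) (metis v u)+
qed

lemma (in skew_list_function) skew_swap:
  assumes "length v = n" "set v \<subseteq> T" "i < n" "j < n" "i \<noteq> j"
  shows "G (swap_entries i j v) + G v \<in> N"
proof -
  have "G (v[i := v ! j, j := v ! i]) + G v \<in> N" if ij: "i < j" "j < n" for i j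
  proof -
    from ij assms(1) have "j < length v" by simp
    from split_two_entries[OF ij(1) this] obtain as xs bs where
      v: "v = as @ v ! i # xs @ v ! j # bs" "v[i := v ! j, j := v ! i] = as @ v ! j # xs @ v ! i # bs"
      by metis
    have "length v = length (as @ v ! i # xs @ v ! j # bs)" "set v = set (as @ v ! i # xs @ v ! j # bs)"
      using v(1) by simp_all
    then have "G (as @ v ! j # xs @ v ! i # bs) + G (as @ v ! i # xs @ v ! j # bs) \<in> N"
      using assms(1,2) by (intro swap_lists) auto
    then show ?thesis using v by simp
  qed
  from this[of i j] this[of j i] show ?thesis
    using assms by (cases "i < j") (auto simp: list_update_swap)
qed

section \<open>Symbols modulo characters\<close>

text \<open>Symbols {a_1, ..., a_n} modulo a subgroup. \<open>half_mem\<close> says that the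
  quotient has no 2-torsion, which is all that is taken from tensoring with the rationals.
  Characters are killed in the last slot, as in the cokernel, and in the other slots by
  skew-symmetry.\<close>

locale milnor_symbols = additive_subgroup_set N for N :: "'m :: ab_group_add set" +
  fixes n :: nat and T Ch :: "'a :: field set" and S :: "'a list \<Rightarrow> 'm"
  assumes half_mem: "m + m \<in> N \<Longrightarrow> m \<in> N"
    and T_one: "1 \<in> T" and T_minus_one: "- 1 \<in> T"
    and T_mult: "a \<in> T \<Longrightarrow> b \<in> T \<Longrightarrow> a * b \<in> T" and T_inverse: "a \<in> T \<Longrightarrow> inverse a \<in> T"
    and T_nonzero: "a \<in> T \<Longrightarrow> a \<noteq> 0" and T_one_minus: "a \<in> T \<Longrightarrow> a \<noteq> 1 \<Longrightarrow> 1 - a \<in> T"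
    and Ch_subset: "Ch \<subseteq> T" and Ch_mult: "x \<in> Ch \<Longrightarrow> y \<in> Ch \<Longrightarrow> x * y \<in> Ch"
    and S_mult: "length as + length bs + 1 = n \<Longrightarrow> set as \<subseteq> T \<Longrightarrow> set bs \<subseteq> T \<Longrightarrow> a \<in> T \<Longrightarrow> b \<in> T \<Longrightarrow>
      S (as @ (a * b) # bs) - S (as @ a # bs) - S (as @ b # bs) \<in> N"
    and S_steinberg: "length as + length bs + 2 = n \<Longrightarrow> set as \<subseteq> T \<Longrightarrow> set bs \<subseteq> T \<Longrightarrow>
      a \<in> T \<Longrightarrow> 1 - a \<in> T \<Longrightarrow> S (as @ a # (1 - a) # bs) \<in> N"
    and S_char_last: "length as + 1 = n \<Longrightarrow> set as \<subseteq> T \<Longrightarrow> \<chi> \<in> Ch \<Longrightarrow> S (as @ [\<chi>]) \<in> N"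
begin

context
  fixes as bs
  assumes len: "length as + length bs + 1 = n" and as: "set as \<subseteq> T" and bs: "set bs \<subseteq> T"
begin

lemma S_one: "S (as @ 1 # bs) \<in> N"
  using minus_mem[OF S_mult[OF len as bs T_one T_one]] by simp

lemma S_minus_one: "S (as @ (- 1) # bs) \<in> N"
proof -
  \<comment> \<open>Since (-1)(-1) = 1, twice the symbol of -1 is the symbol of 1, and halving is
    allowed.\<close>
  have "S (as @ 1 # bs) - (S (as @ 1 # bs) - S (as @ (- 1) # bs) - S (as @ (- 1) # bs)) \<in> N"
    using S_mult[OF len as bs T_minus_one T_minus_one] by (intro diff_mem[OF S_one]) simp
  then have "S (as @ (- 1) # bs) + S (as @ (- 1) # bs) \<in> N" by simp
  then show ?thesis by (rule half_mem)
qed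

lemma S_divide: "a \<in> T \<Longrightarrow> b \<in> T \<Longrightarrow> S (as @ (a * inverse b) # bs) - (S (as @ a # bs) - S (as @ b # bs)) \<in> N"
  using minus_mem[OF S_mult[OF len as bs, of "a * inverse b" b]]
  by (simp add: T_mult T_inverse T_nonzero mult.assoc algebra_simps)

lemma S_inverse: "a \<in> T \<Longrightarrow> S (as @ inverse a # bs) + S (as @ a # bs) \<in> N"
  using add_mem[OF S_divide[OF T_one, of a] S_one] by (simp add: algebra_simps)

lemma S_uminus: "a \<in> T \<Longrightarrow> S (as @ (- a) # bs) - S (as @ a # bs) \<in> N"
  using add_mem[OF S_mult[OF len as bs T_minus_one, of a] S_minus_one] by simp

end

context
  fixes as bs
  assumes len: "length as + length bs + 2 = n" and as: "set as \<subseteq> T" and bs: "set bs \<subseteq> T"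
begin

text \<open>Classical: -a = (1 - a) / (1 - 1/a), and {a, 1 - 1/a} = -{1/a, 1 - 1/a} = 0. The value a
  = 1 is separate because the denominator vanishes.\<close>

lemma S_neg_pair:
  assumes a: "a \<in> T"
  shows "S (as @ a # (- a) # bs) \<in> N"
proof (cases "a = 1")
  case True
  then show ?thesis using S_one[of as "- 1 # bs"] len as bs T_minus_one by simp
next
  case False
  define c where "c = 1 - inverse a"
  have a0: "a \<noteq> 0" by (rule T_nonzero[OF a])
  have c: "c \<in> T" unfolding c_def using a False by (intro T_one_minus T_inverse) simp_all
  have p: "1 - a \<in> T" using a False by (intro T_one_minus)
  have eq: "- a = (1 - a) * inverse c"
    using a0 False by (simp add: c_def field_simps)
  have "S (as @ a # (1 - a) # bs) \<in> N" by (rule S_steinberg[OF len as bs a p])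
  moreover have "S (as @ inverse a # c # bs) \<in> N"
    using S_steinberg[OF len as bs T_inverse[OF a]] c by (simp add: c_def)
  moreover have "S (as @ inverse a # c # bs) + S (as @ a # c # bs) \<in> N"
    using S_inverse[of as "c # bs" a] a c len as bs by simp
  moreover have "S (as @ a # (- a) # bs) - (S (as @ a # (1 - a) # bs) - S (as @ a # c # bs)) \<in> N"
    using S_divide[of "as @ [a]" bs "1 - a" c] p c a len as bs by (simp add: eq)
  ultimately have "(S (as @ a # (- a) # bs) - (S (as @ a # (1 - a) # bs) - S (as @ a # c # bs)))
    + S (as @ a # (1 - a) # bs) + S (as @ inverse a # c # bs)
    - (S (as @ inverse a # c # bs) + S (as @ a # c # bs)) \<in> N"
    by - (assumption | rule add_mem diff_mem)+
  then show ?thesis by simp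
qed

text \<open>In Milnor K-theory itself {a, a} = {a, -1}; here symbols with an entry -1 lie in
  \<open>N\<close>.\<close>

lemma S_same:
  assumes a: "a \<in> T"
  shows "S (as @ a # a # bs) \<in> N"
  using diff_mem[OF S_neg_pair[OF a] S_uminus[of "as @ [a]" bs a]] a len as bs by simp

lemma S_left:
  assumes "a \<in> T" "b \<in> T" "c \<in> T"
  shows "S (as @ (a * b) # c # bs) - S (as @ a # c # bs) - S (as @ b # c # bs) \<in> N"
    "S (as @ c # (a * b) # bs) - S (as @ c # a # bs) - S (as @ c # b # bs) \<in> N"
  using S_mult[of as "c # bs" a b] S_mult[of "as @ [c]" bs a b] assms len as bs by simp_all

text \<open>Expand {ab, ab} = 0 bilinearly and remove {a, a} and {b, b}.\<close>

lemma S_skew: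
  assumes a: "a \<in> T" and b: "b \<in> T"
  shows "S (as @ a # b # bs) + S (as @ b # a # bs) \<in> N"
proof -
  have "S (as @ (a * b) # (a * b) # bs)
    - (S (as @ (a * b) # (a * b) # bs) - S (as @ a # (a * b) # bs) - S (as @ b # (a * b) # bs))
    - (S (as @ a # (a * b) # bs) - S (as @ a # a # bs) - S (as @ a # b # bs))
    - (S (as @ b # (a * b) # bs) - S (as @ b # a # bs) - S (as @ b # b # bs))
    - S (as @ a # a # bs) - S (as @ b # b # bs) \<in> N"
    using a b by (intro diff_mem S_same S_left T_mult)
  then show ?thesis by simp
qed

end

sublocale skew_list_function N n T S
  by unfold_locales (rule S_skew)

lemma S_char:
  "length as + length bs + 1 = n \<Longrightarrow> set as \<subseteq> T \<Longrightarrow> set bs \<subseteq> T \<Longrightarrow> \<chi> \<in> Ch \<Longrightarrow> S (as @ \<chi> # bs) \<in> N"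
proof (induction bs arbitrary: as)
  case (Cons b bs)
  have "S (as @ \<chi> # b # bs) + S ((as @ [b]) @ \<chi> # bs) \<in> N"
    using S_skew[of as bs \<chi> b] Cons.prems Ch_subset by auto
  moreover have "S ((as @ [b]) @ \<chi> # bs) \<in> N" using Cons.prems by (intro Cons.IH) auto
  ultimately show ?case using diff_mem by fastforce
qed (simp add: S_char_last)

lemma one_minus_Ch: "x \<in> Ch \<Longrightarrow> x \<noteq> 1 \<Longrightarrow> 1 - x \<in> T"
  using Ch_subset T_one_minus by auto

text \<open>The Steinberg relation for \<open>a = (1 - x) / (1 - x y)\<close>, where
  \<open>1 - a = x (1 - y) / (1 - x y)\<close>.\<close>

lemma S_three_term:
  assumes len: "length as + length bs + 2 = n" and as: "set as \<subseteq> T" and bs: "set bs \<subseteq> T"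
    and x: "x \<in> Ch" "x \<noteq> 1" and y: "y \<in> Ch" "y \<noteq> 1" and xy: "x * y \<noteq> 1"
  shows "S (as @ (1 - x) # (1 - y) # bs) - S (as @ (1 - x * y) # (1 - y) # bs)
    - S (as @ (1 - x) # (1 - x * y) # bs) \<in> N"
proof -
  define p q r where "p = 1 - x" "q = 1 - y" "r = 1 - x * y"
  have T: "x \<in> T" "p \<in> T" "q \<in> T" "r \<in> T"
    using x y xy one_minus_Ch Ch_mult Ch_subset by (auto simp: p_q_r_def)
  let ?E = "\<lambda>a b. S (as @ a # b # bs)"
  let ?b = "x * q * inverse r"
  have r0: "r \<noteq> 0" using T T_nonzero by blast
  have b: "1 - p * inverse r = ?b"
    using r0 by (simp add: field_simps) (simp add: p_q_r_def algebra_simps)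
  have bT: "p * inverse r \<in> T" "?b \<in> T" "x * q \<in> T" using T by (auto intro!: T_mult T_inverse)
  have 1: "?E (p * inverse r) ?b \<in> N"
    using S_steinberg[OF len as bs bT(1)] bT(2) by (simp only: b)
  have 2: "?E (p * inverse r) ?b - (?E p ?b - ?E r ?b) \<in> N"
    using S_divide[of as "?b # bs" p r] len as bs T bT by simp
  have 3: "?E c ?b - (?E c (x * q) - ?E c r) \<in> N" if "c \<in> T" for c
    using S_divide[of "as @ [c]" bs "x * q" r] len as bs T bT that by simp
  have 4: "?E c (x * q) - ?E c x - ?E c q \<in> N" if "c \<in> T" for c
    using S_mult[of "as @ [c]" bs x q] len as bs T that by simp
  have 5: "?E c x \<in> N" if "c \<in> T" for c
    using S_char[of "as @ [c]" bs x] len as bs x that by simp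
  have 6: "?E r r \<in> N" by (rule S_same[OF len as bs T(4)])
  \<comment> \<open>Bilinearity turns {p/r, xq/r} into {p, xq} - {p, r} - {r, xq} + {r, r}. The
    character \<open>x\<close> splits off and {r, r} vanishes, which leaves {p, q} - {p, r} - {r,
    q}.\<close>
  have "(?E (p * inverse r) ?b - (?E (p * inverse r) ?b - (?E p ?b - ?E r ?b))
    - (?E p ?b - (?E p (x * q) - ?E p r)) + (?E r ?b - (?E r (x * q) - ?E r r)))
    - (?E p (x * q) - ?E p x - ?E p q) + (?E r (x * q) - ?E r x - ?E r q) - ?E p x + ?E r x - ?E r r \<in> N"
    by (intro add_mem diff_mem 1 2 3 4 5 6 T)
  then show ?thesis by (simp add: p_q_r_def algebra_simps)
qed

text \<open>Since \<open>1 - 1 / x = - (1 - x) / x\<close>.\<close>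

lemma S_one_minus_inverse:
  assumes "length as + length bs + 1 = n" "set as \<subseteq> T" "set bs \<subseteq> T" and x: "x \<in> Ch" "x \<noteq> 1"
  shows "S (as @ (1 - inverse x) # bs) - S (as @ (1 - x) # bs) \<in> N"
proof -
  have x0: "x \<noteq> 0" and xT: "x \<in> T" using x Ch_subset T_nonzero by auto
  have p: "1 - x \<in> T" by (rule one_minus_Ch[OF x])
  have "1 - inverse x = - ((1 - x) * inverse x)" using x0 by (simp add: field_simps)
  then have "S (as @ (1 - inverse x) # bs) - S (as @ ((1 - x) * inverse x) # bs) \<in> N"
    using S_uminus[OF assms(1-3) T_mult[OF p T_inverse[OF xT]]] by simp
  moreover have "S (as @ ((1 - x) * inverse x) # bs) - (S (as @ (1 - x) # bs) - S (as @ x # bs)) \<in> N"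
    by (rule S_divide[OF assms(1-3) p xT])
  moreover have "S (as @ x # bs) \<in> N" by (rule S_char[OF assms(1-3) x(1)])
  ultimately have "(S (as @ (1 - inverse x) # bs) - S (as @ ((1 - x) * inverse x) # bs))
    + (S (as @ ((1 - x) * inverse x) # bs) - (S (as @ (1 - x) # bs) - S (as @ x # bs))) - S (as @ x # bs) \<in> N"
    by - (assumption | rule add_mem diff_mem)+
  then show ?thesis by simp
qed

text \<open>With x = ch v_i and y = ch v_j, the additive axiom is \<open>S_three_term\<close>, as ch
  (v_i + v_j) = x y. The assumption \<open>inj\<close> keeps the entries 1 - ch v nonzero.\<close>

lemma unimodular_symbol_chars:
  fixes ch :: "int vec \<Rightarrow> 'a"
  assumes ch: "\<And>v. v \<in> carrier_vec n \<Longrightarrow> ch v \<in> Ch"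
    and add: "\<And>v w. v \<in> carrier_vec n \<Longrightarrow> w \<in> carrier_vec n \<Longrightarrow> ch (v + w) = ch v * ch w"
    and minus: "\<And>v. v \<in> carrier_vec n \<Longrightarrow> ch (- v) = inverse (ch v)"
    and inj: "\<And>v. v \<in> carrier_vec n \<Longrightarrow> ch v = 1 \<Longrightarrow> v = 0\<^sub>v n"
  shows "unimodular_symbol N n (\<lambda>v. S (map (\<lambda>v. 1 - ch v) v))"
proof
  let ?g = "\<lambda>v. 1 - ch v"
  have T: "?g v \<in> T" if "v \<in> carrier_vec n - {0\<^sub>v n}" for v
    using that ch inj by (intro one_minus_Ch) auto
  have frame: "set (map ?g v) \<subseteq> T" if "nonzero_frame n v" for v
    using that T by (auto simp: nonzero_frame_def)
  show "S (map ?g (swap_entries i j v)) + S (map ?g v) \<in> N"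
    if v: "integral_frame n v" and ij: "i < n" "j < n" "i \<noteq> j" for v i j
  proof -
    have v: "nonzero_frame n v" using v by (simp add: integral_frame_iff)
    have "map ?g (swap_entries i j v) = swap_entries i j (map ?g v)"
      using ij nonzero_frame_length[OF v] by (simp add: map_update)
    then show ?thesis using skew_swap[of "map ?g v" i j] frame[OF v] ij nonzero_frame_length[OF v] by simp
  qed
  show "S (map ?g (v[i := - (v ! i)])) - S (map ?g v) \<in> N"
    if v: "integral_frame n v" and i: "i < n" for v i
  proof -
    have v: "nonzero_frame n v" using v by (simp add: integral_frame_iff)
    note l = nonzero_frame_length[OF v]
    let ?as = "map ?g (take i v)" and ?bs = "map ?g (drop (Suc i) v)"
    have vi: "v ! i \<in> carrier_vec n" "v ! i \<noteq> 0\<^sub>v n" using nonzero_frame_nth[OF v i] by auto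
    have s: "set ?as \<subseteq> T" "set ?bs \<subseteq> T"
      using frame[OF v] set_take_subset[of i v] set_drop_subset[of "Suc i" v] by auto
    have e1: "map ?g v = ?as @ ?g (v ! i) # ?bs"
      using i l id_take_nth_drop[of i v] by (metis list.simps(9) map_append)
    have e2: "map ?g (v[i := - (v ! i)]) = ?as @ (1 - inverse (ch (v ! i))) # ?bs"
      using i l vi by (simp add: upd_conv_take_nth_drop minus)
    have len: "length ?as + length ?bs + 1 = n" using i l by simp
    have ne: "ch (v ! i) \<noteq> 1" using inj[of "v ! i"] vi by blast
    show ?thesis
      unfolding e2 by (subst e1) (rule S_one_minus_inverse[OF len s ch[OF vi(1)] ne])
  qed
  have three: "S (map ?g v) - S (map ?g (v[i := v ! i + v ! j])) - S (map ?g (v[j := v ! i + v ! j])) \<in> N"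
    if v: "integral_frame n v" and ij: "i < j" "j < n" for v i j
  proof -
    have v: "nonzero_frame n v" and D: "cdet n v \<noteq> 0" using v by (auto simp: integral_frame_iff)
    note l = nonzero_frame_length[OF v]
    let ?w = "v ! i + v ! j"
    have vi: "v ! i \<in> carrier_vec n - {0\<^sub>v n}" "v ! j \<in> carrier_vec n - {0\<^sub>v n}"
      using nonzero_frame_nth[OF v] ij by auto
    have "cdet n (v[i := ?w]) = cdet n v"
      using cdet_combination[OF v, of i j i 1 1] ij vi by simp
    then have w: "?w \<in> carrier_vec n - {0\<^sub>v n}"
      using D cdet_update_zero[OF l, of i] ij vi by auto
    from ij l have "j < length v" by simp
    from split_two_entries[OF ij(1) this] obtain as xs bs where
      sp: "v = as @ v ! i # xs @ v ! j # bs" "v[i := ?w] = as @ ?w # xs @ v ! j # bs"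
      "v[j := ?w] = as @ v ! i # xs @ ?w # bs" by metis
    have lv: "length as + length xs + length bs + 2 = n" "set as \<union> set xs \<union> set bs \<subseteq> set v"
      using arg_cong[OF sp(1), of length] arg_cong[OF sp(1), of set] l by auto
    let ?as = "map ?g as" and ?xs = "map ?g xs" and ?bs = "map ?g bs"
    have s: "set ?as \<subseteq> T" "set ?xs \<subseteq> T" "set ?bs \<subseteq> T"
      using lv(2) frame[OF v] unfolding set_map by blast+
    let ?s = "signed (length xs)" and ?x = "ch (v ! i)" and ?y = "ch (v ! j)"
    have chw: "ch ?w = ?x * ?y" using add vi by simp
    \<comment> \<open>Bring the two entries next to each other; the sign depends only on
      \<open>length xs\<close> and is the same for all three terms.\<close>
    have mv: "S (?as @ a # ?xs @ b # ?bs) - ?s (S (?as @ ?xs @ a # b # ?bs)) \<in> N"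
      if "a \<in> T" "b \<in> T" for a b
      using move[of ?as ?xs "b # ?bs" a] lv(1) s that by simp
    have "S ((?as @ ?xs) @ (1 - ?x) # (1 - ?y) # ?bs) - S ((?as @ ?xs) @ (1 - ?x * ?y) # (1 - ?y) # ?bs)
      - S ((?as @ ?xs) @ (1 - ?x) # (1 - ?x * ?y) # ?bs) \<in> N"
    proof (rule S_three_term)
      show "?x * ?y \<noteq> 1" "?x \<noteq> 1" "?y \<noteq> 1"
        using inj[of ?w] inj[of "v ! i"] inj[of "v ! j"] w vi unfolding chw by blast+
      show "?x \<in> Ch" "?y \<in> Ch" using ch vi by blast+
    qed (use s lv(1) in auto)
    then have "?s (S (?as @ ?xs @ ?g (v ! i) # ?g (v ! j) # ?bs) - S (?as @ ?xs @ ?g ?w # ?g (v ! j) # ?bs)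
      - S (?as @ ?xs @ ?g (v ! i) # ?g ?w # ?bs)) \<in> N" by (simp add: chw)
    moreover note mv[OF T[OF vi(1)] T[OF vi(2)]] mv[OF T[OF w] T[OF vi(2)]] mv[OF T[OF vi(1)] T[OF w]]
    ultimately have "?s (S (?as @ ?xs @ ?g (v ! i) # ?g (v ! j) # ?bs) - S (?as @ ?xs @ ?g ?w # ?g (v ! j) # ?bs)
      - S (?as @ ?xs @ ?g (v ! i) # ?g ?w # ?bs))
      + (S (?as @ ?g (v ! i) # ?xs @ ?g (v ! j) # ?bs) - ?s (S (?as @ ?xs @ ?g (v ! i) # ?g (v ! j) # ?bs)))
      - (S (?as @ ?g ?w # ?xs @ ?g (v ! j) # ?bs) - ?s (S (?as @ ?xs @ ?g ?w # ?g (v ! j) # ?bs)))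
      - (S (?as @ ?g (v ! i) # ?xs @ ?g ?w # ?bs) - ?s (S (?as @ ?xs @ ?g (v ! i) # ?g ?w # ?bs))) \<in> N"
      by - (assumption | rule add_mem diff_mem)+
    moreover have "map ?g v = ?as @ ?g (v ! i) # ?xs @ ?g (v ! j) # ?bs"
      using arg_cong[OF sp(1), of "map ?g"] by simp
    ultimately show ?thesis unfolding sp(2,3) by (simp add: signed_diff)
  qed
  show "S (map ?g v) - S (map ?g (v[i := v ! i + v ! j])) - S (map ?g (v[j := v ! i + v ! j])) \<in> N"
    if v: "integral_frame n v" and ij: "i < n" "j < n" "i \<noteq> j" for v i j
  proof (cases "i < j")
    case False
    have "v ! i \<in> carrier_vec n" "v ! j \<in> carrier_vec n"
      using v ij nonzero_frame_nth[of n v] by (auto simp: integral_frame_iff)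
    then have c: "v ! j + v ! i = v ! i + v ! j" by (intro comm_add_vec)
    define w where "w = v ! i + v ! j"
    have "j < i" using False ij(3) by simp
    from three[OF v this ij(1)] have "S (map ?g v) - S (map ?g (v[j := w])) - S (map ?g (v[i := w])) \<in> N"
      by (simp only: c w_def)
    then show ?thesis by (simp add: w_def algebra_simps)
  next
    case True
    show ?thesis by (rule three[OF v True ij(2)])
  qed
qed

end

section \<open>Maps between presented vector spaces\<close>

abbreviation scale :: "rat \<Rightarrow> ('g \<Rightarrow>\<^sub>0 rat) \<Rightarrow> ('g \<Rightarrow>\<^sub>0 rat)" where
  "scale c \<equiv> Poly_Mapping.map ((*) c)"

abbreviation relation_span :: "'g set \<Rightarrow> ('g \<Rightarrow>\<^sub>0 rat) set \<Rightarrow> ('g \<Rightarrow>\<^sub>0 rat) set" where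
  "relation_span G R \<equiv> LinearCombinations.module.span class_ring (free_vs G) R"

lemma lookup_scale [simp]: "Poly_Mapping.lookup (scale c x) g = c * Poly_Mapping.lookup x g"
  by (simp add: map.rep_eq when_def)

lemma scale_simps [simp]: "scale 0 x = 0" "scale c 0 = 0" "scale 1 x = x" "scale (- 1) x = - x"
    "scale c (Poly_Mapping.single g b) = Poly_Mapping.single g (c * b)"
  by (auto intro!: poly_mapping_eqI simp: lookup_single when_def)

lemma keys_scale: "Poly_Mapping.keys (scale c x) \<subseteq> Poly_Mapping.keys x"
  by (auto simp: in_keys_iff)

lemma scale_add: "scale c (x + y) = scale c x + scale c y"
  and scale_left_add: "scale (b + c) x = scale b x + scale c x"
  and scale_scale: "scale b (scale c x) = scale (b * c) x"
  by (auto intro!: poly_mapping_eqI simp: lookup_add algebra_simps)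

lemma scale_sum: "scale c (sum f I) = (\<Sum>i\<in>I. scale c (f i))"
  by (induction I rule: infinite_finite_induct) (auto simp: scale_add)

lemma carrier_free_vs: "x \<in> carrier (free_vs G) \<longleftrightarrow> Poly_Mapping.keys x \<subseteq> G"
  by (simp add: free_vs_def)

lemma free_vs_ops [simp]: "x \<oplus>\<^bsub>free_vs G\<^esub> y = x + y" "\<zero>\<^bsub>free_vs G\<^esub> = 0" "c \<odot>\<^bsub>free_vs G\<^esub> x = scale c x"
  by (simp_all add: free_vs_def)

lemma a_rcoset_free_vs: "N +>\<^bsub>free_vs G\<^esub> x = (\<lambda>h. h + x) ` N"
  by (auto simp: a_r_coset_def r_coset_def)

context
  fixes G :: "'g set" and R :: "('g \<Rightarrow>\<^sub>0 rat) set"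
  assumes R: "R \<subseteq> carrier (free_vs G)"
begin

interpretation V: vectorspace class_ring "free_vs G" by (rule vectorspace_free_vs)

lemma relation_span_submodule: "submodule class_ring (relation_span G R) (free_vs G)"
  by (rule V.span_is_submodule[OF R])

lemma relation_span_closed: "x \<in> relation_span G R \<Longrightarrow> Poly_Mapping.keys x \<subseteq> G"
  using subsetD[OF submodule.subset[OF relation_span_submodule]] by (simp add: carrier_free_vs)

lemma relation_span_scale: "x \<in> relation_span G R \<Longrightarrow> scale c x \<in> relation_span G R"
  using submodule.smult_closed[OF relation_span_submodule, of c x] by (simp add: class_ring_simps)

lemma relation_span_add: "x \<in> relation_span G R \<Longrightarrow> y \<in> relation_span G R \<Longrightarrow> x + y \<in> relation_span G R"
  using submodule.m_closed[OF relation_span_submodule, of x y] by simp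

lemma relation_span_incl: "x \<in> R \<Longrightarrow> x \<in> relation_span G R"
  using V.in_own_span[OF R] by blast

lemma additive_subgroup_relation_span: "additive_subgroup_set (relation_span G R)"
proof
  show "0 \<in> relation_span G R" using submodule.zero_closed[OF relation_span_submodule] by simp
  show "x - y \<in> relation_span G R" if "x \<in> relation_span G R" "y \<in> relation_span G R" for x y
    using relation_span_add[OF that(1) relation_span_scale[OF that(2), of "- 1"]] by simp
qed

lemma relation_span_minimal:
  assumes "0 \<in> U" "\<And>x y. x \<in> U \<Longrightarrow> y \<in> U \<Longrightarrow> x + y \<in> U" "\<And>c x. x \<in> U \<Longrightarrow> scale c x \<in> U"
    "R \<subseteq> U" "U \<subseteq> carrier (free_vs G)"
  shows "relation_span G R \<subseteq> U"
proof (rule V.span_is_subset)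
  show "submodule class_ring U (free_vs G)"
    using assms V.module_axioms by (auto intro!: submodule.intro simp: class_ring_simps)
qed (use assms in auto)

lemma coset_eq_iff:
  "relation_span G R +>\<^bsub>free_vs G\<^esub> x = relation_span G R +>\<^bsub>free_vs G\<^esub> y \<longleftrightarrow> x - y \<in> relation_span G R"
proof -
  interpret additive_subgroup_set "relation_span G R" by (rule additive_subgroup_relation_span)
  show ?thesis unfolding a_rcoset_free_vs
  proof
    assume "(\<lambda>h. h + x) ` relation_span G R = (\<lambda>h. h + y) ` relation_span G R"
    then have "0 + x \<in> (\<lambda>h. h + y) ` relation_span G R" using zero_mem by blast
    then show "x - y \<in> relation_span G R" by auto
  next
    assume xy: "x - y \<in> relation_span G R"
    show "(\<lambda>h. h + x) ` relation_span G R = (\<lambda>h. h + y) ` relation_span G R"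
    proof (intro equalityI image_subsetI)
      fix h assume h: "h \<in> relation_span G R"
      show "h + x \<in> (\<lambda>h. h + y) ` relation_span G R"
        by (rule image_eqI[OF _ add_mem[OF h xy]]) simp
      show "h + y \<in> (\<lambda>h. h + x) ` relation_span G R"
        by (rule image_eqI[OF _ diff_mem[OF h xy]]) simp
    qed
  qed
qed

lemma presented_vs_carrier:
  "carrier (presented_vs G R) = {relation_span G R +>\<^bsub>free_vs G\<^esub> x | x. Poly_Mapping.keys x \<subseteq> G}"
  by (auto simp: presented_vs_def quotient_vs_def A_RCOSETS_def' carrier_free_vs)

lemma presented_vs_smult:
  "Poly_Mapping.keys x \<subseteq> G \<Longrightarrow> c \<odot>\<^bsub>presented_vs G R\<^esub> (relation_span G R +>\<^bsub>free_vs G\<^esub> x)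
    = relation_span G R +>\<^bsub>free_vs G\<^esub> scale c x"
  using vectorspace_quotient_vs(2)[OF V.module_axioms relation_span_submodule, of x c]
  by (simp add: presented_vs_def carrier_free_vs)

lemma presented_vs_add:
  "(relation_span G R +>\<^bsub>free_vs G\<^esub> x) \<oplus>\<^bsub>presented_vs G R\<^esub> (relation_span G R +>\<^bsub>free_vs G\<^esub> y)
    = relation_span G R +>\<^bsub>free_vs G\<^esub> (x + y)"
proof -
  interpret additive_subgroup_set "relation_span G R" by (rule additive_subgroup_relation_span)
  have "\<exists>h\<in>relation_span G R. \<exists>k\<in>relation_span G R. l + (x + y) = (h + x) + (k + y)"
    if "l \<in> relation_span G R" for l
    by (intro bexI[OF _ that] bexI[OF _ zero_mem]) simp
  moreover have "(h + x) + (k + y) = (h + k) + (x + y)" for h k by simp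
  ultimately show ?thesis
    using add_mem unfolding a_rcoset_free_vs presented_vs_def quotient_vs_def
    by (force simp: set_add_def set_mult_def)
qed

end

definition linear_extension :: "('g \<Rightarrow> 'h \<Rightarrow>\<^sub>0 rat) \<Rightarrow> ('g \<Rightarrow>\<^sub>0 rat) \<Rightarrow> ('h \<Rightarrow>\<^sub>0 rat)" where
  "linear_extension \<phi> x = (\<Sum>g\<in>Poly_Mapping.keys x. scale (Poly_Mapping.lookup x g) (\<phi> g))"

lemma linear_extension_superset:
  "finite I \<Longrightarrow> Poly_Mapping.keys x \<subseteq> I \<Longrightarrow>
    linear_extension \<phi> x = (\<Sum>g\<in>I. scale (Poly_Mapping.lookup x g) (\<phi> g))"
  unfolding linear_extension_def by (intro sum.mono_neutral_left) (auto simp: in_keys_iff)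

lemma linear_extension_add: "linear_extension \<phi> (x + y) = linear_extension \<phi> x + linear_extension \<phi> y"
proof -
  let ?I = "Poly_Mapping.keys x \<union> Poly_Mapping.keys y"
  show ?thesis
    using linear_extension_superset[of ?I "x + y" \<phi>] linear_extension_superset[of ?I x \<phi>]
      linear_extension_superset[of ?I y \<phi>] Poly_Mapping.keys_add[of x y]
    by (simp add: lookup_add scale_left_add sum.distrib)
qed

lemma linear_extension_scale: "linear_extension \<phi> (scale c x) = scale c (linear_extension \<phi> x)"
proof -
  have "Poly_Mapping.keys (scale c x) \<subseteq> Poly_Mapping.keys x" by (auto simp: in_keys_iff)
  from linear_extension_superset[OF _ this, of \<phi>] show ?thesis
    by (simp add: linear_extension_def scale_sum scale_scale)
qed

lemma linear_extension_single [simp]: "linear_extension \<phi> (Poly_Mapping.single g c) = scale c (\<phi> g)"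
  using linear_extension_superset[of "{g}" "Poly_Mapping.single g c" \<phi>] by simp

lemma linear_extension_zero [simp]: "linear_extension \<phi> 0 = 0"
  by (simp add: linear_extension_def)

lemma linear_extension_diff: "linear_extension \<phi> (x - y) = linear_extension \<phi> x - linear_extension \<phi> y"
  using linear_extension_add[of \<phi> "x - y" y] by simp

lemma linear_extension_sum: "linear_extension \<phi> (sum f I) = (\<Sum>i\<in>I. linear_extension \<phi> (f i))"
  by (induction I rule: infinite_finite_induct) (auto simp: linear_extension_add)

lemma keys_linear_extension:
  assumes "\<And>g. g \<in> G \<Longrightarrow> Poly_Mapping.keys (\<phi> g) \<subseteq> H" "Poly_Mapping.keys x \<subseteq> G"
  shows "Poly_Mapping.keys (linear_extension \<phi> x) \<subseteq> H"
proof -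
  have "Poly_Mapping.keys (scale (Poly_Mapping.lookup x g) (\<phi> g)) \<subseteq> H" if "g \<in> Poly_Mapping.keys x" for g
    using assms that by (fastforce simp: in_keys_iff)
  then show ?thesis unfolding linear_extension_def
    using keys_sum[of "\<lambda>g. scale (Poly_Mapping.lookup x g) (\<phi> g)" "Poly_Mapping.keys x"] by blast
qed

text \<open>Universal property of a presentation. \<open>\<phi>\<close> takes values in the free
  space of the target, so that relations are tested there and not among cosets.\<close>

lemma presented_vs_map_exists:
  assumes R: "R \<subseteq> carrier (free_vs G)" and R': "R' \<subseteq> carrier (free_vs H)"
    and \<phi>: "\<And>g. g \<in> G \<Longrightarrow> Poly_Mapping.keys (\<phi> g) \<subseteq> H"
    and rel: "\<And>r. r \<in> R \<Longrightarrow> linear_extension \<phi> r \<in> relation_span H R'"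
  obtains K where "K \<in> extensional (carrier (presented_vs G R))"
    "linear_map class_ring (presented_vs G R) (presented_vs H R') K"
    "\<And>g. g \<in> G \<Longrightarrow> K (presented_gen G R g) = relation_span H R' +>\<^bsub>free_vs H\<^esub> \<phi> g"
proof -
  let ?c = "\<lambda>x. relation_span G R +>\<^bsub>free_vs G\<^esub> x" and ?c' = "\<lambda>y. relation_span H R' +>\<^bsub>free_vs H\<^esub> y"
  let ?L = "linear_extension \<phi>"
  interpret N': additive_subgroup_set "relation_span H R'" by (rule additive_subgroup_relation_span[OF R'])
  \<comment> \<open>The combinations of generators that map to relations form a subspace, so it is
    enough that this subspace contains \<open>R\<close>.\<close>
  have "relation_span G R \<subseteq> {x. Poly_Mapping.keys x \<subseteq> G \<and> ?L x \<in> relation_span H R'}" (is "_ \<subseteq> ?U")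
  proof (rule relation_span_minimal[OF R])
    show "x + y \<in> ?U" if "x \<in> ?U" "y \<in> ?U" for x y
      using that Poly_Mapping.keys_add[of x y] by (auto simp: linear_extension_add N'.add_mem)
    show "scale c x \<in> ?U" if "x \<in> ?U" for c x
      using that keys_scale[of c x] by (auto simp: linear_extension_scale relation_span_scale[OF R'])
    show "R \<subseteq> ?U" using subsetD[OF R] rel unfolding carrier_free_vs by blast
  qed (auto simp: carrier_free_vs N'.zero_mem)
  then have wd: "?L x - ?L y \<in> relation_span H R'" if "x - y \<in> relation_span G R" for x y
    using that by (auto simp: linear_extension_diff)
  define K where "K = restrict (\<lambda>C. ?c' (?L (SOME x. Poly_Mapping.keys x \<subseteq> G \<and> C = ?c x))) (carrier (presented_vs G R))"
  have K: "K (?c x) = ?c' (?L x)" if x: "Poly_Mapping.keys x \<subseteq> G" for x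
  proof -
    define y where "y = (SOME y. Poly_Mapping.keys y \<subseteq> G \<and> ?c x = ?c y)"
    have "Poly_Mapping.keys y \<subseteq> G \<and> ?c x = ?c y"
      unfolding y_def by (rule someI[of _ x]) (use x in simp)
    then have "x - y \<in> relation_span G R" using coset_eq_iff[OF R] by blast
    then have "?c' (?L x) = ?c' (?L y)" using wd coset_eq_iff[OF R'] by blast
    moreover have "?c x \<in> carrier (presented_vs G R)" using x by (auto simp: presented_vs_carrier[OF R])
    ultimately show ?thesis by (simp add: K_def y_def)
  qed
  have add: "Poly_Mapping.keys (x + y) \<subseteq> G" if "Poly_Mapping.keys x \<subseteq> G" "Poly_Mapping.keys y \<subseteq> G" for x y :: "'a \<Rightarrow>\<^sub>0 rat"
    using that Poly_Mapping.keys_add[of x y] by blast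
  have sc: "Poly_Mapping.keys (scale c x) \<subseteq> G" if "Poly_Mapping.keys x \<subseteq> G" for c and x :: "'a \<Rightarrow>\<^sub>0 rat"
    using that by (auto simp: in_keys_iff)
  have kL: "Poly_Mapping.keys (?L x) \<subseteq> H" if "Poly_Mapping.keys x \<subseteq> G" for x
    by (rule keys_linear_extension[of G]) (fact \<phi>, fact that)
  then have cl: "?c' (?L x) \<in> carrier (presented_vs H R')" if "Poly_Mapping.keys x \<subseteq> G" for x
    using that by (auto simp: presented_vs_carrier[OF R'])
  show thesis
  proof
    show "K \<in> extensional (carrier (presented_vs G R))" by (simp add: K_def)
    show "K (presented_gen G R g) = ?c' (\<phi> g)" if "g \<in> G" for g
      using K[of "basis_elt g"] that by (simp add: presented_gen_def)
    have "K \<in> LinearCombinations.module_hom class_ring (presented_vs G R) (presented_vs H R')"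
      unfolding LinearCombinations.module_hom_def
      by (auto simp: presented_vs_carrier[OF R] K kL presented_vs_add[OF R] presented_vs_add[OF R']
          presented_vs_smult[OF R] presented_vs_smult[OF R'] add sc linear_extension_add
          linear_extension_scale class_ring_simps cl)
    then show "linear_map class_ring (presented_vs G R) (presented_vs H R') K"
      using vectorspace_presented_vs[OF R] vectorspace_presented_vs[OF R']
      by (simp add: linear_map_def mod_hom_def mod_hom_axioms_def vectorspace_def)
  qed
qed

text \<open>The equalizer of two maps is pulled back to the free space. There the reduction to
  integral apartments can be run on basis elements modulo a subgroup, as in the existence
  half.\<close>

lemma presented_vs_map_unique:
  fixes E :: "('g \<Rightarrow>\<^sub>0 rat) set"
  assumes R: "R \<subseteq> carrier (free_vs G)"
    and K: "linear_map class_ring (presented_vs G R) W K" "linear_map class_ring (presented_vs G R) W K'"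
    and ext: "K \<in> extensional (carrier (presented_vs G R))" "K' \<in> extensional (carrier (presented_vs G R))"
  defines "E \<equiv> {x. Poly_Mapping.keys x \<subseteq> G \<and>
      K (relation_span G R +>\<^bsub>free_vs G\<^esub> x) = K' (relation_span G R +>\<^bsub>free_vs G\<^esub> x)}"
  shows "additive_subgroup_set E" "relation_span G R \<subseteq> E" "scale c x \<in> E \<Longrightarrow> c \<noteq> 0 \<Longrightarrow> x \<in> E"
    "(\<And>g. g \<in> G \<Longrightarrow> basis_elt g \<in> E) \<Longrightarrow> K = K'"
proof -
  let ?c = "\<lambda>x. relation_span G R +>\<^bsub>free_vs G\<^esub> x"
  interpret K: linear_map class_ring "presented_vs G R" W K by fact
  interpret K': linear_map class_ring "presented_vs G R" W K' by fact
  interpret N: additive_subgroup_set "relation_span G R" by (rule additive_subgroup_relation_span[OF R])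
  have cl: "?c x \<in> carrier (presented_vs G R)" if "Poly_Mapping.keys x \<subseteq> G" for x
    using that by (auto simp: presented_vs_carrier[OF R])
  have sc: "scale c x \<in> E" if "x \<in> E" for c x
  proof -
    have x: "Poly_Mapping.keys x \<subseteq> G" "K (?c x) = K' (?c x)" using that by (auto simp: E_def)
    have "K (c \<odot>\<^bsub>presented_vs G R\<^esub> ?c x) = K' (c \<odot>\<^bsub>presented_vs G R\<^esub> ?c x)"
      using cl x by (simp add: class_ring_simps K.f_smult K'.f_smult)
    then show ?thesis using x by (auto simp: E_def presented_vs_smult[OF R] in_keys_iff)
  qed
  have ad: "x + y \<in> E" if "x \<in> E" "y \<in> E" for x y
  proof -
    have xy: "Poly_Mapping.keys x \<subseteq> G" "Poly_Mapping.keys y \<subseteq> G" "K (?c x) = K' (?c x)" "K (?c y) = K' (?c y)"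
      using that by (auto simp: E_def)
    have "K (?c x \<oplus>\<^bsub>presented_vs G R\<^esub> ?c y) = K' (?c x \<oplus>\<^bsub>presented_vs G R\<^esub> ?c y)"
      using cl xy by (simp add: K.f_add K'.f_add)
    then show ?thesis using xy Poly_Mapping.keys_add[of x y] by (auto simp: E_def presented_vs_add[OF R])
  qed
  have z: "\<zero>\<^bsub>presented_vs G R\<^esub> = ?c 0"
    by (simp add: presented_vs_def quotient_vs_def a_rcoset_free_vs)
  have "K (?c 0) = K' (?c 0)"
    using K.f0_is_0 K'.f0_is_0 unfolding z by simp
  then have rs: "x \<in> E" if "x \<in> relation_span G R" for x
    using that coset_eq_iff[OF R, of x 0] relation_span_closed[OF R that] by (simp add: E_def)
  then show "relation_span G R \<subseteq> E" by blast
  show E: "additive_subgroup_set E"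
  proof
    show "x - y \<in> E" if "x \<in> E" "y \<in> E" for x y
      using ad[OF that(1) sc[OF that(2), of "- 1"]] by simp
  qed (rule rs[OF N.zero_mem])
  show "x \<in> E" if "scale c x \<in> E" "c \<noteq> 0"
    using sc[OF that(1), of "inverse c"] that(2) by (simp add: scale_scale)
  show "K = K'" if b: "\<And>g. g \<in> G \<Longrightarrow> basis_elt g \<in> E"
  proof (rule extensionalityI[OF ext])
    fix C assume "C \<in> carrier (presented_vs G R)"
    then obtain x where x: "C = ?c x" "Poly_Mapping.keys x \<subseteq> G" by (auto simp: presented_vs_carrier[OF R])
    have "(\<Sum>g\<in>Poly_Mapping.keys x. scale (Poly_Mapping.lookup x g) (basis_elt g)) \<in> E"
      using b x(2) by (intro additive_subgroup_set.sum_mem[OF E] sc) blast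
    also have "(\<Sum>g\<in>Poly_Mapping.keys x. scale (Poly_Mapping.lookup x g) (basis_elt g)) = x"
      by (intro poly_mapping_eqI) (simp add: lookup_sum lookup_single when_def in_keys_iff)
    finally show "K C = K' C" using x(1) by (simp add: E_def)
  qed
qed

section \<open>Milnor symbols\<close>

lemma (in ideal) rcoset_of_mem: "x \<in> I \<Longrightarrow> I +> x = I"
  by (simp add: a_coset_join2 additive_subgroup.a_subgroup additive_subgroup_axioms a_Hcarr)

lemma (in ideal) rcoset_of_diff_mem:
  assumes "x \<in> carrier R" "y \<in> carrier R" "x \<ominus> y \<in> I"
  shows "I +> x = I +> y"
  using assms(3) quotient_eq_iff_same_a_r_cos[OF ideal_axioms assms(1,2)] by blast

context
  fixes F :: "('a, 'm) ring_scheme" (structure)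
  assumes F: "ring F"
begin

interpretation F: ring F by (rule F)

interpretation U: Group.monoid "units_of F"
  by (simp add: F.units_group group.is_monoid)

interpretation T: ideal "tensor_ideal (units_of F)" "free_ring (carrier (units_of F))"
  by (rule ideal_tensor_ideal) (rule U.monoid_axioms)

interpretation S: ideal "steinberg_ideal F" "tensor_algebra (units_of F)"
  by (rule ideal_steinberg_ideal[OF F])

interpretation M: ring "milnor_ring F" by (rule ring_milnor_ring[OF F])

lemma word_closed: "set as \<subseteq> Units F \<Longrightarrow> word as \<in> carrier (free_ring (carrier (units_of F)))"
  by (auto simp: free_ring_def units_of_carrier)

lemma tensor_units_closed: "set as \<subseteq> Units F \<Longrightarrow> tensor (units_of F) as \<in> carrier (tensor_algebra (units_of F))"
  by (rule tensor_closed) (simp add: units_of_carrier)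

lemma milnor_symbol_closed: "set as \<subseteq> Units F \<Longrightarrow> milnor_symbol F as \<in> carrier (milnor_ring F)"
  using ring_hom_closed[OF S.rcos_ring_hom tensor_units_closed]
  by (simp add: milnor_symbol_def milnor_ring_def)

text \<open>Concatenation of words is the product of the free ring, and both quotient maps, to the
  tensor algebra and to the Milnor ring, are ring homomorphisms.\<close>

lemma milnor_symbol_append:
  assumes "set as \<subseteq> Units F" "set bs \<subseteq> Units F"
  shows "milnor_symbol F (as @ bs) = milnor_symbol F as \<otimes>\<^bsub>milnor_ring F\<^esub> milnor_symbol F bs"
proof -
  have "word as \<otimes>\<^bsub>free_ring (carrier (units_of F))\<^esub> word bs = word (as @ bs)"
    by (simp add: free_ring_def mult_single plus_free_monoid_def)
  then have "tensor (units_of F) (as @ bs)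
      = tensor (units_of F) as \<otimes>\<^bsub>tensor_algebra (units_of F)\<^esub> tensor (units_of F) bs"
    using ring_hom_mult[OF T.rcos_ring_hom word_closed[OF assms(1)] word_closed[OF assms(2)]]
    by (simp add: tensor_def tensor_algebra_def)
  then show ?thesis
    using ring_hom_mult[OF S.rcos_ring_hom tensor_units_closed[OF assms(1)] tensor_units_closed[OF assms(2)]]
    by (simp add: milnor_symbol_def milnor_ring_def)
qed

lemma milnor_symbol_add:
  assumes ab: "a \<in> Units F" "b \<in> Units F"
  shows "milnor_symbol F [a \<otimes> b] = milnor_symbol F [a] \<oplus>\<^bsub>milnor_ring F\<^esub> milnor_symbol F [b]"
proof -
  let ?W = "free_ring (carrier (units_of F))"
  have cl: "word [a \<otimes> b] \<in> carrier ?W" "word [a] \<in> carrier ?W" "word [b] \<in> carrier ?W"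
    using ab by (auto intro!: word_closed)
  \<comment> \<open>The generators of \<open>tensor_ideal\<close> use the subtraction of the
    underlying type, coset equality uses that of the ring record; the two agree on the
    carrier.\<close>
  have neg: "\<ominus>\<^bsub>?W\<^esub> x = - x" if "x \<in> carrier ?W" for x
    using that by (intro T.minus_equality) (auto simp: free_ring_def)
  have "word [a \<otimes>\<^bsub>units_of F\<^esub> b] - word [a] - word [b] \<in> tensor_ideal (units_of F)"
    unfolding tensor_ideal_def
  proof (rule subsetD[OF T.genideal_self])
    show "{word [a \<otimes>\<^bsub>units_of F\<^esub> b] - word [a] - word [b] | a b.
        a \<in> carrier (units_of F) \<and> b \<in> carrier (units_of F)} \<subseteq> carrier ?W"
    proof safe
      fix x y assume "x \<in> carrier (units_of F)" "y \<in> carrier (units_of F)"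
      then have "x \<in> Units F" "y \<in> Units F" by (simp_all add: units_of_carrier)
      then have "word [x \<otimes> y] \<in> carrier ?W" "word [x] \<in> carrier ?W" "word [y] \<in> carrier ?W"
        by (auto intro!: word_closed)
      from T.minus_closed[OF T.minus_closed[OF this(1,2)] this(3)] this
      show "word [x \<otimes>\<^bsub>units_of F\<^esub> y] - word [x] - word [y] \<in> carrier ?W"
        by (simp add: a_minus_def neg units_of_mult) (simp add: free_ring_def)
    qed
  qed (use ab in \<open>auto simp: units_of_carrier\<close>)
  then have "word [a \<otimes> b] \<ominus>\<^bsub>?W\<^esub> (word [a] \<oplus>\<^bsub>?W\<^esub> word [b]) \<in> tensor_ideal (units_of F)"
    using cl by (simp add: a_minus_def neg units_of_mult) (simp add: free_ring_def algebra_simps)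
  then have "tensor (units_of F) [a \<otimes> b]
      = tensor_ideal (units_of F) +>\<^bsub>?W\<^esub> (word [a] \<oplus>\<^bsub>?W\<^esub> word [b])"
    using cl by (simp add: T.rcoset_of_diff_mem tensor_def)
  also have "\<dots> = tensor (units_of F) [a] \<oplus>\<^bsub>tensor_algebra (units_of F)\<^esub> tensor (units_of F) [b]"
    using ring_hom_add[OF T.rcos_ring_hom cl(2,3)] by (simp add: tensor_def tensor_algebra_def)
  finally show ?thesis
    using ring_hom_add[OF S.rcos_ring_hom tensor_units_closed tensor_units_closed, of "[a]" "[b]"] ab
    by (simp add: milnor_symbol_def milnor_ring_def)
qed

lemma milnor_symbol_steinberg:
  assumes "a \<in> Units F" "\<one> \<ominus> a \<in> Units F"
  shows "milnor_symbol F [a, \<one> \<ominus> a] = \<zero>\<^bsub>milnor_ring F\<^esub>"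
proof -
  have "tensor (units_of F) [a, \<one> \<ominus> a] \<in> steinberg_ideal F"
    unfolding steinberg_ideal_def
    by (rule subsetD[OF S.genideal_self]) (use assms in \<open>auto intro!: tensor_units_closed\<close>)
  then show ?thesis
    by (simp add: milnor_symbol_def milnor_ring_def S.rcoset_of_mem FactRing_def)
qed

lemma milnor_symbol_mult_entry:
  assumes "set as \<subseteq> Units F" "set bs \<subseteq> Units F" "a \<in> Units F" "b \<in> Units F"
  shows "milnor_symbol F (as @ (a \<otimes> b) # bs)
    = milnor_symbol F (as @ a # bs) \<oplus>\<^bsub>milnor_ring F\<^esub> milnor_symbol F (as @ b # bs)"
proof -
  have "milnor_symbol F (as @ x # bs) = milnor_symbol F as \<otimes>\<^bsub>milnor_ring F\<^esub>
      (milnor_symbol F [x] \<otimes>\<^bsub>milnor_ring F\<^esub> milnor_symbol F bs)" if "x \<in> Units F" for x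
    using milnor_symbol_append[of as "x # bs"] milnor_symbol_append[of "[x]" bs] assms that by simp
  then show ?thesis
    using assms milnor_symbol_closed by (simp add: milnor_symbol_add M.l_distr M.r_distr)
qed

lemma milnor_symbol_steinberg_entry:
  assumes "set as \<subseteq> Units F" "set bs \<subseteq> Units F" "a \<in> Units F" "\<one> \<ominus> a \<in> Units F"
  shows "milnor_symbol F (as @ a # (\<one> \<ominus> a) # bs) = \<zero>\<^bsub>milnor_ring F\<^esub>"
  using milnor_symbol_append[of as "a # (\<one> \<ominus> a) # bs"] milnor_symbol_append[of "[a, \<one> \<ominus> a]" bs] assms
  by (simp add: milnor_symbol_steinberg milnor_symbol_closed)

definition milnor_generators :: "nat \<Rightarrow> ('a free_monoid \<Rightarrow>\<^sub>0 int) set set set" where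
  "milnor_generators n = {milnor_symbol F as | as. length as = n \<and> set as \<subseteq> Units F}"

lemma milnor_generators_subset: "milnor_generators n \<subseteq> carrier (milnor_ring F)"
  using milnor_symbol_closed by (auto simp: milnor_generators_def)

lemma milnor_K_eq: "milnor_K F n = (add_monoid (milnor_ring F))
    \<lparr>carrier := generate (add_monoid (milnor_ring F)) (milnor_generators n)\<rparr>"
  by (simp add: milnor_K_def milnor_generators_def)

lemma comm_group_milnor_K: "comm_group (milnor_K F n)"
proof -
  have "subgroup (generate (add_monoid (milnor_ring F)) (milnor_generators n)) (add_monoid (milnor_ring F))"
    by (rule M.add.generate_is_subgroup[OF milnor_generators_subset])
  then have "group (milnor_K F n)"
    unfolding milnor_K_eq by (rule subgroup.subgroup_is_group) (rule M.a_group)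
  then show ?thesis
    by (rule group.group_comm_groupI)
      (simp add: milnor_K_eq M.a_comm M.add.generate_in_carrier[OF milnor_generators_subset])
qed

lemma milnor_symbol_in_K: "length as = n \<Longrightarrow> set as \<subseteq> Units F \<Longrightarrow> milnor_symbol F as \<in> carrier (milnor_K F n)"
  by (auto simp: milnor_K_eq milnor_generators_def intro: generate.incl)

lemma milnor_K_mult_symbol:
  assumes "y \<in> carrier (milnor_K F m)" and x: "x \<in> Units F"
  shows "y \<otimes>\<^bsub>milnor_ring F\<^esub> milnor_symbol F [x] \<in> carrier (milnor_K F (Suc m))"
proof -
  interpret K: comm_group "milnor_K F (Suc m)" by (rule comm_group_milnor_K)
  have sx: "milnor_symbol F [x] \<in> carrier (milnor_ring F)" using x milnor_symbol_closed by simp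
  have gen: "h \<otimes>\<^bsub>milnor_ring F\<^esub> milnor_symbol F [x] \<in> milnor_generators (Suc m)"
    if h: "h \<in> milnor_generators m" for h
  proof -
    obtain as where "h = milnor_symbol F as" "length as = m" "set as \<subseteq> Units F"
      using h by (auto simp: milnor_generators_def)
    then show ?thesis using milnor_symbol_append[of as "[x]"] x
      by (auto simp: milnor_generators_def intro!: exI[of _ "as @ [x]"])
  qed
  have "y \<in> generate (add_monoid (milnor_ring F)) (milnor_generators m)"
    using assms(1) by (simp add: milnor_K_eq)
  then have "y \<otimes>\<^bsub>milnor_ring F\<^esub> milnor_symbol F [x]
      \<in> generate (add_monoid (milnor_ring F)) (milnor_generators (Suc m))"
  proof induction
    case one
    then show ?case using sx generate.one[of "add_monoid (milnor_ring F)"] by simp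
  next
    case (incl h)
    then show ?case by (intro generate.incl gen)
  next
    case (inv h)
    then have "\<ominus>\<^bsub>milnor_ring F\<^esub> (h \<otimes>\<^bsub>milnor_ring F\<^esub> milnor_symbol F [x])
        \<in> generate (add_monoid (milnor_ring F)) (milnor_generators (Suc m))"
      unfolding a_inv_def by (intro generate.inv gen)
    moreover have "h \<in> carrier (milnor_ring F)" using milnor_generators_subset inv by blast
    ultimately have "(\<ominus>\<^bsub>milnor_ring F\<^esub> h) \<otimes>\<^bsub>milnor_ring F\<^esub> milnor_symbol F [x]
        \<in> generate (add_monoid (milnor_ring F)) (milnor_generators (Suc m))"
      using sx by (simp only: M.l_minus)
    then show ?case by (simp only: a_inv_def)
  next
    case (eng g h)
    then show ?case
      using generate.eng[OF eng.IH] sx M.add.generate_in_carrier[OF milnor_generators_subset]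
      by (simp add: M.l_distr)
  qed
  then show ?thesis by (simp add: milnor_K_eq)
qed

lemma milnor_product_image_subgroup:
  assumes "S \<subseteq> Units F"
  shows "subgroup (milnor_product_image F S n) (milnor_K F n)"
proof -
  interpret K: comm_group "milnor_K F n" by (rule comm_group_milnor_K)
  show ?thesis unfolding milnor_product_image_def
    by (rule K.generate_is_subgroup) (use milnor_K_mult_symbol assms in auto)
qed

text \<open>The symbol is the product of a symbol of degree one less with that of
  \<open>\<chi>\<close>, hence one of the generators of the image; this is why it dies in the
  cokernel.\<close>

lemma milnor_symbol_char_in_product_image:
  assumes "set as \<subseteq> Units F" "\<chi> \<in> S" "S \<subseteq> Units F"
  shows "milnor_symbol F (as @ [\<chi>]) \<in> milnor_product_image F S (Suc (length as))"
  unfolding milnor_product_image_def using assms milnor_symbol_append[of as "[\<chi>]"] milnor_symbol_in_K[of as]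
  by (auto intro!: generate.incl)

end

section \<open>Symbols on the torus\<close>

lemma torus_field_ops [simp]: "x \<otimes>\<^bsub>torus_field d\<^esub> y = x * y" "\<one>\<^bsub>torus_field d\<^esub> = 1"
    "\<zero>\<^bsub>torus_field d\<^esub> = 0" "x \<oplus>\<^bsub>torus_field d\<^esub> y = x + y"
  by (simp_all add: torus_field_def)

lemma torus_field_units: "x \<in> Units (torus_field d) \<longleftrightarrow> x \<in> carrier (torus_field d) \<and> x \<noteq> 0"
proof -
  interpret field "torus_field d" by (rule field_torus_field)
  show ?thesis by (simp add: field_Units)
qed

lemma torus_field_minus: "x \<in> carrier (torus_field d) \<Longrightarrow> y \<in> carrier (torus_field d) \<Longrightarrow> x \<ominus>\<^bsub>torus_field d\<^esub> y = x - y"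
proof -
  assume xy: "x \<in> carrier (torus_field d)" "y \<in> carrier (torus_field d)"
  interpret field "torus_field d" by (rule field_torus_field)
  have "\<ominus>\<^bsub>torus_field d\<^esub> y + y = 0" using l_neg[OF xy(2)] by simp
  then show ?thesis by (simp add: a_minus_def eq_neg_iff_add_eq_0)
qed

lemma torus_units_closed:
  "1 \<in> Units (torus_field d)" "- 1 \<in> Units (torus_field d)"
  "a \<in> Units (torus_field d) \<Longrightarrow> b \<in> Units (torus_field d) \<Longrightarrow> a * b \<in> Units (torus_field d)"
  "a \<in> Units (torus_field d) \<Longrightarrow> inverse a \<in> Units (torus_field d)"
  "a \<in> Units (torus_field d) \<Longrightarrow> a \<noteq> 1 \<Longrightarrow> 1 - a \<in> Units (torus_field d)"
proof -
  interpret field "torus_field d" by (rule field_torus_field)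
  show 1: "1 \<in> Units (torus_field d)" using Units_one_closed by simp
  show "- 1 \<in> Units (torus_field d)"
    using minus_closed[of "\<zero>\<^bsub>torus_field d\<^esub>" "\<one>\<^bsub>torus_field d\<^esub>"] torus_field_minus[of 0 d 1] zero_closed one_closed
    by (simp add: torus_field_units)
  show "a * b \<in> Units (torus_field d)" if "a \<in> Units (torus_field d)" "b \<in> Units (torus_field d)"
    using Units_m_closed[OF that] by simp
  show "inverse a \<in> Units (torus_field d)" if a: "a \<in> Units (torus_field d)"
    using Units_inv_Units[OF a] Units_r_inv[OF a] inverse_unique[of a] by simp
  show "1 - a \<in> Units (torus_field d)" if "a \<in> Units (torus_field d)" "a \<noteq> 1"
    using that minus_closed[of "\<one>\<^bsub>torus_field d\<^esub>" a] torus_field_minus[of 1 d a] one_closed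
    by (simp add: torus_field_units)
qed

lemma torus_coord_powi: "torus_coord i powi k = Fract (Poly_Mapping.single (Poly_Mapping.single i k) 1) 1"
proof -
  let ?m = "\<lambda>k :: int. Fract (Poly_Mapping.single (Poly_Mapping.single i k) (1 :: Qbar)) 1"
  have mult: "?m a * ?m b = ?m (a + b)" for a b
    by (simp add: mult_single single_add)
  have one: "?m 0 = 1" by (simp add: One_fract_def single_one)
  have nat: "torus_coord i ^ n = ?m (int n)" for n
  proof (induction n)
    case (Suc n)
    then show ?case using mult[of 1 "int n"] by (simp add: torus_coord_def)
  qed (simp add: One_fract_def)
  have inv: "inverse (?m a) = ?m (- a)" for a
    by (rule inverse_unique) (simp only: mult right_minus one)
  show ?thesis
  proof (cases "k \<ge> 0")
    case False
    then have "torus_coord i powi k = inverse (?m (- k))"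
      by (simp only: power_int_def nat power_inverse if_False) simp
    then show ?thesis by (simp only: inv minus_minus)
  qed (simp add: power_int_def nat)
qed

lemma torus_char_eq:
  "torus_char v = Fract (Poly_Mapping.single (\<Sum>i<dim_vec v. Poly_Mapping.single i (v $ i)) 1) 1"
proof -
  have "(\<Prod>i<n. torus_coord i powi (v $ i))
    = Fract (Poly_Mapping.single (\<Sum>i<n. Poly_Mapping.single i (v $ i)) 1) 1" for n
  proof (induction n)
    case (Suc n)
    then show ?case by (simp add: torus_coord_powi mult_single add.commute)
  qed (simp add: One_fract_def single_one)
  then show ?thesis by (simp add: torus_char_def)
qed

lemma torus_coord_nonzero: "torus_coord i \<noteq> 0"
  by (simp add: torus_coord_def Zero_fract_def eq_fract) (metis lookup_single_eq lookup_zero one_neq_zero)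

lemma torus_char_add:
  "v \<in> carrier_vec d \<Longrightarrow> w \<in> carrier_vec d \<Longrightarrow> torus_char (v + w) = torus_char v * torus_char w"
  by (simp add: torus_char_def power_int_add torus_coord_nonzero prod.distrib)

lemma torus_char_uminus: "torus_char (- v) = inverse (torus_char v)"
  by (simp add: torus_char_def power_int_minus prod_inversef[unfolded o_def])

lemma torus_char_eq_one:
  assumes "v \<in> carrier_vec d" "torus_char v = 1"
  shows "v = 0\<^sub>v d"
proof (rule eq_vecI)
  let ?m = "\<Sum>i<dim_vec v. Poly_Mapping.single i (v $ i)"
  have "Poly_Mapping.single ?m (1 :: Qbar) = Poly_Mapping.single 0 1"
    using assms(2) by (simp add: torus_char_eq One_fract_def eq_fract single_one)
  then have "?m = 0" by (metis lookup_single_eq lookup_single_not_eq one_neq_zero)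
  moreover have "Poly_Mapping.lookup ?m k = v $ k" if "k < dim_vec v" for k
    using that by (simp add: lookup_sum lookup_single when_def)
  ultimately show "v $ k = 0\<^sub>v d $ k" if "k < dim_vec (0\<^sub>v d)" for k
    using that assms(1) by (metis carrier_vecD index_zero_vec(1) index_zero_vec(2) lookup_zero)
qed (use assms in simp)

abbreviation torus_relations :: "nat \<Rightarrow> ((laurent fract free_monoid \<Rightarrow>\<^sub>0 int) set set set \<Rightarrow>\<^sub>0 rat) set" where
  "torus_relations d \<equiv> relation_span (carrier (torus_K_coker d d)) (tensor_rat_rels (torus_K_coker d d))"

text \<open>The class in the cokernel, before scalars are extended. The degree is \<open>d\<close>
  and not \<open>length as\<close>, so that all values lie in one fixed group.\<close>

definition torus_symbol_gen :: "nat \<Rightarrow> laurent fract list \<Rightarrow> (laurent fract free_monoid \<Rightarrow>\<^sub>0 int) set set set" where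
  "torus_symbol_gen d as = milnor_product_image (torus_field d) (torus_char ` carrier_vec d) d
     #>\<^bsub>milnor_K (torus_field d) d\<^esub> milnor_symbol (torus_field d) as"

lemma torus_symbol_eq:
  "length as = d \<Longrightarrow> torus_symbol d as
    = torus_relations d +>\<^bsub>free_vs (carrier (torus_K_coker d d))\<^esub> basis_elt (torus_symbol_gen d as)"
  by (simp add: torus_symbol_def tensor_rat_one_def presented_gen_def torus_symbol_gen_def)

lemma tensor_rat_rels_subset:
  assumes "Group.monoid A"
  shows "tensor_rat_rels A \<subseteq> carrier (free_vs (carrier A))"
  unfolding tensor_rat_rels_def free_vs_def
  using Group.monoid.m_closed[OF assms]
  by (clarsimp, drule_tac subsetD[OF keys_diff], auto dest!: subsetD[OF keys_diff] split: if_splits)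

context
  fixes d :: nat
begin

interpretation F: field "torus_field d" by (rule field_torus_field)

private abbreviation "S \<equiv> torus_char ` carrier_vec d"
private abbreviation "P \<equiv> milnor_product_image (torus_field d) S d"
private abbreviation "Kd \<equiv> milnor_K (torus_field d) d"

interpretation K: comm_group Kd by (rule comm_group_milnor_K[OF F.ring_axioms])

lemma torus_chars_units: "S \<subseteq> Units (torus_field d)" using torus_char_unit by auto

interpretation P: normal P Kd
  by (rule K.subgroup_imp_normal[OF milnor_product_image_subgroup[OF F.ring_axioms torus_chars_units]])

lemma comm_group_torus_K_coker: "comm_group (torus_K_coker d d)"
  unfolding torus_K_coker_def by (rule comm_group_milnor_coker[OF F.ring_axioms torus_chars_units])

interpretation A: comm_group "torus_K_coker d d" by (rule comm_group_torus_K_coker)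

lemma torus_rels_subset: "tensor_rat_rels (torus_K_coker d d) \<subseteq> carrier (free_vs (carrier (torus_K_coker d d)))"
  by (rule tensor_rat_rels_subset) (rule A.monoid_axioms)

lemma torus_symbol_gen_closed:
  "length as = d \<Longrightarrow> set as \<subseteq> Units (torus_field d) \<Longrightarrow> torus_symbol_gen d as \<in> carrier (torus_K_coker d d)"
  using milnor_symbol_in_K[OF F.ring_axioms, of as d]
  by (auto simp: torus_symbol_gen_def torus_K_coker_def milnor_coker_def FactGroup_def RCOSETS_def)

lemma torus_symbol_gen_mult:
  assumes "length as = d" "set as \<subseteq> Units (torus_field d)" "length bs = d" "set bs \<subseteq> Units (torus_field d)"
    "milnor_symbol (torus_field d) cs = milnor_symbol (torus_field d) as \<oplus>\<^bsub>milnor_ring (torus_field d)\<^esub> milnor_symbol (torus_field d) bs"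
  shows "torus_symbol_gen d cs = torus_symbol_gen d as \<otimes>\<^bsub>torus_K_coker d d\<^esub> torus_symbol_gen d bs"
  using P.rcos_sum[OF milnor_symbol_in_K[OF F.ring_axioms assms(1,2)] milnor_symbol_in_K[OF F.ring_axioms assms(3,4)]]
  by (simp add: torus_symbol_gen_def torus_K_coker_def milnor_coker_def FactGroup_def assms(5))
    (simp add: milnor_K_eq[OF F.ring_axioms])

interpretation N: additive_subgroup_set "torus_relations d"
  by (rule additive_subgroup_relation_span[OF torus_rels_subset])

text \<open>For the generator e of the neutral element, 1 * 1 = 1 gives the relation e - e - e =
  -e.\<close>

lemma basis_one_in_torus_relations: "basis_elt \<one>\<^bsub>torus_K_coker d d\<^esub> \<in> torus_relations d"
proof -
  let ?one = "\<one>\<^bsub>torus_K_coker d d\<^esub>"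
  have "basis_elt (?one \<otimes>\<^bsub>torus_K_coker d d\<^esub> ?one) - basis_elt ?one - basis_elt ?one \<in> torus_relations d"
    by (rule relation_span_incl[OF torus_rels_subset])
      (use A.one_closed in \<open>unfold tensor_rat_rels_def, blast\<close>)
  from N.minus_mem[OF this] show ?thesis by simp
qed

lemma torus_symbol_gen_trivial:
  assumes "milnor_symbol (torus_field d) as \<in> P"
  shows "basis_elt (torus_symbol_gen d as) \<in> torus_relations d"
proof -
  have "torus_symbol_gen d as = P"
    unfolding torus_symbol_gen_def
    by (rule K.coset_join2[OF _ P.subgroup_axioms assms]) (use assms P.subset in auto)
  also have "P = \<one>\<^bsub>torus_K_coker d d\<^esub>"
    by (simp add: torus_K_coker_def milnor_coker_def FactGroup_def)
  finally show ?thesis using basis_one_in_torus_relations by simp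
qed

lemma milnor_symbols_torus:
  "milnor_symbols (torus_relations d) d (Units (torus_field d)) S (\<lambda>as. basis_elt (torus_symbol_gen d as))"
proof
  show "m \<in> torus_relations d" if "m + m \<in> torus_relations d" for m
  proof -
    \<comment> \<open>The relations form a rational subspace, so halving is possible; this is where
      2-torsion is lost.\<close>
    have "scale (1 / 2) (m + m) = m" by (rule poly_mapping_eqI) (simp add: lookup_add)
    then show ?thesis using relation_span_scale[OF torus_rels_subset that, of "1 / 2"] by simp
  qed
  show "a \<noteq> 0" if "a \<in> Units (torus_field d)" for a using that by (simp add: torus_field_units)
  show "x * y \<in> S" if "x \<in> S" "y \<in> S" for x y
  proof -
    from that obtain v w where "v \<in> carrier_vec d" "w \<in> carrier_vec d" "x = torus_char v" "y = torus_char w" by auto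
    then show ?thesis by (intro image_eqI[of _ _ "v + w"]) (auto simp: torus_char_add)
  qed
  show "basis_elt (torus_symbol_gen d (as @ (a * b) # bs)) - basis_elt (torus_symbol_gen d (as @ a # bs))
      - basis_elt (torus_symbol_gen d (as @ b # bs)) \<in> torus_relations d"
    if "length as + length bs + 1 = d" "set as \<subseteq> Units (torus_field d)" "set bs \<subseteq> Units (torus_field d)"
      "a \<in> Units (torus_field d)" "b \<in> Units (torus_field d)" for as bs a b
  proof -
    have "torus_symbol_gen d (as @ (a * b) # bs)
      = torus_symbol_gen d (as @ a # bs) \<otimes>\<^bsub>torus_K_coker d d\<^esub> torus_symbol_gen d (as @ b # bs)"
      using that milnor_symbol_mult_entry[OF F.ring_axioms that(2-5)] by (intro torus_symbol_gen_mult) auto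
    moreover have "torus_symbol_gen d (as @ c # bs) \<in> carrier (torus_K_coker d d)"
      if "c \<in> Units (torus_field d)" for c
      using that \<open>length as + length bs + 1 = d\<close> \<open>set as \<subseteq> _\<close> \<open>set bs \<subseteq> _\<close>
      by (intro torus_symbol_gen_closed) auto
    ultimately show ?thesis using that
      by (intro relation_span_incl[OF torus_rels_subset]) (auto simp: tensor_rat_rels_def)
  qed
  show "basis_elt (torus_symbol_gen d (as @ a # (1 - a) # bs)) \<in> torus_relations d"
    if "set as \<subseteq> Units (torus_field d)" "set bs \<subseteq> Units (torus_field d)"
      "a \<in> Units (torus_field d)" "1 - a \<in> Units (torus_field d)" for as bs a
  proof -
    have "\<one>\<^bsub>torus_field d\<^esub> \<ominus>\<^bsub>torus_field d\<^esub> a = 1 - a"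
      using that torus_units_closed(1) by (simp add: torus_field_minus torus_field_units)
    then have "milnor_symbol (torus_field d) (as @ a # (1 - a) # bs) = \<zero>\<^bsub>milnor_ring (torus_field d)\<^esub>"
      using milnor_symbol_steinberg_entry[OF F.ring_axioms that(1-3)] that(4) by simp
    also have "\<dots> = \<one>\<^bsub>Kd\<^esub>" by (simp add: milnor_K_eq[OF F.ring_axioms])
    finally show ?thesis using P.one_closed by (intro torus_symbol_gen_trivial) simp
  qed
  show "basis_elt (torus_symbol_gen d (as @ [\<chi>])) \<in> torus_relations d"
    if "length as + 1 = d" "set as \<subseteq> Units (torus_field d)" "\<chi> \<in> S" for as \<chi>
    using milnor_symbol_char_in_product_image[OF F.ring_axioms that(2,3) torus_chars_units] that(1)
    by (intro torus_symbol_gen_trivial) simp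
qed (use torus_units_closed torus_chars_units in auto)

lemma unimodular_symbol_torus:
  "unimodular_symbol (torus_relations d) d (\<lambda>v. basis_elt (torus_symbol_gen d (map (\<lambda>v. 1 - torus_char v) v)))"
  by (rule milnor_symbols.unimodular_symbol_chars[OF milnor_symbols_torus])
    (auto intro: torus_char_add torus_char_uminus torus_char_eq_one)

end

section \<open>Rational and integral frames\<close>

text \<open>Two coefficients make the notion free of division, so that it serves integral and
  rational vectors alike.\<close>

definition proportional :: "'a :: comm_ring_1 vec \<Rightarrow> 'a vec \<Rightarrow> bool" where
  "proportional x y \<longleftrightarrow> (\<exists>a b. a \<noteq> 0 \<and> b \<noteq> 0 \<and> a \<cdot>\<^sub>v x = b \<cdot>\<^sub>v y)"

lemma (in additive_subgroup_set) proportional_frames: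
  fixes us vs :: "'a :: idom vec list"
  assumes scale: "\<And>v i a. nonzero_frame d v \<Longrightarrow> i < d \<Longrightarrow> a \<noteq> 0 \<Longrightarrow> G (v[i := a \<cdot>\<^sub>v v ! i]) - G v \<in> N"
    and us: "nonzero_frame d us" and vs: "nonzero_frame d vs"
    and pr: "\<And>i. i < d \<Longrightarrow> proportional (us ! i) (vs ! i)"
  shows "G us - G vs \<in> N"
proof -
  note l = nonzero_frame_length[OF us] nonzero_frame_length[OF vs]
  \<comment> \<open>Entries are exchanged one at a time; \<open>?m k\<close> is the hybrid frame
    after \<open>k\<close> exchanges.\<close>
  let ?m = "\<lambda>k. take k us @ drop k vs"
  have m: "nonzero_frame d (?m k)" if "k \<le> d" for k
    using us vs l that set_take_subset[of k us] set_drop_subset[of k vs] by (auto simp: nonzero_frame_def)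
  have "k \<le> d \<Longrightarrow> G (?m k) - G vs \<in> N" for k
  proof (induction k)
    case (Suc k)
    then have k: "k < d" by simp
    have mk: "?m (Suc k) = (?m k)[k := us ! k]"
      using k l by (auto intro!: nth_equalityI simp: nth_append nth_list_update less_Suc_eq)
    obtain a b where ab: "a \<noteq> 0" "b \<noteq> 0" "a \<cdot>\<^sub>v us ! k = b \<cdot>\<^sub>v vs ! k"
      using pr[OF k] by (auto simp: proportional_def)
    have nth: "?m (Suc k) ! k = us ! k" "?m k ! k = vs ! k" using k l by (auto simp: nth_append)
    \<comment> \<open>Consecutive hybrids differ in slot \<open>k\<close> only and become equal once
      that slot is scaled by \<open>a\<close> in the later and by \<open>b\<close> in the earlier
      one.\<close>
    have "(?m (Suc k))[k := a \<cdot>\<^sub>v ?m (Suc k) ! k] = (?m k)[k := b \<cdot>\<^sub>v ?m k ! k]"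
      unfolding nth ab(3) unfolding mk by simp
    then have "(G (?m k) - G vs) + (G ((?m k)[k := b \<cdot>\<^sub>v ?m k ! k]) - G (?m k))
        - (G ((?m (Suc k))[k := a \<cdot>\<^sub>v ?m (Suc k) ! k]) - G (?m (Suc k))) \<in> N"
      using k by (intro add_mem diff_mem scale m ab Suc.IH) auto
    moreover note \<open>(?m (Suc k))[k := a \<cdot>\<^sub>v ?m (Suc k) ! k] = (?m k)[k := b \<cdot>\<^sub>v ?m k ! k]\<close>
    ultimately show ?case by simp
  qed (simp add: zero_mem)
  from this[of d] show ?thesis using l by simp
qed

lemma cdet_scaled:
  assumes "length us = d" "length vs = d" "\<And>i. i < d \<Longrightarrow> us ! i = c i \<cdot>\<^sub>v vs ! i" "set vs \<subseteq> carrier_vec d"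
  shows "cdet d us = (\<Prod>i<d. c i) * cdet d vs"
proof -
  have A: "mat_of_cols d us \<in> carrier_mat d d" "mat_of_cols d vs \<in> carrier_mat d d"
    using assms(1,2) mat_of_cols_carrier(1) by metis+
  have entry: "mat_of_cols d us $$ (i, j) = c j * mat_of_cols d vs $$ (i, j)" if "i < d" "j < d" for i j
  proof -
    have "vs ! j \<in> carrier_vec d" using that assms by (auto simp: subset_iff)
    then show ?thesis using that assms by (auto simp: mat_of_cols_index)
  qed
  have "(\<Prod>j<d. mat_of_cols d us $$ (p j, j)) = (\<Prod>j<d. c j) * (\<Prod>j<d. mat_of_cols d vs $$ (p j, j))"
    if p: "p permutes {0..<d}" for p
  proof -
    have "p j < d" if "j < d" for j using permutes_in_image[OF p, of j] that by simp
    then have "(\<Prod>j<d. mat_of_cols d us $$ (p j, j)) = (\<Prod>j<d. c j * mat_of_cols d vs $$ (p j, j))"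
      by (intro prod.cong entry) auto
    then show ?thesis by (simp only: prod.distrib)
  qed
  then show ?thesis
    unfolding det_col[OF A(1)] det_col[OF A(2)]
    by (simp add: sum_distrib_left mult.left_commute[of "signof _"])
qed

text \<open>\<open>lin_dep\<close> is a notion for sets, so repeated entries are treated apart; for
  distinct entries a dependence is a nonzero kernel vector of the matrix.\<close>

lemma dependent_list_iff:
  assumes "length vs = d" "set vs \<subseteq> carrier_vec d"
  shows "dependent_list d vs \<longleftrightarrow> cdet d vs = 0"
proof -
  interpret vec_space "TYPE(rat)" d .
  have A: "mat_of_cols d vs \<in> carrier_mat d d" using assms(1) mat_of_cols_carrier(1) by metis
  have cols: "cols (mat_of_cols d vs) = vs" using assms(2) by simp
  show ?thesis
  proof (cases "distinct vs")
    case True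
    show ?thesis
      unfolding dependent_list_def det_0_iff_vec_prod_zero_field[OF A]
      using True lin_depI[OF A] lin_depE[OF A] unfolding cols by metis
  next
    case False
    then obtain i j where "i < d" "j < d" "i \<noteq> j" "vs ! i = vs ! j"
      using assms(1) by (auto simp: distinct_conv_nth)
    then show ?thesis using False cdet_repeated[OF assms(1)] by (simp add: dependent_list_def)
  qed
qed

text \<open>Any integral nonzero multiple will do, so no canonical one such as the primitive vector
  is fixed. The price is that compatibility with scaling holds only up to
  \<open>proportional\<close>.\<close>

definition clear_denominators :: "rat vec \<Rightarrow> int vec" where
  "clear_denominators w = (SOME u. u \<in> carrier_vec (dim_vec w) \<and> (\<exists>c. c \<noteq> 0 \<and> map_vec rat_of_int u = c \<cdot>\<^sub>v w))"

lemma clear_denominators: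
  assumes "w \<in> carrier_vec d"
  obtains c where "clear_denominators w \<in> carrier_vec d" "c \<noteq> 0"
    "map_vec rat_of_int (clear_denominators w) = c \<cdot>\<^sub>v w"
proof -
  define den where "den i = snd (quotient_of (w $ i))" for i
  define c where "c = (\<Prod>i<d. den i)"
  have den: "den i > 0" "w $ i = of_int (fst (quotient_of (w $ i))) / of_int (den i)" for i
    using quotient_of_denom_pos' quotient_of_div[of "w $ i"] by (auto simp: den_def)
  have "den i \<noteq> 0" for i using den(1)[of i] by simp
  then have c: "c \<noteq> 0" by (simp add: c_def)
  have "\<exists>n. rat_of_int c * w $ i = of_int n" if "i < d" for i
  proof -
    have "den i dvd c" unfolding c_def using that by (intro dvd_prodI) auto
    then obtain k where "c = den i * k" by blast
    then show ?thesis using den[of i]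
      by (intro exI[of _ "k * fst (quotient_of (w $ i))"]) (simp add: field_simps)
  qed
  then obtain n where n: "\<And>i. i < d \<Longrightarrow> rat_of_int c * w $ i = of_int (n i)" by metis
  have "\<exists>u. u \<in> carrier_vec (dim_vec w) \<and> (\<exists>c. c \<noteq> 0 \<and> map_vec rat_of_int u = c \<cdot>\<^sub>v w)"
    using assms c n by (intro exI[of _ "Matrix.vec d n"] conjI exI[of _ "rat_of_int c"] eq_vecI) auto
  from someI_ex[OF this] show thesis
    using that assms unfolding clear_denominators_def by auto
qed

lemma of_int_vec_nonzero:
  "map_vec rat_of_int u \<in> carrier_vec d - {0\<^sub>v d} \<longleftrightarrow> u \<in> carrier_vec d - {0\<^sub>v d}"
  by (auto simp: vec_eq_iff)

lemma clear_denominators_nonzero: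
  assumes "w \<in> carrier_vec d - {0\<^sub>v d}"
  shows "clear_denominators w \<in> carrier_vec d - {0\<^sub>v d}"
proof -
  obtain c where "c \<noteq> 0" "map_vec rat_of_int (clear_denominators w) = c \<cdot>\<^sub>v w"
    using clear_denominators[of w d] assms by blast
  then show ?thesis using smult_vec_nonzero[OF assms] of_int_vec_nonzero[of _ d] by metis
qed

lemma proportional_of_int:
  assumes w: "w \<in> carrier_vec d" and u: "u \<in> carrier_vec d" "u' \<in> carrier_vec d"
    and c: "map_vec rat_of_int u = c \<cdot>\<^sub>v w" "map_vec rat_of_int u' = c' \<cdot>\<^sub>v w" "c \<noteq> 0" "c' \<noteq> 0"
  shows "proportional u u'"
proof -
  \<comment> \<open>With c'/c = p/q, the vectors satisfy p u = q u' with integral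
    coefficients.\<close>
  obtain p q where pq: "quotient_of (c' / c) = (p, q)" by force
  have q: "q > 0" using quotient_of_denom_pos[OF pq] .
  have cc: "c' / c = of_int p / of_int q" using quotient_of_div[OF pq] .
  then have p: "p \<noteq> 0" using c by auto
  have eq: "of_int p * c = of_int q * c'" using cc c q by (simp add: field_simps)
  have "p \<cdot>\<^sub>v u = q \<cdot>\<^sub>v u'"
  proof (rule eq_vecI)
    fix i assume i: "i < dim_vec (q \<cdot>\<^sub>v u')"
    have "map_vec rat_of_int u $ i = (c \<cdot>\<^sub>v w) $ i" "map_vec rat_of_int u' $ i = (c' \<cdot>\<^sub>v w) $ i"
      by (simp_all only: c)
    then have "rat_of_int (u $ i) = c * w $ i" "rat_of_int (u' $ i) = c' * w $ i"
      using i u w by auto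
    then have "rat_of_int (p * u $ i) = of_int (q * u' $ i)" using eq by (simp flip: mult.assoc)
    then show "(p \<cdot>\<^sub>v u) $ i = (q \<cdot>\<^sub>v u') $ i" using i u by (simp only: of_int_eq_iff) simp
  qed (use u in simp)
  moreover have "q \<noteq> 0" using q by simp
  ultimately show ?thesis using p unfolding proportional_def by blast
qed

abbreviation clear_frame :: "rat vec list \<Rightarrow> int vec list" where
  "clear_frame \<equiv> map clear_denominators"

abbreviation rat_frame :: "int vec list \<Rightarrow> rat vec list" where
  "rat_frame \<equiv> map (map_vec rat_of_int)"

lemma frames_iff: "vs \<in> frames d \<longleftrightarrow> nonzero_frame d vs"
  by (simp add: frames_def nonzero_frame_def)

lemma nonzero_clear_frame: "nonzero_frame d vs \<Longrightarrow> nonzero_frame d (clear_frame vs)"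
  unfolding nonzero_frame_def using clear_denominators_nonzero by auto

lemma nonzero_rat_frame: "nonzero_frame d vs \<Longrightarrow> nonzero_frame d (rat_frame vs)"
  unfolding nonzero_frame_def using of_int_vec_nonzero by auto

lemma cdet_rat_frame:
  "set vs \<subseteq> carrier_vec d \<Longrightarrow> cdet d (rat_frame vs) = of_int (cdet d vs)"
  using of_int_hom.hom_det[of "mat_of_cols d vs"] by (subst mat_of_cols_map) auto

lemma cdet_clear_frame:
  assumes "nonzero_frame d vs" "cdet d vs = 0"
  shows "cdet d (clear_frame vs) = 0"
proof -
  have "\<exists>c. i < d \<longrightarrow> map_vec rat_of_int (clear_denominators (vs ! i)) = c \<cdot>\<^sub>v vs ! i" for i
    using clear_denominators[of "vs ! i" d] nonzero_frame_nth[OF assms(1), of i] by blast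
  then obtain c where c: "\<And>i. i < d \<Longrightarrow> map_vec rat_of_int (clear_denominators (vs ! i)) = c i \<cdot>\<^sub>v vs ! i"
    by metis
  have "cdet d (rat_frame (clear_frame vs)) = 0"
    using cdet_scaled[of "rat_frame (clear_frame vs)" d vs c] c assms
    by (auto simp: nonzero_frame_def)
  then show ?thesis
    using nonzero_clear_frame[OF assms(1)] by (subst (asm) cdet_rat_frame) (auto simp: nonzero_frame_def)
qed

lemma proportional_clear_smult:
  assumes w: "w \<in> carrier_vec d" and c: "c \<noteq> 0"
  shows "proportional (clear_denominators (c \<cdot>\<^sub>v w)) (clear_denominators w)"
proof -
  obtain a where a: "clear_denominators (c \<cdot>\<^sub>v w) \<in> carrier_vec d" "a \<noteq> 0"
    "map_vec rat_of_int (clear_denominators (c \<cdot>\<^sub>v w)) = a \<cdot>\<^sub>v (c \<cdot>\<^sub>v w)"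
    using clear_denominators[of "c \<cdot>\<^sub>v w" d] w by auto
  obtain b where b: "clear_denominators w \<in> carrier_vec d" "b \<noteq> 0"
    "map_vec rat_of_int (clear_denominators w) = b \<cdot>\<^sub>v w"
    using clear_denominators[OF w] by auto
  show ?thesis
    using proportional_of_int[OF w a(1) b(1), of "a * c" b] a b c by (simp add: smult_smult_assoc)
qed

lemma proportional_clear_of_int:
  assumes "u \<in> carrier_vec d"
  shows "proportional (clear_denominators (map_vec rat_of_int u)) u"
proof -
  have w: "map_vec rat_of_int u \<in> carrier_vec d" using assms by simp
  obtain b where b: "clear_denominators (map_vec rat_of_int u) \<in> carrier_vec d" "b \<noteq> 0"
    "map_vec rat_of_int (clear_denominators (map_vec rat_of_int u)) = b \<cdot>\<^sub>v map_vec rat_of_int u"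
    using clear_denominators[OF w] by auto
  show ?thesis
    using proportional_of_int[OF w b(1) assms, of b 1] b by simp
qed

lemma proportional_refl: "proportional x x"
  unfolding proportional_def by (intro exI[of _ 1]) simp

text \<open>Induction over a decomposition into transpositions, each of which changes both parity
  and sign. \<open>Q\<close> must survive swaps, because the induction hypothesis is applied to the
  swapped list.\<close>

lemma (in additive_subgroup_set) skew_permute:
  assumes skew: "\<And>v i j. Q v \<Longrightarrow> i < d \<Longrightarrow> j < d \<Longrightarrow> i \<noteq> j \<Longrightarrow> G (swap_entries i j v) + G v \<in> N"
    and swap: "\<And>v i j. Q v \<Longrightarrow> i < d \<Longrightarrow> j < d \<Longrightarrow> Q (swap_entries i j v)"
    and len: "\<And>v. Q v \<Longrightarrow> length v = d"
    and p: "p permutes {..<d}" and v: "Q v"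
  shows "G (permute_list p v) - (if evenperm p then G v else - G v) \<in> N"
proof -
  have tr: "permute_list (Transposition.transpose a b) v = swap_entries a b v"
    if "a < d" "b < d" "Q v" for a b v
    using that len[OF that(3)]
    by (auto intro!: nth_equalityI simp: permute_list_def nth_list_update Transposition.transpose_def)
  have "permutation p \<and> (\<forall>v. Q v \<longrightarrow> G (permute_list p v) - (if evenperm p then G v else - G v) \<in> N)"
    using p finite_lessThan[of d]
  proof (induction rule: permutes_induct)
    case id
    then show ?case by (simp add: zero_mem)
  next
    case (swap a b p)
    let ?t = "Transposition.transpose a b"
    have ab: "a < d" "b < d" "a \<noteq> b" using swap.hyps by auto
    have ev: "evenperm (?t \<circ> p) \<longleftrightarrow> \<not> evenperm p"
      using swap.IH ab by (simp add: evenperm_comp evenperm_swap permutation_swap_id)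
    show ?case
    proof (intro conjI allI impI)
      show "permutation (?t \<circ> p)"
        using swap.IH by (intro permutation_compose permutation_swap_id) auto
      fix v assume v: "Q v"
      have "permute_list (?t \<circ> p) v = permute_list p (swap_entries a b v)"
        using swap.hyps len[OF v] ab v by (simp add: permute_list_compose tr)
      moreover have "G (permute_list p (swap_entries a b v))
          - (if evenperm p then G (swap_entries a b v) else - G (swap_entries a b v)) \<in> N"
        using swap.IH assms(2)[OF v ab(1,2)] by blast
      moreover note skew[OF v ab]
      ultimately show "G (permute_list (?t \<circ> p) v) - (if evenperm (?t \<circ> p) then G v else - G v) \<in> N"
        unfolding ev using add_mem diff_mem by (cases "evenperm p") fastforce+
    qed
  qed
  then show ?thesis using v by blast
qed

text \<open>Counting vertices of (w, v) from 0, removing vertex k + 1 carries the sign (-1)^(k + 1),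
  and moving \<open>w\<close> from the front into slot \<open>k\<close> costs (-1)^k; such a face
  therefore contributes \<open>- G (v[k := w])\<close>.\<close>

lemma face_sum:
  fixes G :: "'a list \<Rightarrow> 'm :: ab_group_add"
  assumes "skew_list_function N d T G" and v: "length v = d" "set v \<subseteq> T" and w: "w \<in> T"
  shows "(\<Sum>i\<le>d. signed i (G (take i (w # v) @ drop (Suc i) (w # v)))) - defect d G v w \<in> N"
proof -
  interpret skew_list_function N d T G by fact
  have "signed (Suc k) (G (w # take k v @ drop (Suc k) v)) - (- G (v[k := w])) \<in> N" if k: "k < d" for k
  proof -
    have s: "set (take k v) \<subseteq> T" "set (drop (Suc k) v) \<subseteq> T"
      using v(2) set_take_subset[of k v] set_drop_subset[of "Suc k" v] by auto
    have "G ([] @ w # take k v @ drop (Suc k) v) - signed (length (take k v)) (G ([] @ take k v @ w # drop (Suc k) v)) \<in> N"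
      using k v s w by (intro move) auto
    then have "G (w # take k v @ drop (Suc k) v) - signed k (G (v[k := w])) \<in> N"
      using k v by (simp add: upd_conv_take_nth_drop min_def)
    then have "signed (Suc k) (G (w # take k v @ drop (Suc k) v) - signed k (G (v[k := w]))) \<in> N"
      by (simp only: signed_mem_iff)
    then show ?thesis by (simp add: signed_diff) (simp add: signed_def split: if_splits)
  qed
  then have "(\<Sum>k<d. signed (Suc k) (G (w # take k v @ drop (Suc k) v))) - (\<Sum>k<d. - G (v[k := w])) \<in> N"
    by (intro diff_sum_mem) simp
  moreover have "(\<Sum>i\<le>d. signed i (G (take i (w # v) @ drop (Suc i) (w # v))))
    = G v + (\<Sum>k<d. signed (Suc k) (G (w # take k v @ drop (Suc k) v)))"
    by (subst sum.atMost_shift) simp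
  ultimately show ?thesis by (simp add: defect_def sum_negf)
qed

section \<open>The map out of the Steinberg module\<close>

lemma swap_entries_adjacent:
  "swap_entries (length as) (Suc (length as)) (as @ a # b # bs) = as @ b # a # bs"
  by (simp add: list_update_append nth_append)

lemma (in additive_subgroup_set) skew_list_function_frames:
  fixes G :: "'v :: zero vec list \<Rightarrow> 'm"
  assumes "\<And>v i j. nonzero_frame d v \<Longrightarrow> i < d \<Longrightarrow> j < d \<Longrightarrow> i \<noteq> j \<Longrightarrow> G (swap_entries i j v) + G v \<in> N"
  shows "skew_list_function N d (carrier_vec d - {0\<^sub>v d}) G"
proof
  fix as bs :: "'v vec list" and a b :: "'v vec"
  assume as: "length as + length bs + 2 = d" "set as \<subseteq> carrier_vec d - {0\<^sub>v d}" "set bs \<subseteq> carrier_vec d - {0\<^sub>v d}"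
    "a \<in> carrier_vec d - {0\<^sub>v d}" "b \<in> carrier_vec d - {0\<^sub>v d}"
  then have "nonzero_frame d (as @ b # a # bs)" by (auto simp: nonzero_frame_def)
  from assms[OF this, of "length as" "Suc (length as)"] as(1)
  show "G (as @ a # b # bs) + G (as @ b # a # bs) \<in> N"
    unfolding swap_entries_adjacent by simp
qed

context unimodular_symbol
begin

text \<open>Take a v_i as apex over \<open>v\<close>: every new face but the \<open>i\<close>-th
  contains two proportional entries and vanishes, so the cocycle relation is the claim.\<close>

lemma F_scale:
  assumes v: "nonzero_frame d v" and i: "i < d" and a: "a \<noteq> 0"
  shows "F (v[i := a \<cdot>\<^sub>v v ! i]) - F v \<in> N"
proof -
  note l = nonzero_frame_length[OF v]
  have vi: "v ! i \<in> carrier_vec d" using nonzero_frame_nth[OF v i] by simp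
  have "(\<Sum>j<d. F (v[j := a \<cdot>\<^sub>v v ! i])) = (\<Sum>j\<in>{i}. F (v[j := a \<cdot>\<^sub>v v ! i]))"
    using i vi l by (intro sum.mono_neutral_right) (auto simp: F_dependent cdet_update_smult cdet_nth)
  then show ?thesis
    using minus_mem[OF F_cocycle[OF v smult_vec_nonzero[OF nonzero_frame_nth[OF v i] a]]]
    by (simp add: defect_def)
qed

text \<open>\<open>F\<close> arises from values of \<open>f\<close> by sums alone. It is applied to
  the elements supported on the generators of the target.\<close>

lemma F_in_subgroup:
  assumes "additive_subgroup_set M" and f: "\<And>v. integral_frame d v \<Longrightarrow> f v \<in> M"
  shows "nonzero_frame d v \<Longrightarrow> F v \<in> M"
proof (induction v rule: F.induct)
  case (1 v)
  interpret M: additive_subgroup_set M by fact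
  note l = nonzero_frame_length[OF 1(2)]
  show ?case
  proof (cases "\<bar>cdet d v\<bar> > 1")
    case True
    then have "(\<Sum>i<d. F (v[i := cut v])) \<in> M"
      using 1 l nonzero_frame_update[OF 1(2) cut(1)[OF l True]] by (intro M.sum_mem) auto
    then show ?thesis using True l by (simp add: F.simps[of v])
  next
    case False
    then have "cdet d v = 0 \<or> integral_frame d v" using 1(2) by (auto simp: integral_frame_iff)
    then show ?thesis
      using f M.zero_mem by (auto simp: F_dependent F_unimodular integral_frame_iff)
  qed
qed

sublocale F: skew_list_function N d "carrier_vec d - {0\<^sub>v d}" F
  by (rule skew_list_function_frames) (rule F_swap)

end

lemma scale_neg_one_power: "scale ((- 1) ^ i) x = signed i x"
  by (cases "even i") (simp_all add: signed_def)

lemma single_neg_one_power: "Poly_Mapping.single g ((- 1 :: rat) ^ i) = signed i (basis_elt g)"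
  by (cases "even i") (simp_all add: signed_def single_uminus)

lemma scale_sign: "scale (of_int (sign p)) x = (if evenperm p then x else - x)"
  by (simp add: sign_def)

lemma steinberg_map_exists:
  obtains K where "K \<in> extensional (carrier (steinberg d))" "linear_map class_ring (steinberg d) (torus_K d d) K"
    "\<And>vs. integral_frame d vs \<Longrightarrow>
      K (apartment d (rat_frame vs)) = torus_symbol d (map (\<lambda>v. 1 - torus_char v) vs)"
proof -
  let ?A = "carrier (torus_K_coker d d)"
  let ?f = "\<lambda>v. basis_elt (torus_symbol_gen d (map (\<lambda>v. 1 - torus_char v) v))"
  interpret unimodular_symbol "torus_relations d" d ?f by (rule unimodular_symbol_torus)
  \<comment> \<open>A rational frame is read through an integral representative;
    \<open>F_scale\<close> makes the arbitrary multiples harmless.\<close>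
  define \<phi> where "\<phi> vs = F (clear_frame vs)" for vs
  have keys: "Poly_Mapping.keys (F v) \<subseteq> ?A" if "nonzero_frame d v" for v
  proof -
    have "additive_subgroup_set {x :: _ \<Rightarrow>\<^sub>0 rat. Poly_Mapping.keys x \<subseteq> ?A}"
    proof (unfold_locales, unfold mem_Collect_eq)
      show "Poly_Mapping.keys (x - y) \<subseteq> ?A" if "Poly_Mapping.keys x \<subseteq> ?A" "Poly_Mapping.keys y \<subseteq> ?A"
        for x y :: "_ \<Rightarrow>\<^sub>0 rat"
        using keys_diff[of x y] that by blast
    qed simp
    moreover have "?f v \<in> {x. Poly_Mapping.keys x \<subseteq> ?A}" if v: "integral_frame d v" for v
    proof -
      have "1 - torus_char u \<in> Units (torus_field d)" if "u \<in> set v" for u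
        using v that torus_char_unit torus_char_eq_one
        by (intro torus_units_closed(5)) (auto simp: integral_frame_iff nonzero_frame_def)
      then show ?thesis
        using v torus_symbol_gen_closed[of "map (\<lambda>v. 1 - torus_char v) v" d]
        by (auto simp: integral_frame_def)
    qed
    ultimately show ?thesis using F_in_subgroup[OF _ _ that, of "{x. Poly_Mapping.keys x \<subseteq> ?A}"] by blast
  qed
  have rel: "linear_extension \<phi> r \<in> torus_relations d" if r: "r \<in> steinberg_rels d" for r
  proof -
    consider (dep) vs where "r = basis_elt vs" "nonzero_frame d vs" "dependent_list d vs"
      | (perm) p vs where "r = basis_elt (permute_list p vs) - Poly_Mapping.single vs (of_int (sign p))"
        "nonzero_frame d vs" "p permutes {..<d}"
      | (smult) vs i c where "r = basis_elt (vs[i := c \<cdot>\<^sub>v (vs ! i)]) - basis_elt vs"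
        "nonzero_frame d vs" "i < d" "c \<noteq> 0"
      | (face) ws where "r = (\<Sum>i\<le>d. Poly_Mapping.single (take i ws @ drop (Suc i) ws) ((-1) ^ i))"
        "length ws = Suc d" "set ws \<subseteq> carrier_vec d - {0\<^sub>v d}"
      using r unfolding steinberg_rels_def frames_iff by blast
    then show ?thesis
    proof cases
      case dep
      have "cdet d vs = 0"
        using iffD1[OF dependent_list_iff dep(3)] dep(2) unfolding nonzero_frame_def by blast
      then have "cdet d (clear_frame vs) = 0" by (rule cdet_clear_frame[OF dep(2)])
      then show ?thesis by (simp add: dep(1) \<phi>_def F_dependent zero_mem)
    next
      case perm
      let ?u = "clear_frame vs"
      have u: "nonzero_frame d ?u" by (rule nonzero_clear_frame[OF perm(2)])
      have "F (permute_list p ?u) - (if evenperm p then F ?u else - F ?u) \<in> torus_relations d"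
        by (rule skew_permute[where Q = "nonzero_frame d" and d = d])
          (use F_swap nonzero_frame_swap nonzero_frame_length perm(3) u in blast)+
      moreover have "clear_frame (permute_list p vs) = permute_list p ?u"
        using perm(3) nonzero_frame_length[OF perm(2)] by (simp add: permute_list_map)
      ultimately show ?thesis by (simp add: perm(1) linear_extension_diff \<phi>_def scale_sign)
    next
      case smult
      have vi: "vs ! i \<in> carrier_vec d - {0\<^sub>v d}" by (rule nonzero_frame_nth[OF smult(2,3)])
      have "F (clear_frame (vs[i := c \<cdot>\<^sub>v (vs ! i)])) - F (clear_frame vs) \<in> torus_relations d"
      proof (rule proportional_frames[OF F_scale])
        show "nonzero_frame d (clear_frame (vs[i := c \<cdot>\<^sub>v (vs ! i)]))" "nonzero_frame d (clear_frame vs)"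
          by (intro nonzero_clear_frame scale_entry(1) smult)+
        show "proportional (clear_frame (vs[i := c \<cdot>\<^sub>v (vs ! i)]) ! j) (clear_frame vs ! j)" if "j < d" for j
          using that smult vi nonzero_frame_length[OF smult(2)]
          by (cases "j = i") (auto intro: proportional_clear_smult proportional_refl)
      qed
      then show ?thesis by (simp add: smult(1) linear_extension_diff \<phi>_def)
    next
      case face
      then obtain w v where ws: "ws = w # v" by (cases ws) auto
      have v: "nonzero_frame d v" "w \<in> carrier_vec d - {0\<^sub>v d}"
        using face ws by (auto simp: nonzero_frame_def)
      have v': "nonzero_frame d (clear_frame v)" "clear_denominators w \<in> carrier_vec d - {0\<^sub>v d}"
        using nonzero_clear_frame[OF v(1)] clear_denominators_nonzero[OF v(2)] by auto
      have "(\<Sum>i\<le>d. signed i (F (take i (clear_frame ws) @ drop (Suc i) (clear_frame ws))))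
          - defect d F (clear_frame v) (clear_denominators w) \<in> torus_relations d"
        using face_sum[OF F.skew_list_function_axioms, of "clear_frame v" "clear_denominators w"] v'
        by (simp add: ws nonzero_frame_def)
      \<comment> \<open>Clearing denominators acts entrywise, so it commutes with taking
        faces.\<close>
      from add_mem[OF this F_cocycle[OF v']]
      have "(\<Sum>i\<le>d. signed i (\<phi> (take i ws @ drop (Suc i) ws))) \<in> torus_relations d"
        by (simp add: \<phi>_def take_map drop_map)
      then show ?thesis by (simp add: face(1) linear_extension_sum scale_neg_one_power)
    qed
  qed
  have kphi: "Poly_Mapping.keys (\<phi> g) \<subseteq> ?A" if "g \<in> frames d" for g
    using keys nonzero_clear_frame that by (simp add: \<phi>_def frames_iff)
  obtain K where K: "K \<in> extensional (carrier (steinberg d))"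
    "linear_map class_ring (steinberg d) (torus_K d d) K"
    "\<And>g. g \<in> frames d \<Longrightarrow> K (apartment d g) = torus_relations d +>\<^bsub>free_vs ?A\<^esub> \<phi> g"
    using presented_vs_map_exists[of "steinberg_rels d" "frames d" "tensor_rat_rels (torus_K_coker d d)" ?A \<phi>,
        OF steinberg_rels_subset torus_rels_subset kphi rel]
    unfolding steinberg_def torus_K_def tensor_rat_def apartment_def by blast
  have "K (apartment d (rat_frame vs)) = torus_symbol d (map (\<lambda>v. 1 - torus_char v) vs)"
    if vs: "integral_frame d vs" for vs
  proof -
    have v: "nonzero_frame d vs" "\<bar>cdet d vs\<bar> = 1" using vs by (auto simp: integral_frame_iff)
    note l = nonzero_frame_length[OF v(1)]
    \<comment> \<open>\<open>clear_frame\<close> need not return \<open>vs\<close> itself, only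
      multiples of its entries.\<close>
    have "F (clear_frame (rat_frame vs)) - F vs \<in> torus_relations d"
    proof (rule proportional_frames[OF F_scale])
      show "nonzero_frame d (clear_frame (rat_frame vs))"
        by (intro nonzero_clear_frame nonzero_rat_frame v)
      show "proportional (clear_frame (rat_frame vs) ! i) (vs ! i)" if "i < d" for i
        using that l nonzero_frame_nth[OF v(1) that] by (auto intro: proportional_clear_of_int)
    qed (assumption | rule v(1))+
    then have "torus_relations d +>\<^bsub>free_vs ?A\<^esub> \<phi> (rat_frame vs) = torus_relations d +>\<^bsub>free_vs ?A\<^esub> ?f vs"
      by (simp add: coset_eq_iff[OF torus_rels_subset] \<phi>_def F_unimodular[OF v(2)])
    then show ?thesis
      using K(3)[of "rat_frame vs"] nonzero_rat_frame[OF v(1)] l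
      by (simp add: frames_iff torus_symbol_eq)
  qed
  with K(1,2) show thesis by (rule that)
qed

section \<open>Generation by integral apartments and uniqueness\<close>

abbreviation steinberg_relations :: "nat \<Rightarrow> (rat vec list \<Rightarrow>\<^sub>0 rat) set" where
  "steinberg_relations d \<equiv> relation_span (frames d) (steinberg_rels d)"

context
  fixes d :: nat
begin

interpretation N: additive_subgroup_set "steinberg_relations d"
  by (rule additive_subgroup_relation_span[OF steinberg_rels_subset])

lemma steinberg_dependent:
  assumes "nonzero_frame d vs" "cdet d vs = 0"
  shows "basis_elt vs \<in> steinberg_relations d"
proof -
  have "dependent_list d vs" using assms by (subst dependent_list_iff) (auto simp: nonzero_frame_def)
  then show ?thesis
    using assms(1) by (intro relation_span_incl[OF steinberg_rels_subset]) (unfold steinberg_rels_def frames_iff, blast)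
qed

lemma steinberg_scale:
  "nonzero_frame d vs \<Longrightarrow> i < d \<Longrightarrow> c \<noteq> 0 \<Longrightarrow>
    basis_elt (vs[i := c \<cdot>\<^sub>v vs ! i]) - basis_elt vs \<in> steinberg_relations d"
  by (rule relation_span_incl[OF steinberg_rels_subset]) (unfold steinberg_rels_def frames_iff, blast)

lemma steinberg_swap:
  assumes vs: "nonzero_frame d vs" and ij: "i < d" "j < d" "i \<noteq> j"
  shows "basis_elt (swap_entries i j vs) + basis_elt vs \<in> steinberg_relations d"
proof -
  let ?t = "Transposition.transpose i j"
  have "?t permutes {..<d}" using ij by (intro permutes_swap_id) auto
  then have "basis_elt (permute_list ?t vs) - Poly_Mapping.single vs (of_int (sign ?t)) \<in> steinberg_relations d"
    using vs by (intro relation_span_incl[OF steinberg_rels_subset]) (unfold steinberg_rels_def frames_iff, blast)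
  moreover have "permute_list ?t vs = swap_entries i j vs"
    using ij nonzero_frame_length[OF vs]
    by (auto intro!: nth_equalityI simp: permute_list_def nth_list_update Transposition.transpose_def)
  ultimately show ?thesis using ij by (simp add: sign_swap_id single_uminus)
qed

text \<open>\<open>face_sum\<close> for the basis elements themselves, which are skew-symmetric
  modulo the relations.\<close>

lemma steinberg_defect:
  assumes v: "nonzero_frame d v" and w: "w \<in> carrier_vec d - {0\<^sub>v d}"
  shows "defect d (basis_elt :: _ \<Rightarrow> (rat vec list \<Rightarrow>\<^sub>0 rat)) v w \<in> steinberg_relations d"
proof -
  let ?ws = "w # v"
  have "(\<Sum>i\<le>d. Poly_Mapping.single (take i ?ws @ drop (Suc i) ?ws) ((-1 :: rat) ^ i)) \<in> steinberg_relations d"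
  proof (rule relation_span_incl[OF steinberg_rels_subset])
    have "length ?ws = Suc d" "set ?ws \<subseteq> carrier_vec d - {0\<^sub>v d}"
      using v w by (auto simp: nonzero_frame_def)
    then show "(\<Sum>i\<le>d. Poly_Mapping.single (take i ?ws @ drop (Suc i) ?ws) ((-1 :: rat) ^ i)) \<in> steinberg_rels d"
      unfolding steinberg_rels_def by blast
  qed
  then have "(\<Sum>i\<le>d. signed i (basis_elt (take i ?ws @ drop (Suc i) ?ws))) \<in> steinberg_relations d"
    unfolding single_neg_one_power .
  moreover have "(\<Sum>i\<le>d. signed i (basis_elt (take i ?ws @ drop (Suc i) ?ws))) - defect d basis_elt v w
      \<in> steinberg_relations d"
    by (rule face_sum[OF N.skew_list_function_frames[OF steinberg_swap]])
      (use v w in \<open>auto simp: nonzero_frame_def\<close>)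
  ultimately show ?thesis using N.diff_mem by fastforce
qed

text \<open>\<open>E\<close> will be the set where two candidate maps agree. Integral frames are
  treated by descent on the absolute determinant; a rational frame is congruent to an integral one
  by the scaling relations.\<close>

lemma steinberg_generated_by_integral:
  assumes "additive_subgroup_set E" and rel: "steinberg_relations d \<subseteq> E"
    and int: "\<And>v. integral_frame d v \<Longrightarrow> basis_elt (rat_frame v) \<in> E"
  shows "nonzero_frame d vs \<Longrightarrow> basis_elt vs \<in> E"
proof -
  interpret E: additive_subgroup_set E by fact
  have E: "basis_elt (rat_frame v) \<in> E" if "nonzero_frame d v" for v
    using that
  proof (induction "nat \<bar>cdet d v\<bar>" arbitrary: v rule: less_induct)
    case (less v)
    note l = nonzero_frame_length[OF less.prems]
    consider "cdet d v = 0" | "\<bar>cdet d v\<bar> = 1" | "\<bar>cdet d v\<bar> > 1" by linarith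
    then show ?case
    proof cases
      case 1
      then have "cdet d (rat_frame v) = 0"
        using less.prems by (subst cdet_rat_frame) (auto simp: nonzero_frame_def)
      then show ?thesis using steinberg_dependent[OF nonzero_rat_frame[OF less.prems]] rel by blast
    next
      case 2
      then show ?thesis using int less.prems by (simp add: integral_frame_iff)
    next
      case 3
      obtain w where w: "w \<in> carrier_vec d - {0\<^sub>v d}"
        and co: "\<And>i. i < d \<Longrightarrow> 0 \<le> coord d v w i \<and> coord d v w i < 1"
        using lattice_point_in_parallelepiped[OF l 3] by blast
      have "basis_elt (rat_frame (v[i := w])) \<in> E" if i: "i < d" for i
      proof (rule less.hyps)
        show "nat \<bar>cdet d (v[i := w])\<bar> < nat \<bar>cdet d v\<bar>"
          using abs_cdet_update_less[of d v i w] co[OF i] 3 by auto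
      qed (rule nonzero_frame_update[OF less.prems w])
      then have "(\<Sum>i<d. basis_elt (rat_frame (v[i := w]))) \<in> E" by (intro E.sum_mem) simp
      moreover have "defect d (basis_elt :: _ \<Rightarrow> (rat vec list \<Rightarrow>\<^sub>0 rat)) (rat_frame v) (map_vec rat_of_int w) \<in> E"
        using steinberg_defect[OF nonzero_rat_frame[OF less.prems]] w of_int_vec_nonzero[of w d] rel by blast
      ultimately show ?thesis
        using E.add_mem by (fastforce simp: defect_def map_update)
    qed
  qed
  show "basis_elt vs \<in> E" if vs: "nonzero_frame d vs"
  proof -
    have "basis_elt (rat_frame (clear_frame vs)) - basis_elt vs \<in> steinberg_relations d"
    proof (rule N.proportional_frames[OF steinberg_scale])
      show "nonzero_frame d (rat_frame (clear_frame vs))"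
        by (intro nonzero_clear_frame nonzero_rat_frame vs)
      show "proportional (rat_frame (clear_frame vs) ! i) (vs ! i)" if i: "i < d" for i
      proof -
        obtain c where "c \<noteq> 0" "map_vec rat_of_int (clear_denominators (vs ! i)) = c \<cdot>\<^sub>v vs ! i"
          using clear_denominators[of "vs ! i" d] nonzero_frame_nth[OF vs i] by blast
        then show ?thesis using i nonzero_frame_length[OF vs]
          unfolding proportional_def by (intro exI[of _ 1] exI[of _ c]) simp
      qed
    qed (assumption | rule vs)+
    from E.diff_mem[OF E[OF nonzero_clear_frame[OF vs]] subsetD[OF rel this]] show ?thesis by simp
  qed
qed

end

lemma steinberg_map_unique:
  assumes K: "linear_map class_ring (steinberg d) W K" "linear_map class_ring (steinberg d) W K'"
    and ext: "K \<in> extensional (carrier (steinberg d))" "K' \<in> extensional (carrier (steinberg d))"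
    and eq: "\<And>vs. integral_frame d vs \<Longrightarrow> K (apartment d (rat_frame vs)) = K' (apartment d (rat_frame vs))"
  shows "K = K'"
proof -
  note u = presented_vs_map_unique[OF steinberg_rels_subset K[unfolded steinberg_def] ext[unfolded steinberg_def]]
  show ?thesis
  proof (rule u(4))
    fix vs assume vs: "vs \<in> frames d"
    show "basis_elt vs \<in> {x. Poly_Mapping.keys x \<subseteq> frames d \<and>
        K (steinberg_relations d +>\<^bsub>free_vs (frames d)\<^esub> x) = K' (steinberg_relations d +>\<^bsub>free_vs (frames d)\<^esub> x)}"
      by (rule steinberg_generated_by_integral[OF u(1,2)])
        (use vs eq nonzero_rat_frame in \<open>auto simp: frames_iff integral_frame_iff apartment_def presented_gen_def\<close>)
  qed
qed

text \<open>Functions of the logic are total, so uniqueness requires that the values outside the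
  carrier be fixed; this is the purpose of \<open>extensional\<close>.\<close>

theorem theorem46:
  fixes d :: nat
  shows "\<exists>!K. K \<in> extensional (carrier (steinberg d)) \<and>
    linear_map class_ring (steinberg d) (torus_K d d) K \<and>
    (\<forall>vs :: int vec list. integral_frame d vs \<longrightarrow>
      K (apartment d (map (map_vec rat_of_int) vs)) = torus_symbol d (map (\<lambda>v. 1 - torus_char v) vs))"
proof -
  obtain K where "K \<in> extensional (carrier (steinberg d))"
    "linear_map class_ring (steinberg d) (torus_K d d) K"
    "\<And>vs. integral_frame d vs \<Longrightarrow>
      K (apartment d (rat_frame vs)) = torus_symbol d (map (\<lambda>v. 1 - torus_char v) vs)"
    using steinberg_map_exists[of d] by blast
  then show ?thesis
    by (intro ex1I[of _ K] conjI allI impI) (auto intro!: steinberg_map_unique)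
qed

end
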